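(* Let $\mathcal{N},\mathcal{M}\subset\mathbb{N}$ be two infinite subsets of indices, and set $$C=\{k\in\mathbb{N}\cup\{0\}\colon 2^k+i\in\mathcal{N}\text{ for some } i\in\{1,\dots,2^k\}\},$$ $$D=\{s\in\mathbb{N}\cup\{0\}\colon 2^s+i\in\mathcal{M}\text{ for some } i\in\{1,\dots,2^s\}\}.$$ Then there exists a non-negative function $f\in L^1([0,1)^2)$ such that for almost every $z\in[0,1)^2$ both $$\lim_{\substack{n,m\to\infty;\\ n,m\in\mathcal{N}}}S_{n,m}f(z)=f(z)\qquad\text{and}\qquad \limsup_{\substack{n,m\to\infty;\\ n,m\in\mathcal{M}}}|S_{n,m}f(z)|=\infty$$ hold, if and only if $$\sup_{n\in D}\operatorname{dist}(n,C)=\infty,$$ where $\operatorname{dist}(n,C)=\min_{m\in C}|n-m|$.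
   Context: $\mathbb{N}=\{1,2,3,\dots\}$; "almost every" refers to Lebesgue measure. The one-dimensional Haar system $\{h_m\}_{m\in\mathbb{N}}$ on $[0,1)$ is: $h_1\equiv 1$, and for $m=2^k+i$ with $k\in\mathbb{N}\cup\{0\}$, $i\in\{1,\dots,2^k\}$, $$h_m(x)=\begin{cases}2^{k/2} & x\in\left(\frac{i-1}{2^k},\frac{2i-1}{2^{k+1}}\right),\\ -2^{k/2} & x\in\left(\frac{2i-1}{2^{k+1}},\frac{i}{2^k}\right),\\ 0 & x\notin\left[\frac{i-1}{2^k},\frac{i}{2^k}\right],\end{cases}$$ where at inner points of discontinuity $h_m$ is the mean of its left and right limits, and at the endpoints of the unit interval it is the limit from inside. The two-dimensional Haar system is $H_{i,j}(x,y)=h_i(x)h_j(y)$, $(i,j)\in\mathbb{N}^2$. For $f\in L^1([0,1)^2)$ and $n,m\in\mathbb{N}$, the rectangular partial sums are $$S_{n,m}f=\sum_{1\le i\le n,\ 1\le j\le m}\langle f,H_{i,j}\rangle H_{i,j},\qquad \langle f,H_{i,j}\rangle=\int_{[0,1)^2}fH_{i,j}\,dx\,dy.$$ The limit and limsup as $n,m\to\infty$ are taken as $\min\{n,m\}\to\infty$, with both indices in the indicated set. *)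

theory Defs
  imports "HOL-Analysis.Analysis" "HOL-Library.Discrete_Functions"
begin

text \<open>The values at the jump points in \<open>haar_step\<close> are irrelevant; they are fixed in \<open>haar\<close>.\<close>

definition haar_step :: "nat \<Rightarrow> nat \<Rightarrow> real \<Rightarrow> real" where
  "haar_step k i x =
     (if (real i - 1) / 2 ^ k < x \<and> x < (2 * real i - 1) / 2 ^ (k + 1) then 2 powr (real k / 2)
      else if (2 * real i - 1) / 2 ^ (k + 1) < x \<and> x < real i / 2 ^ k then - (2 powr (real k / 2))
      else 0)"

text \<open>At points of continuity the mean of the one-sided limits is the value of \<open>haar_step\<close>, so the
  mean can be taken at every point other than 0 and 1. Every \<open>m \<ge> 2\<close> is uniquely \<open>2 ^ k + i\<close> with
  \<open>1 \<le> i \<le> 2 ^ k\<close>, and then \<open>k = floor_log (m - 1)\<close>; see \<open>haar_index\<close> below.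
  The index \<open>m = 0\<close> is not used.\<close>

definition haar :: "nat \<Rightarrow> real \<Rightarrow> real" where
  "haar m x =
     (if m = 1 then 1
      else let k = floor_log (m - 1); h = haar_step k (m - 2 ^ k)
           in if x = 0 then Lim (at_right 0) h
              else if x = 1 then Lim (at_left 1) h
              else (Lim (at_left x) h + Lim (at_right x) h) / 2)"

definition haar2 :: "nat \<Rightarrow> nat \<Rightarrow> real \<times> real \<Rightarrow> real" where
  "haar2 i j = (\<lambda>(x, y). haar i x * haar j y)"

definition unit_square :: "(real \<times> real) set" where
  "unit_square = {0..<1} \<times> {0..<1}"

definition haar_coeff :: "(real \<times> real \<Rightarrow> real) \<Rightarrow> nat \<Rightarrow> nat \<Rightarrow> real" where
  "haar_coeff f i j = (LINT z:unit_square|lebesgue. f z * haar2 i j z)"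

definition haar_partial_sum :: "nat \<Rightarrow> nat \<Rightarrow> (real \<times> real \<Rightarrow> real) \<Rightarrow> real \<times> real \<Rightarrow> real" where
  "haar_partial_sum n m f z = (\<Sum>i = 1..n. \<Sum>j = 1..m. haar_coeff f i j * haar2 i j z)"

text \<open>\<open>min {n, m} \<rightarrow> \<infinity>\<close> with both \<open>n\<close> and \<open>m\<close> restricted to \<open>A\<close>.\<close>

definition both_to_infinity_in :: "nat set \<Rightarrow> (nat \<times> nat) filter" where
  "both_to_infinity_in A = inf (filtercomap (\<lambda>(n, m). min n m) at_top) (principal (A \<times> A))"

definition haar_levels :: "nat set \<Rightarrow> nat set" where
  "haar_levels A = {k. \<exists>i\<in>{1..2 ^ k}. 2 ^ k + i \<in> A}"

lemma floor_log_haar_index: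
  assumes "i \<in> {1..2 ^ k}"
  shows "floor_log (2 ^ k + i - 1) = k"
  by (rule floor_log_eqI) (use assms in auto)

lemma haar_index:
  assumes "i \<in> {1..2 ^ k}"
  shows "haar (2 ^ k + i) x =
    (if x = 0 then Lim (at_right 0) (haar_step k i)
     else if x = 1 then Lim (at_left 1) (haar_step k i)
     else (Lim (at_left x) (haar_step k i) + Lim (at_right x) (haar_step k i)) / 2)"
proof -
  have "2 ^ k + i \<noteq> 1" using assms by (auto simp: add_eq_if)
  then show ?thesis
    unfolding haar_def Let_def floor_log_haar_index[OF assms] by simp
qed

lemma eventually_both_to_infinity_in:
  "eventually P (both_to_infinity_in A) \<longleftrightarrow>
     (\<exists>K. \<forall>n\<in>A. \<forall>m\<in>A. min n m \<ge> K \<longrightarrow> P (n, m))"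
  unfolding both_to_infinity_in_def eventually_inf_principal eventually_filtercomap_at_top_linorder
  by fastforce

lemma Lim_const_left:
  fixes f :: "real \<Rightarrow> real"
  assumes "a < x" "\<And>y. a < y \<Longrightarrow> y < x \<Longrightarrow> f y = c"
  shows "Lim (at_left x) f = c"
proof (rule tendsto_Lim)
  have "eventually (\<lambda>y. f y = c) (at_left x)"
    using assms by (auto simp: eventually_at_left[OF assms(1)])
  then show "(f \<longlongrightarrow> c) (at_left x)" by (rule tendsto_eventually)
qed simp

lemma Lim_const_right:
  fixes f :: "real \<Rightarrow> real"
  assumes "x < b" "\<And>y. x < y \<Longrightarrow> y < b \<Longrightarrow> f y = c"
  shows "Lim (at_right x) f = c"
proof (rule tendsto_Lim)
  have "eventually (\<lambda>y. f y = c) (at_right x)"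
    using assms by (auto simp: eventually_at_right[OF assms(1)])
  then show "(f \<longlongrightarrow> c) (at_right x)" by (rule tendsto_eventually)
qed simp

lemma haar_index_explicit:
  fixes k i :: nat
  assumes i: "i \<in> {1..2 ^ k}"
  defines "a \<equiv> (real i - 1) / 2 ^ k" and "c \<equiv> (2 * real i - 1) / 2 ^ (k + 1)"
    and "b \<equiv> real i / 2 ^ k" and "v \<equiv> 2 powr (real k / 2)"
  shows "haar (2 ^ k + i) x =
    (if x < a \<or> b < x then 0
     else if x = a then (if i = 1 then v else v / 2)
     else if x < c then v
     else if x = c then 0
     else if x < b then - v
     else (if i = 2 ^ k then - v else - v / 2))"
proof -
  have ac: "a < c" and cb: "c < b" by (auto simp: a_def b_def c_def field_simps)
  have a0: "a = 0 \<longleftrightarrow> i = 1" and a0': "0 \<le> a" and b1': "b \<le> 1"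
    using i of_nat_le_iff[of i "2 ^ k", where 'a = real] by (auto simp: a_def b_def field_simps)
  have b1: "b = 1 \<longleftrightarrow> i = 2 ^ k"
  proof -
    have "b = 1 \<longleftrightarrow> real i = real (2 ^ k)" by (auto simp: b_def)
    then show ?thesis unfolding of_nat_eq_iff by simp
  qed
  define h where "h = haar_step k i"
  have h: "h y = (if a < y \<and> y < c then v else if c < y \<and> y < b then - v else 0)" for y
    by (simp add: h_def haar_step_def a_def b_def c_def v_def)
  have L: "Lim (at_left x) h = (if a < x \<and> x \<le> c then v else if c < x \<and> x \<le> b then - v else 0)" for x
  proof -
    consider "x \<le> a" | "a < x" "x \<le> c" | "c < x" "x \<le> b" | "b < x" by linarith
    then show ?thesis
    proof cases
      case 1 then show ?thesis using ac cb by (intro Lim_const_left[of "x - 1"]) (auto simp: h)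
    next
      case 2 then show ?thesis using ac cb by (intro Lim_const_left[of a]) (auto simp: h)
    next
      case 3 then show ?thesis using ac cb by (intro Lim_const_left[of c]) (auto simp: h)
    next
      case 4 then show ?thesis using ac cb by (intro Lim_const_left[of b]) (auto simp: h)
    qed
  qed
  have R: "Lim (at_right x) h = (if a \<le> x \<and> x < c then v else if c \<le> x \<and> x < b then - v else 0)" for x
  proof -
    consider "x < a" | "a \<le> x" "x < c" | "c \<le> x" "x < b" | "b \<le> x" by linarith
    then show ?thesis
    proof cases
      case 1 then show ?thesis using ac cb by (intro Lim_const_right[of _ a]) (auto simp: h)
    next
      case 2 then show ?thesis using ac cb by (intro Lim_const_right[of _ c]) (auto simp: h)
    next
      case 3 then show ?thesis using ac cb by (intro Lim_const_right[of _ b]) (auto simp: h)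
    next
      case 4 then show ?thesis using ac cb by (intro Lim_const_right[of _ "x + 1"]) (auto simp: h)
    qed
  qed
  have "haar (2 ^ k + i) x = (if x = 0 then Lim (at_right 0) h else if x = 1 then Lim (at_left 1) h
     else (Lim (at_left x) h + Lim (at_right x) h) / 2)"
    unfolding h_def by (rule haar_index[OF i])
  also have "\<dots> = (if x < a \<or> b < x then 0
     else if x = a then (if a = 0 then v else v / 2)
     else if x < c then v
     else if x = c then 0
     else if x < b then - v
     else (if b = 1 then - v else - v / 2))"
    unfolding L R using ac cb a0' b1' by auto
  finally show ?thesis by (simp only: a0 b1)
qed

lemma infdist_nat_attained:
  fixes n :: nat and A :: "nat set"
  assumes "A \<noteq> {}"
  shows "\<exists>m\<in>A. infdist (real n) (real ` A) = \<bar>real n - real m\<bar> \<and>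
           (\<forall>l\<in>A. \<bar>real n - real m\<bar> \<le> \<bar>real n - real l\<bar>)"
proof -
  obtain m where m: "m \<in> A" "\<And>l. l \<in> A \<Longrightarrow> nat \<bar>int n - int m\<bar> \<le> nat \<bar>int n - int l\<bar>"
    using ex_has_least_nat[of "\<lambda>m. m \<in> A" _ "\<lambda>m. nat \<bar>int n - int m\<bar>"] assms by blast
  have le: "\<bar>real n - real m\<bar> \<le> \<bar>real n - real l\<bar>" if "l \<in> A" for l
    using m(2)[OF that] by linarith
  have "infdist (real n) (real ` A) = (INF l\<in>A. \<bar>real n - real l\<bar>)"
    using assms by (simp add: infdist_notempty dist_real_def image_image)
  also have "\<dots> = \<bar>real n - real m\<bar>"
    by (rule cInf_eq_minimum) (use m(1) le in \<open>auto\<close>)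
  finally show ?thesis using m(1) le by blast
qed

end

theory Submission
  imports Defs
begin

text \<open>
  For almost every \<open>z\<close>, the partial sum \<open>S\<^bsub>n,m\<^esub> f z\<close> is the average of \<open>f\<close> over a dyadic rectangle
  around \<open>z\<close> whose sides have levels \<open>k\<close> or \<open>k + 1\<close>, where \<open>k\<close> is the level of the index.

  Suppose that \<open>D\<close> stays within a bounded distance of \<open>C\<close>, and \<open>f \<ge> 0\<close>. A rectangle of \<open>M\<close> with a large
  average contains a dyadic rectangle of comparable side lengths on which some average of \<open>N\<close> is
  large throughout. By the one-dimensional weak type bound, applied in each coordinate, the union of
  the former rectangles has measure at most a constant times that of the set where the averages of
  \<open>N\<close> are large, and the latter tends to 0 under convergence along \<open>N\<close>.

  If the distance is unbounded, take sparse levels \<open>n\<^sub>0 < n\<^sub>1 < \<dots>\<close> in \<open>D\<close> far away from \<open>C\<close> and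
  surround each of them by a block of binary digits, \<open>u\<close> digits before and \<open>v\<close> digits after it. Let
  \<open>T\<close> be the union of \<open>l\<close> blocks, and let \<open>f\<close> be a multiple of the indicator of \<open>Z \<times> Z\<close>, where \<open>Z\<close> is
  the set of \<open>x\<close> whose digits in \<open>T\<close> vanish. An average of \<open>f\<close> depends only on the number of digits of
  \<open>T\<close> that its two levels have passed. The levels of \<open>M\<close> can stop inside a block, and so the averages
  of \<open>M\<close> equal a prescribed value \<open>\<Lambda>\<close> on a staircase of \<open>l\<close> almost disjoint sets. The levels of \<open>N\<close>
  see whole blocks only, so the averages of \<open>N\<close> are at most \<open>\<Lambda> / 4 ^ u\<close> outside a set smaller than the
  staircase by a factor of order \<open>2 ^ (v - u)\<close>. The staircase is larger by a factor \<open>l\<close> than the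
  weak type \<open>(1, 1)\<close> inequality would permit; hence independent copies, living on disjoint
  ranges of digits, can cover almost the whole square at the cost of an integral of order \<open>\<Lambda> / l\<close>.
  Summing such functions over \<open>\<Lambda> = 1, 2, \<dots>\<close> with summable errors and applying Borel-Cantelli gives
  the example.
\<close>

section \<open>Partial sums as averages over dyadic rectangles\<close>

definition dyadic_cell :: "nat \<Rightarrow> int \<Rightarrow> real set" where
  "dyadic_cell p j = {t. \<lfloor>2 ^ p * t\<rfloor> = j}"

lemma dyadic_cell_eq: "dyadic_cell p j = {real_of_int j / 2 ^ p..<(real_of_int j + 1) / 2 ^ p}"
  by (auto simp: dyadic_cell_def floor_eq_iff field_simps)

lemma sets_dyadic_cell [measurable]: "dyadic_cell p j \<in> sets borel"
  by (simp add: dyadic_cell_eq)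

lemma emeasure_dyadic_cell: "emeasure lborel (dyadic_cell p j) = ennreal (1 / 2 ^ p)"
  by (simp add: dyadic_cell_eq divide_right_mono diff_divide_distrib[symmetric])

lemma measure_dyadic_cell: "measure lborel (dyadic_cell p j) = 1 / 2 ^ p"
  by (simp add: measure_def emeasure_dyadic_cell)

lemma fmeasurable_dyadic_cell: "dyadic_cell p j \<in> fmeasurable lborel"
  by (rule fmeasurableI) (simp_all add: emeasure_dyadic_cell)

text \<open>Passing to a coarser cell divides its index by a power of 2. Encoding cells by floors
  reduces their nesting and splitting to this identity.\<close>

lemma floor_pow2_div:
  assumes "p \<le> q"
  shows "\<lfloor>2 ^ p * (t::real)\<rfloor> = \<lfloor>2 ^ q * t\<rfloor> div 2 ^ (q - p)"
proof -
  have "\<lfloor>2 ^ q * t\<rfloor> div 2 ^ (q - p) = \<lfloor>2 ^ q * t / real_of_int (2 ^ (q - p))\<rfloor>"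
    using floor_divide_real_eq_div[of "2 ^ (q - p)" "2 ^ q * t"] by simp
  also have "2 ^ q * t / real_of_int (2 ^ (q - p)) = 2 ^ p * t"
    using power_add[of "2::real" p "q - p"] assms by simp
  finally show ?thesis by simp
qed

lemma dyadic_cell_disjoint: "j \<noteq> j' \<Longrightarrow> dyadic_cell p j \<inter> dyadic_cell p j' = {}"
  by (auto simp: dyadic_cell_def)

lemma dyadic_cell_subset:
  assumes "p \<le> q"
  shows "dyadic_cell q j \<subseteq> dyadic_cell p (j div 2 ^ (q - p))"
  by (auto simp: dyadic_cell_def floor_pow2_div[OF assms])

lemma dyadic_cell_split:
  "dyadic_cell p j = dyadic_cell (Suc p) (2 * j) \<union> dyadic_cell (Suc p) (2 * j + 1)"
proof -
  have "\<lfloor>2 ^ p * t\<rfloor> = \<lfloor>2 ^ Suc p * t\<rfloor> div 2" for t :: real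
    using floor_pow2_div[of p "Suc p" t] by simp
  then show ?thesis unfolding dyadic_cell_def by (simp only:) force
qed

lemma dyadic_cell_0: "dyadic_cell 0 0 = {0..<1}"
  by (simp add: dyadic_cell_eq)

lemma dyadic_cell_subset_unit:
  assumes "j \<in> {0..<2 ^ p}"
  shows "dyadic_cell p j \<subseteq> {0..<1}"
  using dyadic_cell_subset[of 0 p j] assms by (simp add: dyadic_cell_0)

lemma floor_pow2_unit:
  assumes "x \<in> {0..<1::real}"
  shows "\<lfloor>2 ^ p * x\<rfloor> \<in> {0..<2 ^ p}"
proof -
  have "2 ^ p * x < 2 ^ p * 1" using assms by (intro mult_strict_left_mono) auto
  then show ?thesis using assms by (auto simp: floor_less_iff)
qed

lemma unit_eq_UN_cells: "{0..<1::real} = (\<Union>j\<in>{0..<2 ^ p}. dyadic_cell p j)"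
proof
  show "{0..<1} \<subseteq> (\<Union>j\<in>{0..<2 ^ p}. dyadic_cell p j)"
    using floor_pow2_unit[of _ p] by (auto simp: dyadic_cell_def)
  show "(\<Union>j\<in>{0..<2 ^ p}. dyadic_cell p j) \<subseteq> {0..<1}"
    using dyadic_cell_subset_unit[of _ p] by blast
qed

section \<open>Haar partitions and the one-dimensional kernel\<close>

definition dyadic_rats :: "real set" where
  "dyadic_rats = (\<Union>p j. {real_of_int j / 2 ^ p})"

lemma dyadic_ratsI: "real_of_int j / 2 ^ p \<in> dyadic_rats"
  by (auto simp: dyadic_rats_def)

lemma countable_dyadic_rats: "countable dyadic_rats"
  by (auto simp: dyadic_rats_def)

text \<open>All jumps of the Haar functions lie in this set; off it a Haar function is read off from
  the half-open cells.\<close>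

lemma null_dyadic_rats: "dyadic_rats \<in> null_sets lborel"
  by (intro countable_imp_null_set_lborel countable_dyadic_rats)

text \<open>For \<open>n = 2 ^ k + i\<close> with \<open>1 \<le> i \<le> 2 ^ k\<close>, the \<open>n\<close>-th partition consists of the cells of
  level \<open>k + 1\<close> to the left of \<open>i / 2 ^ k\<close> and of the cells of level \<open>k\<close> to the right.\<close>

definition haar_lev :: "nat \<Rightarrow> real \<Rightarrow> nat" where
  "haar_lev n x = (if n \<le> 1 then 0
     else let k = floor_log (n - 1) in if \<lfloor>2 ^ k * x\<rfloor> < int n - 2 ^ k then Suc k else k)"

lemma haar_lev_index:
  assumes "i \<in> {1..2 ^ k}"
  shows "haar_lev (2 ^ k + i) x = (if \<lfloor>2 ^ k * x\<rfloor> < int i then Suc k else k)"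
proof -
  have "\<not> 2 ^ k + i \<le> 1" using assms by (auto simp: add_eq_if)
  then show ?thesis unfolding haar_lev_def floor_log_haar_index[OF assms] by simp
qed

lemma haar_index_cases:
  fixes n :: nat
  assumes "n \<ge> 2"
  obtains k i where "i \<in> {1..2 ^ k}" "n = 2 ^ k + i"
proof -
  define k where "k = floor_log (n - 1)"
  have "2 ^ k \<le> n - 1" "n - 1 < 2 * 2 ^ k"
    unfolding k_def using assms floor_log_exp2_le[of "n - 1"] floor_log_exp2_gt[of "n - 1"] by auto
  then show ?thesis using assms by (intro that[of "n - 2 ^ k" k]) auto
qed

lemma haar_index_cell:
  assumes i: "i \<in> {1..2 ^ k}" and x: "x \<notin> dyadic_rats"
  shows "haar (2 ^ k + i) x =
    (if \<lfloor>2 ^ Suc k * x\<rfloor> = 2 * (int i - 1) then 2 powr (real k / 2)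
     else if \<lfloor>2 ^ Suc k * x\<rfloor> = 2 * (int i - 1) + 1 then - (2 powr (real k / 2)) else 0)"
proof -
  have ne: "x \<noteq> (real i - 1) / 2 ^ k" "x \<noteq> (2 * real i - 1) / 2 ^ (k + 1)" "x \<noteq> real i / 2 ^ k"
    using x dyadic_ratsI[of "int i - 1" k] dyadic_ratsI[of "2 * int i - 1" "k + 1"]
      dyadic_ratsI[of "int i" k] by auto
  have f: "\<lfloor>2 ^ Suc k * x\<rfloor> = 2 * (int i - 1) \<longleftrightarrow> (real i - 1) / 2 ^ k \<le> x \<and> x < (2 * real i - 1) / 2 ^ (k + 1)"
    unfolding floor_eq_iff by (auto simp: field_simps)
  have g: "\<lfloor>2 ^ Suc k * x\<rfloor> = 2 * (int i - 1) + 1 \<longleftrightarrow> (2 * real i - 1) / 2 ^ (k + 1) \<le> x \<and> x < real i / 2 ^ k"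
    unfolding floor_eq_iff by (auto simp: field_simps)
  have lt: "(real i - 1) / 2 ^ k < (2 * real i - 1) / 2 ^ (k + 1)" "(2 * real i - 1) / 2 ^ (k + 1) < real i / 2 ^ k"
    by (auto simp: field_simps)
  show ?thesis unfolding haar_index_explicit[OF i] f g using ne lt by auto
qed

definition haar_kernel :: "nat \<Rightarrow> real \<Rightarrow> real \<Rightarrow> real" where
  "haar_kernel n x t = (\<Sum>i = 1..n. haar i x * haar i t)"

text \<open>The first \<open>n\<close> Haar functions span the functions that are constant on the
  cells of the \<open>n\<close>-th partition, so their kernel is that of averaging over these cells.
  One further function splits one cell of level \<open>k\<close> into halves: its product at
  \<open>x\<close> and \<open>t\<close> is \<open>2 ^ k\<close> if both lie in the same half and
  \<open>- (2 ^ k)\<close> if they lie in opposite halves, which turns the kernel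
  \<open>2 ^ k\<close> of the cell into \<open>2 ^ Suc k\<close> and 0.\<close>

lemma haar_kernel_eq:
  assumes x: "x \<in> {0..<1}" "x \<notin> dyadic_rats" and t: "t \<in> {0..<1}" "t \<notin> dyadic_rats" and "n \<ge> 1"
  shows "haar_kernel n x t = 2 ^ haar_lev n x * indicator (dyadic_cell (haar_lev n x) \<lfloor>2 ^ haar_lev n x * x\<rfloor>) t"
proof -
  let ?K = "\<lambda>p. 2 ^ p * indicator (dyadic_cell p \<lfloor>2 ^ p * x\<rfloor>) t :: real"
  \<comment> \<open>Within level \<open>k\<close> the induction is on the number of cells already
    split. Reaching \<open>i = 2 ^ k\<close> completes the level, which is how \<open>pow\<close>
    below advances.\<close>
  have step: "haar_kernel (2 ^ k + i) x t = (if \<lfloor>2 ^ k * x\<rfloor> < int i then ?K (Suc k) else ?K k)"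
    if "i \<le> 2 ^ k" and base: "haar_kernel (2 ^ k) x t = ?K k" for k i
    using that(1)
  proof (induction i)
    case 0
    then show ?case using base floor_pow2_unit[OF x(1), of k] by simp
  next
    case (Suc i)
    have i: "Suc i \<in> {1..2 ^ k}" using Suc by auto
    have fx: "\<lfloor>2 ^ k * x\<rfloor> = \<lfloor>2 ^ Suc k * x\<rfloor> div 2" and ft: "\<lfloor>2 ^ k * t\<rfloor> = \<lfloor>2 ^ Suc k * t\<rfloor> div 2"
      using floor_pow2_div[of k "Suc k"] by auto
    define v :: real where "v = 2 powr (real k / 2)"
    have pw: "v * v = 2 ^ k"
      by (simp add: v_def powr_add[symmetric] powr_realpow)
    have "haar_kernel (2 ^ k + Suc i) x t = haar_kernel (2 ^ k + i) x t + haar (2 ^ k + Suc i) x * haar (2 ^ k + Suc i) t"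
      by (simp add: haar_kernel_def)
    also have "\<dots> = (if \<lfloor>2 ^ k * x\<rfloor> < int i then ?K (Suc k) else ?K k) + haar (2 ^ k + Suc i) x * haar (2 ^ k + Suc i) t"
      using Suc by simp
    also have "\<dots> = (if \<lfloor>2 ^ k * x\<rfloor> < int (Suc i) then ?K (Suc k) else ?K k)"
    proof -
      define a b where "a = \<lfloor>2 ^ Suc k * x\<rfloor>" and "b = \<lfloor>2 ^ Suc k * t\<rfloor>"
      have K: "?K (Suc k) = (if b = a then 2 * 2 ^ k else 0)" "?K k = (if b div 2 = a div 2 then 2 ^ k else 0)"
        using fx ft by (auto simp: dyadic_cell_def a_def b_def)
      have H: "haar (2 ^ k + Suc i) y = (if c = 2 * int i then v
          else if c = 2 * int i + 1 then - v else 0)"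
        if "c = \<lfloor>2 ^ Suc k * y\<rfloor>" "y \<notin> dyadic_rats" for y c
        using haar_index_cell[OF i that(2)] that(1) by (simp add: v_def)
      have Hx: "haar (2 ^ k + Suc i) x = (if a = 2 * int i then v
          else if a = 2 * int i + 1 then - v else 0)"
        and Ht: "haar (2 ^ k + Suc i) t = (if b = 2 * int i then v
          else if b = 2 * int i + 1 then - v else 0)"
        using H x t by (auto simp: a_def b_def)
      have lt: "\<lfloor>2 ^ k * x\<rfloor> < int i \<longleftrightarrow> a div 2 < int i" "\<lfloor>2 ^ k * x\<rfloor> < int (Suc i) \<longleftrightarrow> a div 2 < int i + 1"
        using fx by (auto simp: a_def)
      have c: "b \<noteq> 2 * int i \<and> b \<noteq> 2 * int i + 1 \<longleftrightarrow> b div 2 \<noteq> int i" by presburger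
      consider "a = 2 * int i" | "a = 2 * int i + 1" | "a div 2 < int i" | "a div 2 > int i" by linarith
      then show ?thesis
      proof cases
        case 1
        then show ?thesis unfolding lt Hx Ht K using pw c by auto
      next
        case 2
        then have "a div 2 = int i" by simp
        then show ?thesis unfolding lt Hx Ht K using pw c 2 by auto
      next
        case 3
        then have "a \<noteq> 2 * int i" "a \<noteq> 2 * int i + 1" by auto
        then show ?thesis unfolding lt Hx Ht K using 3 by simp
      next
        case 4
        then have "a \<noteq> 2 * int i" "a \<noteq> 2 * int i + 1" by auto
        then show ?thesis unfolding lt Hx Ht K using 4 by simp
      qed
    qed
    finally show ?case .
  qed
  have pow: "haar_kernel (2 ^ k) x t = ?K k" for k
  proof (induction k)
    case 0
    have "\<lfloor>x\<rfloor> = 0" "\<lfloor>t\<rfloor> = 0" using x t by (auto simp: floor_eq_iff)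
    then show ?case by (simp add: haar_kernel_def haar_def dyadic_cell_def)
  next
    case (Suc k)
    have "\<lfloor>2 ^ k * x\<rfloor> < int (2 ^ k)" using floor_pow2_unit[OF x(1), of k] by simp
    moreover have "(2::nat) ^ Suc k = 2 ^ k + 2 ^ k" by simp
    ultimately show ?case using step[OF order_refl Suc.IH] by (simp only: if_True)
  qed
  show ?thesis
  proof (cases "n = 1")
    case True
    then show ?thesis using pow[of 0] by (simp add: haar_lev_def)
  next
    case False
    then have "n \<ge> 2" using \<open>n \<ge> 1\<close> by simp
    from haar_index_cases[OF this] obtain k i where ki: "i \<in> {1..2 ^ k}" "n = 2 ^ k + i" .
    have "haar_kernel n x t = (if \<lfloor>2 ^ k * x\<rfloor> < int i then ?K (Suc k) else ?K k)"
      unfolding ki(2) by (rule step[OF _ pow]) (use ki(1) in auto)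
    also have "\<dots> = ?K (haar_lev n x)"
      unfolding ki(2) haar_lev_index[OF ki(1)] by (cases "\<lfloor>2 ^ k * x\<rfloor> < int i") (simp_all only: if_True if_False)
    finally show ?thesis .
  qed
qed

lemma haar_measurable [measurable]:
  assumes "i \<ge> 1"
  shows "haar i \<in> borel_measurable borel"
proof (cases "i = 1")
  case True
  have "haar i = (\<lambda>x. 1)" using True by (auto simp: haar_def)
  then show ?thesis by simp
next
  case False
  then have "i \<ge> 2" using assms by simp
  from haar_index_cases[OF this] obtain k j where kj: "j \<in> {1..2 ^ k}" "i = 2 ^ k + j" .
  show ?thesis unfolding kj(2) haar_index_explicit[OF kj(1), abs_def] by measurable
qed

lemma haar_bounded:
  assumes "i \<ge> 1"
  obtains B where "\<And>x. \<bar>haar i x\<bar> \<le> B"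
proof (cases "i = 1")
  case True
  then show ?thesis by (intro that[of 1]) (auto simp: haar_def)
next
  case False
  then have "i \<ge> 2" using assms by simp
  from haar_index_cases[OF this] obtain k j where kj: "j \<in> {1..2 ^ k}" "i = 2 ^ k + j" .
  show ?thesis
    by (rule that[of "2 powr (real k / 2)"]) (auto simp: kj(2) haar_index_explicit[OF kj(1)])
qed

section \<open>Two-dimensional partial sums\<close>

lemma set_integrable_mult_haar2:
  assumes f: "f absolutely_integrable_on unit_square" and ij: "i \<ge> 1" "j \<ge> 1"
  shows "set_integrable lebesgue unit_square (\<lambda>w. f w * haar2 i j w)"
proof -
  obtain B1 where B1: "\<And>x. \<bar>haar i x\<bar> \<le> B1" using haar_bounded[OF ij(1)] by blast
  obtain B2 where B2: "\<And>x. \<bar>haar j x\<bar> \<le> B2" using haar_bounded[OF ij(2)] by blast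
  have [measurable]: "haar i \<in> borel_measurable borel" "haar j \<in> borel_measurable borel"
    using ij by simp_all
  have "haar2 i j \<in> borel_measurable (borel \<Otimes>\<^sub>M borel)"
    unfolding haar2_def by measurable
  then have m: "haar2 i j \<in> borel_measurable lebesgue"
    unfolding borel_prod by (intro measurable_completion) simp
  have fi: "integrable lebesgue (\<lambda>w. indicat_real unit_square w * f w)"
    using f by (simp add: set_integrable_def)
  have "integrable lebesgue (\<lambda>w. (indicat_real unit_square w * f w) * haar2 i j w)"
  proof (rule Bochner_Integration.integrable_bound)
    show "integrable lebesgue (\<lambda>w. (B1 * B2) * (indicat_real unit_square w * f w))"
      using fi by simp
    show "(\<lambda>w. (indicat_real unit_square w * f w) * haar2 i j w) \<in> borel_measurable lebesgue"
      by (intro borel_measurable_times m borel_measurable_integrable[OF fi])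
    have h: "\<bar>haar2 i j w\<bar> \<le> B1 * B2" for w
      using B1[of "fst w"] B2[of "snd w"] by (auto simp: haar2_def case_prod_beta abs_mult intro!: mult_mono)
    have "\<bar>(indicat_real unit_square w * f w) * haar2 i j w\<bar> \<le> \<bar>(B1 * B2) * (indicat_real unit_square w * f w)\<bar>" for w
    proof -
      have "\<bar>haar2 i j w\<bar> \<le> \<bar>B1 * B2\<bar>" using h[of w] by (rule order_trans) (rule abs_ge_self)
      from mult_right_mono[OF this abs_ge_zero[of "indicat_real unit_square w * f w"]]
      show ?thesis by (simp only: abs_mult mult.commute)
    qed
    then show "AE w in lebesgue. norm ((indicat_real unit_square w * f w) * haar2 i j w)
        \<le> norm ((B1 * B2) * (indicat_real unit_square w * f w))"
      by simp
  qed
  then show ?thesis by (simp add: set_integrable_def mult.assoc)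
qed

lemma AE_not_dyadic_rats:
  "AE w in lebesgue. fst w \<notin> dyadic_rats \<and> snd w \<notin> dyadic_rats"
proof -
  have 1: "dyadic_rats \<times> UNIV \<in> null_sets (lborel \<Otimes>\<^sub>M lborel)" and 2: "UNIV \<times> dyadic_rats \<in> null_sets (lborel \<Otimes>\<^sub>M lborel)"
    using lborel.times_in_null_sets1[OF null_dyadic_rats, of UNIV] lborel.times_in_null_sets2[OF _ null_dyadic_rats, of UNIV lborel] by simp_all
  have "AE w in lborel. w \<notin> dyadic_rats \<times> UNIV" "AE w in lborel. w \<notin> UNIV \<times> dyadic_rats"
    using 1 2 unfolding lborel_prod by (auto intro!: AE_not_in)
  then have "AE w in lborel. fst w \<notin> dyadic_rats \<and> snd w \<notin> dyadic_rats"
    by eventually_elim (auto simp: mem_Times_iff)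
  then show ?thesis by (rule AE_completion)
qed

definition dyadic_rect :: "nat \<Rightarrow> nat \<Rightarrow> real \<times> real \<Rightarrow> (real \<times> real) set" where
  "dyadic_rect p q z = dyadic_cell p \<lfloor>2 ^ p * fst z\<rfloor> \<times> dyadic_cell q \<lfloor>2 ^ q * snd z\<rfloor>"

definition dyadic_avg :: "(real \<times> real \<Rightarrow> real) \<Rightarrow> nat \<Rightarrow> nat \<Rightarrow> real \<times> real \<Rightarrow> real" where
  "dyadic_avg f p q z = 2 ^ p * 2 ^ q * (LINT w:dyadic_rect p q z|lebesgue. f w)"

lemma dyadic_rect_subset_unit:
  assumes "z \<in> unit_square"
  shows "dyadic_rect p q z \<subseteq> unit_square"
  using assms floor_pow2_unit[of "fst z" p] floor_pow2_unit[of "snd z" q]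
    dyadic_cell_subset_unit[of "\<lfloor>2 ^ p * fst z\<rfloor>" p] dyadic_cell_subset_unit[of "\<lfloor>2 ^ q * snd z\<rfloor>" q]
  unfolding dyadic_rect_def unit_square_def by fastforce

text \<open>Exchanging the finite sums with the integral gives the integral of \<open>f\<close>
  against a product of two kernels. By \<open>haar_kernel_eq\<close> this product is the indicator
  of the rectangle around \<open>z\<close> divided by its area.\<close>

lemma haar_partial_sum_eq_avg:
  assumes f: "f absolutely_integrable_on unit_square" and z: "z \<in> unit_square"
    "fst z \<notin> dyadic_rats" "snd z \<notin> dyadic_rats" and nm: "n \<ge> 1" "m \<ge> 1"
  shows "haar_partial_sum n m f z = dyadic_avg f (haar_lev n (fst z)) (haar_lev m (snd z)) z"
proof -
  obtain x y where xy: "z = (x, y)" by fastforce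
  define p q where "p = haar_lev n x" and "q = haar_lev m y"
  define g where "g i j w = indicator unit_square w * f w * haar2 i j w" for i j w
  have gi: "integrable lebesgue (g i j)" if "i \<in> {1..n}" "j \<in> {1..m}" for i j
    using set_integrable_mult_haar2[OF f, of i j] that by (simp add: g_def[abs_def] set_integrable_def mult.assoc)
  have "haar_partial_sum n m f z = (\<Sum>i = 1..n. \<Sum>j = 1..m. (LINT w|lebesgue. g i j w * haar2 i j z))"
    by (simp add: haar_partial_sum_def haar_coeff_def set_lebesgue_integral_def g_def mult.assoc
          flip: integral_mult_left_zero)
  also have "\<dots> = (LINT w|lebesgue. (\<Sum>i = 1..n. \<Sum>j = 1..m. g i j w * haar2 i j z))"
    by (subst Bochner_Integration.integral_sum, use gi in \<open>auto intro!: sum.cong integral_sum[symmetric]\<close>)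
  also have "\<dots> = (LINT w|lebesgue. indicator unit_square w * f w * (haar_kernel n x (fst w) * haar_kernel m y (snd w)))"
  proof (intro Bochner_Integration.integral_cong refl)
    fix w
    have "haar_kernel n x (fst w) * haar_kernel m y (snd w)
        = (\<Sum>i = 1..n. \<Sum>j = 1..m. (haar i x * haar i (fst w)) * (haar j y * haar j (snd w)))"
      by (simp only: haar_kernel_def sum_product)
    then show "(\<Sum>i = 1..n. \<Sum>j = 1..m. g i j w * haar2 i j z)
        = indicator unit_square w * f w * (haar_kernel n x (fst w) * haar_kernel m y (snd w))"
      by (simp add: sum_distrib_left xy g_def haar2_def case_prod_beta mult_ac)
  qed
  also have "\<dots> = (LINT w|lebesgue. (2 ^ p * 2 ^ q) * (indicator (dyadic_rect p q z) w * f w))"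
  \<comment> \<open>The kernel formula asks the integration variable, too, to avoid dyadic
    rationals, so the integrands agree only almost everywhere.\<close>
  proof (rule integral_cong_AE)
    have "AE w in lebesgue. fst w \<notin> dyadic_rats \<and> snd w \<notin> dyadic_rats" by (rule AE_not_dyadic_rats)
    then show "AE w in lebesgue. indicator unit_square w * f w * (haar_kernel n x (fst w) * haar_kernel m y (snd w))
        = (2 ^ p * 2 ^ q) * (indicator (dyadic_rect p q z) w * f w)"
    proof eventually_elim
      case (elim w)
      show ?case
      proof (cases "w \<in> unit_square")
        case True
        then show ?thesis using elim z nm
          by (simp add: haar_kernel_eq xy unit_square_def mem_Times_iff p_def q_def dyadic_rect_def indicator_times)
      next
        case False
        then show ?thesis using dyadic_rect_subset_unit[OF z(1), of p q] by (auto simp: indicator_def)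
      qed
    qed
  next
    have [measurable]: "(\<lambda>x. indicator unit_square x * f x) \<in> borel_measurable lebesgue"
      using f by (auto simp: set_integrable_def)
    have k: "haar_kernel n x \<in> borel_measurable borel" for n x
      unfolding haar_kernel_def[abs_def] by (intro borel_measurable_sum borel_measurable_times) auto
    have "(\<lambda>w. haar_kernel n x (fst w) * haar_kernel m y (snd w)) \<in> borel_measurable (borel \<Otimes>\<^sub>M borel)"
      using k by measurable
    then have [measurable]: "(\<lambda>w. haar_kernel n x (fst w) * haar_kernel m y (snd w)) \<in> borel_measurable lebesgue"
      unfolding borel_prod by (intro measurable_completion) simp
    show "(\<lambda>w. indicator unit_square w * f w * (haar_kernel n x (fst w) * haar_kernel m y (snd w))) \<in> borel_measurable lebesgue"
      by measurable
    have eq: "indicator (dyadic_rect p q z) w * f w = indicator (dyadic_rect p q z) w * (indicator unit_square w * f w)" for w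
      using dyadic_rect_subset_unit[OF z(1), of p q] by (auto simp: indicator_def)
    have [measurable]: "dyadic_rect p q z \<in> sets lebesgue"
      unfolding dyadic_rect_def by (intro sets_completionI_sets) (simp add: borel_prod[symmetric])
    show "(\<lambda>w. (2 ^ p * 2 ^ q) * (indicator (dyadic_rect p q z) w * f w)) \<in> borel_measurable lebesgue"
      unfolding eq by measurable
  qed
  also have "\<dots> = dyadic_avg f p q z"
    by (simp add: dyadic_avg_def set_lebesgue_integral_def)
  finally show ?thesis by (simp add: p_def q_def xy)
qed

section \<open>Levels at bounded distance\<close>

definition dyadic_dense :: "real \<Rightarrow> real set \<Rightarrow> nat \<Rightarrow> int \<Rightarrow> bool" where
  "dyadic_dense \<delta> A q j \<longleftrightarrow> ennreal (\<delta> / 2 ^ q) \<le> emeasure lborel (dyadic_cell q j \<inter> A)"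

text \<open>The set \<open>U\<close> is split by the first level \<open>q\<close> at which the density is large; the pieces consist
  of whole cells.\<close>

lemma dyadic_maximal_bound:
  assumes A: "A \<in> sets borel" and \<delta>: "\<delta> > 0"
  defines "U \<equiv> {y \<in> {0..<1::real}. \<exists>q. dyadic_dense \<delta> A q \<lfloor>2 ^ q * y\<rfloor>}"
  shows "emeasure lborel U \<le> ennreal (1 / \<delta>) * emeasure lborel A"
proof -
  define J where "J q = {j \<in> {0..<2 ^ q}. dyadic_dense \<delta> A q j \<and> (\<forall>q'<q. \<not> dyadic_dense \<delta> A q' (j div 2 ^ (q - q')))}" for q
  define V where "V q = (\<Union>j\<in>J q. dyadic_cell q j)" for q
  have V_iff: "y \<in> V q \<longleftrightarrow> y \<in> {0..<1} \<and> dyadic_dense \<delta> A q \<lfloor>2 ^ q * y\<rfloor>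
      \<and> (\<forall>q'<q. \<not> dyadic_dense \<delta> A q' \<lfloor>2 ^ q' * y\<rfloor>)" for y q
  proof -
    have "y \<in> V q \<longleftrightarrow> \<lfloor>2 ^ q * y\<rfloor> \<in> J q" by (auto simp: V_def dyadic_cell_def)
    moreover have "\<lfloor>2 ^ q * y\<rfloor> \<in> {0..<2 ^ q} \<longleftrightarrow> y \<in> {0..<1}"
      using unit_eq_UN_cells[of q] by (auto simp: dyadic_cell_def)
    moreover have "\<lfloor>2 ^ q' * y\<rfloor> = \<lfloor>2 ^ q * y\<rfloor> div 2 ^ (q - q')" if "q' < q" for q'
      using floor_pow2_div[of q' q y] that by simp
    ultimately show ?thesis by (auto simp: J_def)
  qed
  have finJ: "finite (J q)" for q
    by (rule finite_subset[of _ "{0..<2 ^ q}"]) (auto simp: J_def)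
  have V_sets [measurable]: "V q \<in> sets borel" for q
    unfolding V_def using finJ by (intro sets.finite_UN) auto
  have disj: "disjoint_family V"
    unfolding disjoint_family_on_def
  proof (intro ballI impI)
    fix q q' :: nat assume "q \<noteq> q'"
    then show "V q \<inter> V q' = {}" by (cases "q < q'") (auto simp: V_iff)
  qed
  have U: "U = (\<Union>q. V q)"
  proof (intro equalityI subsetI)
    fix y assume y: "y \<in> U"
    define q where "q = (LEAST q. dyadic_dense \<delta> A q \<lfloor>2 ^ q * y\<rfloor>)"
    have "dyadic_dense \<delta> A q \<lfloor>2 ^ q * y\<rfloor>" unfolding q_def using y by (auto simp: U_def intro: LeastI)
    moreover have "\<forall>q'<q. \<not> dyadic_dense \<delta> A q' \<lfloor>2 ^ q' * y\<rfloor>" unfolding q_def using not_less_Least by blast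
    ultimately have "y \<in> V q" using y by (simp add: V_iff U_def)
    then show "y \<in> (\<Union>q. V q)" by blast
  qed (auto simp: V_iff U_def)
  have one: "emeasure lborel (V q) \<le> ennreal (1 / \<delta>) * emeasure lborel (V q \<inter> A)" for q
  proof -
    have cells: "disjoint_family_on (\<lambda>j. dyadic_cell q j) (J q)" "disjoint_family_on (\<lambda>j. dyadic_cell q j \<inter> A) (J q)"
      using dyadic_cell_disjoint[of _ _ q] by (auto simp: disjoint_family_on_def)
    have "emeasure lborel (V q) = (\<Sum>j\<in>J q. emeasure lborel (dyadic_cell q j))"
      unfolding V_def by (rule sum_emeasure[symmetric]) (use cells finJ in auto)
    also have "\<dots> \<le> (\<Sum>j\<in>J q. ennreal (1 / \<delta>) * emeasure lborel (dyadic_cell q j \<inter> A))"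
    proof (rule sum_mono)
      fix j assume "j \<in> J q"
      then have "ennreal (\<delta> / 2 ^ q) \<le> emeasure lborel (dyadic_cell q j \<inter> A)" by (simp add: J_def dyadic_dense_def)
      then have "ennreal (1 / \<delta>) * ennreal (\<delta> / 2 ^ q) \<le> ennreal (1 / \<delta>) * emeasure lborel (dyadic_cell q j \<inter> A)"
        by (rule mult_left_mono) simp
      then show "emeasure lborel (dyadic_cell q j) \<le> ennreal (1 / \<delta>) * emeasure lborel (dyadic_cell q j \<inter> A)"
        using \<delta> by (simp add: emeasure_dyadic_cell ennreal_mult[symmetric])
    qed
    also have "\<dots> = ennreal (1 / \<delta>) * (\<Sum>j\<in>J q. emeasure lborel (dyadic_cell q j \<inter> A))"
      by (simp add: sum_distrib_left)
    also have "(\<Sum>j\<in>J q. emeasure lborel (dyadic_cell q j \<inter> A)) = emeasure lborel (\<Union>j\<in>J q. dyadic_cell q j \<inter> A)"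
      by (rule sum_emeasure) (use cells finJ A in auto)
    also have "(\<Union>j\<in>J q. dyadic_cell q j \<inter> A) = V q \<inter> A" by (auto simp: V_def)
    finally show ?thesis .
  qed
  have "emeasure lborel U = (\<Sum>q. emeasure lborel (V q))"
    unfolding U by (rule suminf_emeasure[symmetric]) (use disj in auto)
  also have "\<dots> \<le> (\<Sum>q. ennreal (1 / \<delta>) * emeasure lborel (V q \<inter> A))"
    by (intro suminf_le one) auto
  also have "\<dots> = ennreal (1 / \<delta>) * (\<Sum>q. emeasure lborel (V q \<inter> A))"
    by simp
  also have "(\<Sum>q. emeasure lborel (V q \<inter> A)) = emeasure lborel (\<Union>q. V q \<inter> A)"
    by (rule suminf_emeasure) (use disj A in \<open>auto simp: disjoint_family_on_def\<close>)
  also have "\<dots> \<le> emeasure lborel A"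
    by (rule emeasure_mono) (use A in auto)
  finally show ?thesis by (simp add: mult_left_mono)
qed

section \<open>Enlargement of plane sets, one coordinate at a time\<close>

definition enlarge_snd :: "real \<Rightarrow> (real \<times> real) set \<Rightarrow> (real \<times> real) set" where
  "enlarge_snd \<delta> E = {(x, y). y \<in> {0..<1} \<and> (\<exists>q. dyadic_dense \<delta> (Pair x -` E) q \<lfloor>2 ^ q * y\<rfloor>)}"

definition enlarge_fst :: "real \<Rightarrow> (real \<times> real) set \<Rightarrow> (real \<times> real) set" where
  "enlarge_fst \<delta> E = prod.swap -` enlarge_snd \<delta> (prod.swap -` E)"

text \<open>Density depends on \<open>y\<close> only through its cell, so the set is a countable
  union of products.\<close>

lemma enlarge_snd_sets:
  assumes E: "E \<in> sets (borel \<Otimes>\<^sub>M borel)"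
  shows "enlarge_snd \<delta> E \<in> sets (borel \<Otimes>\<^sub>M borel)"
proof -
  have "enlarge_snd \<delta> E = (\<Union>q. \<Union>j\<in>{0..<2 ^ q}. {x. dyadic_dense \<delta> (Pair x -` E) q j} \<times> dyadic_cell q j)"
  proof (intro equalityI subsetI)
    fix w assume "w \<in> enlarge_snd \<delta> E"
    then obtain x y q where w: "w = (x, y)" "y \<in> {0..<1}" "dyadic_dense \<delta> (Pair x -` E) q \<lfloor>2 ^ q * y\<rfloor>"
      by (auto simp: enlarge_snd_def)
    then have "w \<in> {x. dyadic_dense \<delta> (Pair x -` E) q \<lfloor>2 ^ q * y\<rfloor>} \<times> dyadic_cell q \<lfloor>2 ^ q * y\<rfloor>"
      by (simp add: dyadic_cell_def)
    then show "w \<in> (\<Union>q. \<Union>j\<in>{0..<2 ^ q}. {x. dyadic_dense \<delta> (Pair x -` E) q j} \<times> dyadic_cell q j)"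
      using floor_pow2_unit[OF w(2), of q] by blast
  next
    fix w assume "w \<in> (\<Union>q. \<Union>j\<in>{0..<2 ^ q}. {x. dyadic_dense \<delta> (Pair x -` E) q j} \<times> dyadic_cell q j)"
    then obtain x y q j where "w = (x, y)" "j \<in> {0..<2 ^ q}" "dyadic_dense \<delta> (Pair x -` E) q j" "y \<in> dyadic_cell q j"
      by auto
    moreover from this have "y \<in> {0..<1}" using dyadic_cell_subset_unit[of j q] by blast
    ultimately show "w \<in> enlarge_snd \<delta> E" by (auto simp: enlarge_snd_def dyadic_cell_def)
  qed
  moreover have "{x. dyadic_dense \<delta> (Pair x -` E) q j} \<in> sets borel" for q j
  proof -
    have S: "E \<inter> (UNIV \<times> dyadic_cell q j) \<in> sets (lborel \<Otimes>\<^sub>M lborel)"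
      using E by (intro sets.Int) (auto simp: cong: sets_pair_measure_cong)
    have [measurable]: "(\<lambda>x. emeasure lborel (Pair x -` (E \<inter> (UNIV \<times> dyadic_cell q j)))) \<in> borel_measurable lborel"
      by (rule lborel.measurable_emeasure_Pair[OF S])
    have "Pair x -` (E \<inter> (UNIV \<times> dyadic_cell q j)) = dyadic_cell q j \<inter> Pair x -` E" for x by auto
    then have "{x. dyadic_dense \<delta> (Pair x -` E) q j}
        = {x \<in> space lborel. ennreal (\<delta> / 2 ^ q) \<le> emeasure lborel (Pair x -` (E \<inter> (UNIV \<times> dyadic_cell q j)))}"
      by (auto simp: dyadic_dense_def)
    also have "\<dots> \<in> sets lborel" by measurable
    finally show ?thesis by simp
  qed
  ultimately show ?thesis by auto
qed

lemma swap_lborel: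
  assumes S: "S \<in> sets (borel \<Otimes>\<^sub>M borel)"
  shows "prod.swap -` S \<in> sets (borel \<Otimes>\<^sub>M borel :: (real \<times> real) measure)"
    "emeasure (lborel \<Otimes>\<^sub>M lborel) (prod.swap -` S :: (real \<times> real) set) = emeasure (lborel \<Otimes>\<^sub>M lborel) S"
proof -
  have S': "S \<in> sets (lborel \<Otimes>\<^sub>M lborel)" using S by (simp cong: sets_pair_measure_cong)
  have sw: "(\<lambda>(x, y). (y, x)) = (prod.swap :: real \<times> real \<Rightarrow> real \<times> real)" by (auto simp: fun_eq_iff)
  have "prod.swap \<in> measurable (lborel \<Otimes>\<^sub>M lborel) (lborel \<Otimes>\<^sub>M lborel :: (real \<times> real) measure)"
    unfolding sw[symmetric] by measurable
  from measurable_sets[OF this S']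
  show "prod.swap -` S \<in> sets (borel \<Otimes>\<^sub>M borel :: (real \<times> real) measure)"
    by (simp add: space_pair_measure cong: sets_pair_measure_cong)
  have "emeasure (lborel \<Otimes>\<^sub>M lborel) S = emeasure (distr (lborel \<Otimes>\<^sub>M lborel) (lborel \<Otimes>\<^sub>M lborel) (\<lambda>(x, y). (y, x))) S"
    by (rule arg_cong[where f = "\<lambda>M. emeasure M S"]) (rule lborel_pair.distr_pair_swap)
  also have "\<dots> = emeasure (lborel \<Otimes>\<^sub>M lborel) (prod.swap -` S)"
    unfolding sw by (subst emeasure_distr) (use S' \<open>prod.swap \<in> measurable _ _\<close> in \<open>auto simp: space_pair_measure\<close>)
  finally show "emeasure (lborel \<Otimes>\<^sub>M lborel) (prod.swap -` S) = emeasure (lborel \<Otimes>\<^sub>M lborel) S" by simp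
qed

text \<open>On each vertical line \<open>enlarge_snd\<close> is a superlevel set of the dyadic
  maximal function of a section of \<open>E\<close>. The one-dimensional bound is integrated over
  these lines by Tonelli.\<close>

lemma enlarge_snd_bound:
  assumes E: "E \<in> sets (borel \<Otimes>\<^sub>M borel)" and \<delta>: "\<delta> > 0"
  shows "emeasure (lborel \<Otimes>\<^sub>M lborel) (enlarge_snd \<delta> E) \<le> ennreal (1 / \<delta>) * emeasure (lborel \<Otimes>\<^sub>M lborel) E"
proof -
  have S: "E \<in> sets (lborel \<Otimes>\<^sub>M lborel)" "enlarge_snd \<delta> E \<in> sets (lborel \<Otimes>\<^sub>M lborel)"
    using E enlarge_snd_sets[OF E] by (auto cong: sets_pair_measure_cong)
  have "emeasure (lborel \<Otimes>\<^sub>M lborel) (enlarge_snd \<delta> E) = (\<integral>\<^sup>+x. emeasure lborel (Pair x -` enlarge_snd \<delta> E) \<partial>lborel)"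
    by (rule lborel.emeasure_pair_measure_alt[OF S(2)])
  also have "\<dots> \<le> (\<integral>\<^sup>+x. ennreal (1 / \<delta>) * emeasure lborel (Pair x -` E) \<partial>lborel)"
  proof (rule nn_integral_mono)
    fix x
    have "Pair x -` E \<in> sets borel" using sets_Pair1[OF E, of x] by simp
    from dyadic_maximal_bound[OF this \<delta>]
    show "emeasure lborel (Pair x -` enlarge_snd \<delta> E) \<le> ennreal (1 / \<delta>) * emeasure lborel (Pair x -` E)"
      by (simp add: enlarge_snd_def vimage_def)
  qed
  also have "\<dots> = ennreal (1 / \<delta>) * (\<integral>\<^sup>+x. emeasure lborel (Pair x -` E) \<partial>lborel)"
    using lborel.measurable_emeasure_Pair[OF S(1)] by (intro nn_integral_cmult) simp
  also have "\<dots> = ennreal (1 / \<delta>) * emeasure (lborel \<Otimes>\<^sub>M lborel) E"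
    using lborel.emeasure_pair_measure_alt[OF S(1)] by simp
  finally show ?thesis .
qed

text \<open>Let \<open>I' \<times> J'\<close> be a subrectangle of \<open>I \<times> J\<close>
  contained in \<open>E\<close>, with sides at least \<delta> times as long. Enlarging
  \<open>E\<close> along the second coordinate fills \<open>I' \<times> J\<close>, and then
  enlarging along the first fills \<open>I \<times> J\<close>. Each enlargement costs a factor 1 /
  \<delta>.\<close>

lemma dyadic_rectangle_enlargement:
  assumes E: "E \<in> sets borel" and \<delta>: "\<delta> > 0"
  obtains H where "H \<in> sets borel" "emeasure lborel H \<le> ennreal (1 / \<delta>\<^sup>2) * emeasure lborel E"
    "\<And>z w p q p' q'. z \<in> unit_square \<Longrightarrow> dyadic_rect p' q' w \<subseteq> dyadic_rect p q z \<Longrightarrow> dyadic_rect p' q' w \<subseteq> E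
      \<Longrightarrow> \<delta> / 2 ^ p \<le> 1 / 2 ^ p' \<Longrightarrow> \<delta> / 2 ^ q \<le> 1 / 2 ^ q' \<Longrightarrow> z \<in> H"
proof (rule that)
  let ?F = "enlarge_snd \<delta> E"
  let ?H = "enlarge_fst \<delta> ?F"
  have E': "E \<in> sets (borel \<Otimes>\<^sub>M borel)" using E unfolding borel_prod .
  have F: "?F \<in> sets (borel \<Otimes>\<^sub>M borel)" using E' by (rule enlarge_snd_sets)
  note F' = swap_lborel[OF F]
  note H' = swap_lborel[OF enlarge_snd_sets[OF F'(1)]]
  show "?H \<in> sets borel" using H'(1) unfolding enlarge_fst_def borel_prod .
  have "emeasure lborel ?H \<le> ennreal (1 / \<delta>) * emeasure lborel ?F"
    using H'(2) enlarge_snd_bound[OF F'(1) \<delta>] F'(2) by (simp add: enlarge_fst_def lborel_prod)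
  also have "\<dots> \<le> ennreal (1 / \<delta>) * (ennreal (1 / \<delta>) * emeasure lborel E)"
    using enlarge_snd_bound[OF E' \<delta>] by (intro mult_left_mono) (auto simp: lborel_prod)
  also have "\<dots> = ennreal (1 / \<delta>\<^sup>2) * emeasure lborel E"
    using \<delta> by (simp add: mult.assoc[symmetric] ennreal_mult[symmetric] power2_eq_square)
  finally show "emeasure lborel ?H \<le> ennreal (1 / \<delta>\<^sup>2) * emeasure lborel E" .
  fix z w :: "real \<times> real" and p q p' q'
  assume z: "z \<in> unit_square" and sub: "dyadic_rect p' q' w \<subseteq> dyadic_rect p q z" "dyadic_rect p' q' w \<subseteq> E"
    and le: "\<delta> / 2 ^ p \<le> 1 / 2 ^ p'" "\<delta> / 2 ^ q \<le> 1 / 2 ^ q'"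
  define I where "I = dyadic_cell p \<lfloor>2 ^ p * fst z\<rfloor>"
  define J where "J = dyadic_cell q \<lfloor>2 ^ q * snd z\<rfloor>"
  define I' where "I' = dyadic_cell p' \<lfloor>2 ^ p' * fst w\<rfloor>"
  define J' where "J' = dyadic_cell q' \<lfloor>2 ^ q' * snd w\<rfloor>"
  have ne: "fst w \<in> I'" "snd w \<in> J'" by (auto simp: I'_def J'_def dyadic_cell_def)
  have IJ: "I' \<subseteq> I" "J' \<subseteq> J" "I' \<times> J' \<subseteq> E"
    using sub ne by (auto simp: dyadic_rect_def I_def J_def I'_def J'_def times_subset_iff)
  have J01: "J \<subseteq> {0..<1}" "I \<subseteq> {0..<1}"
    unfolding J_def I_def using z
    by (intro dyadic_cell_subset_unit floor_pow2_unit; force simp: unit_square_def)+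
  have F_mem: "(x, y) \<in> ?F" if "x \<in> I'" "y \<in> J" for x y
  proof -
    have J_y: "J = dyadic_cell q \<lfloor>2 ^ q * y\<rfloor>" using that by (auto simp: J_def dyadic_cell_def)
    have "ennreal (\<delta> / 2 ^ q) \<le> ennreal (1 / 2 ^ q')" using le by (simp add: ennreal_leI)
    also have "\<dots> = emeasure lborel J'" by (simp add: J'_def emeasure_dyadic_cell)
    also have "\<dots> \<le> emeasure lborel (J \<inter> Pair x -` E)"
    proof (rule emeasure_mono)
      show "J \<inter> Pair x -` E \<in> sets lborel" using sets_Pair1[OF E', of x] by (simp add: J_def)
    qed (use IJ that in auto)
    finally have "dyadic_dense \<delta> (Pair x -` E) q \<lfloor>2 ^ q * y\<rfloor>" by (simp add: dyadic_dense_def J_y)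
    then show ?thesis using that J01 by (auto simp: enlarge_snd_def)
  qed
  have "ennreal (\<delta> / 2 ^ p) \<le> ennreal (1 / 2 ^ p')" using le by (simp add: ennreal_leI)
  also have "\<dots> = emeasure lborel I'" by (simp add: I'_def emeasure_dyadic_cell)
  also have "\<dots> \<le> emeasure lborel (I \<inter> Pair (snd z) -` (prod.swap -` ?F))"
  proof (rule emeasure_mono)
    show "I \<inter> Pair (snd z) -` (prod.swap -` ?F) \<in> sets lborel"
      using sets_Pair1[OF F'(1), of "snd z"] by (simp add: I_def)
    have "snd z \<in> J" by (simp add: J_def dyadic_cell_def)
    then show "I' \<subseteq> I \<inter> Pair (snd z) -` (prod.swap -` ?F)" using F_mem IJ by auto
  qed
  finally have "dyadic_dense \<delta> (Pair (snd z) -` (prod.swap -` ?F)) p \<lfloor>2 ^ p * fst z\<rfloor>"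
    by (simp add: dyadic_dense_def I_def)
  moreover have "fst z \<in> {0..<1}" using z by (auto simp: unit_square_def)
  ultimately show "z \<in> ?H" by (cases z) (auto simp: enlarge_fst_def enlarge_snd_def)
qed

section \<open>Averages over nested rectangles\<close>

lemma sets_dyadic_rect: "dyadic_rect p q z \<in> sets lebesgue"
  unfolding dyadic_rect_def by (intro sets_completionI_sets) (simp add: borel_prod[symmetric])

lemma set_integrable_dyadic_rect:
  assumes "f absolutely_integrable_on unit_square" "z \<in> unit_square"
  shows "set_integrable lebesgue (dyadic_rect p q z) f"
  using assms(1) sets_dyadic_rect dyadic_rect_subset_unit[OF assms(2)] by (rule set_integrable_subset)

lemma dyadic_rect_self: "z \<in> dyadic_rect p q z"
  by (cases z) (simp add: dyadic_rect_def dyadic_cell_def)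

lemma dyadic_rect_eq: "w \<in> dyadic_rect p q z \<Longrightarrow> dyadic_rect p q w = dyadic_rect p q z"
  by (auto simp: dyadic_rect_def dyadic_cell_def)

lemma dyadic_rect_mono:
  assumes "p \<le> p'" "q \<le> q'"
  shows "dyadic_rect p' q' z \<subseteq> dyadic_rect p q z"
  by (auto simp: dyadic_rect_def dyadic_cell_def floor_pow2_div[OF assms(1)] floor_pow2_div[OF assms(2)])

text \<open>The average over a rectangle is the mean of the averages over its two halves, so it is
  attained or exceeded on one of them.\<close>

lemma dyadic_avg_child_fst:
  assumes f: "f absolutely_integrable_on unit_square" and z: "z \<in> unit_square"
  shows "\<exists>w\<in>dyadic_rect p q z. dyadic_avg f p q z \<le> dyadic_avg f (Suc p) q w"
proof -
  define j where "j = \<lfloor>2 ^ p * fst z\<rfloor>"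
  \<comment> \<open>A point in each half; its purpose is to name that half as a
    \<open>dyadic_rect\<close>.\<close>
  define W where "W i = (real_of_int (2 * j + i) / 2 ^ Suc p, snd z)" for i
  have cell: "\<lfloor>2 ^ Suc p * fst (W i)\<rfloor> = 2 * j + i" for i
  proof -
    have "2 ^ Suc p * fst (W i) = real_of_int (2 * j + i)" by (simp add: W_def)
    then show ?thesis by (simp only: floor_of_int)
  qed
  have split: "dyadic_rect p q z = dyadic_rect (Suc p) q (W 0) \<union> dyadic_rect (Suc p) q (W 1)"
    unfolding dyadic_rect_def cell j_def[symmetric] dyadic_cell_split[of p j] by (auto simp: W_def)
  have disj: "dyadic_rect (Suc p) q (W 0) \<inter> dyadic_rect (Suc p) q (W 1) = {}"
    unfolding dyadic_rect_def cell using dyadic_cell_disjoint[of "2 * j" "2 * j + 1" "Suc p"] by auto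
  have W: "W 0 \<in> dyadic_rect p q z" "W 1 \<in> dyadic_rect p q z"
    unfolding split using dyadic_rect_self by auto
  then have "W 0 \<in> unit_square" "W 1 \<in> unit_square" using dyadic_rect_subset_unit[OF z] by auto
  then have "(LINT w:dyadic_rect p q z|lebesgue. f w)
      = (LINT w:dyadic_rect (Suc p) q (W 0)|lebesgue. f w) + (LINT w:dyadic_rect (Suc p) q (W 1)|lebesgue. f w)"
    unfolding split using disj by (intro set_integral_Un set_integrable_dyadic_rect f)
  then have "2 * dyadic_avg f p q z = dyadic_avg f (Suc p) q (W 0) + dyadic_avg f (Suc p) q (W 1)"
    by (simp add: dyadic_avg_def algebra_simps)
  then have "dyadic_avg f p q z \<le> dyadic_avg f (Suc p) q (W 0) \<or> dyadic_avg f p q z \<le> dyadic_avg f (Suc p) q (W 1)"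
    by linarith
  then show ?thesis using W by blast
qed

lemma dyadic_avg_child_snd:
  assumes f: "f absolutely_integrable_on unit_square" and z: "z \<in> unit_square"
  shows "\<exists>w\<in>dyadic_rect p q z. dyadic_avg f p q z \<le> dyadic_avg f p (Suc q) w"
proof -
  define j where "j = \<lfloor>2 ^ q * snd z\<rfloor>"
  define W where "W i = (fst z, real_of_int (2 * j + i) / 2 ^ Suc q)" for i
  have cell: "\<lfloor>2 ^ Suc q * snd (W i)\<rfloor> = 2 * j + i" for i
  proof -
    have "2 ^ Suc q * snd (W i) = real_of_int (2 * j + i)" by (simp add: W_def)
    then show ?thesis by (simp only: floor_of_int)
  qed
  have split: "dyadic_rect p q z = dyadic_rect p (Suc q) (W 0) \<union> dyadic_rect p (Suc q) (W 1)"
    unfolding dyadic_rect_def cell j_def[symmetric] dyadic_cell_split[of q j] by (auto simp: W_def)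
  have disj: "dyadic_rect p (Suc q) (W 0) \<inter> dyadic_rect p (Suc q) (W 1) = {}"
    unfolding dyadic_rect_def cell using dyadic_cell_disjoint[of "2 * j" "2 * j + 1" "Suc q"] by auto
  have W: "W 0 \<in> dyadic_rect p q z" "W 1 \<in> dyadic_rect p q z"
    unfolding split using dyadic_rect_self by auto
  then have "W 0 \<in> unit_square" "W 1 \<in> unit_square" using dyadic_rect_subset_unit[OF z] by auto
  then have "(LINT w:dyadic_rect p q z|lebesgue. f w)
      = (LINT w:dyadic_rect p (Suc q) (W 0)|lebesgue. f w) + (LINT w:dyadic_rect p (Suc q) (W 1)|lebesgue. f w)"
    unfolding split using disj by (intro set_integral_Un set_integrable_dyadic_rect f)
  then have "2 * dyadic_avg f p q z = dyadic_avg f p (Suc q) (W 0) + dyadic_avg f p (Suc q) (W 1)"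
    by (simp add: dyadic_avg_def algebra_simps)
  then have "dyadic_avg f p q z \<le> dyadic_avg f p (Suc q) (W 0) \<or> dyadic_avg f p q z \<le> dyadic_avg f p (Suc q) (W 1)"
    by linarith
  then show ?thesis using W by blast
qed

text \<open>Repeated halving, keeping the better half each time, reaches every finer pair of
  levels.\<close>

lemma dyadic_avg_descendant:
  assumes f: "f absolutely_integrable_on unit_square" and z: "z \<in> unit_square" and le: "p \<le> p'" "q \<le> q'"
  obtains w where "w \<in> dyadic_rect p q z" "dyadic_avg f p q z \<le> dyadic_avg f p' q' w"
proof -
  have "\<exists>w\<in>dyadic_rect p q z. dyadic_avg f p q z \<le> dyadic_avg f p' q w"
    using le(1)
  proof (induction p' rule: dec_induct)
    case base
    show ?case using dyadic_rect_self by blast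
  next
    case (step n)
    then obtain w where w: "w \<in> dyadic_rect p q z" "dyadic_avg f p q z \<le> dyadic_avg f n q w" by blast
    then have "w \<in> unit_square" using dyadic_rect_subset_unit[OF z] by blast
    then obtain v where v: "v \<in> dyadic_rect n q w" "dyadic_avg f n q w \<le> dyadic_avg f (Suc n) q v"
      using dyadic_avg_child_fst[OF f] by blast
    then have "v \<in> dyadic_rect p q z"
      using dyadic_rect_mono[of p n q q w] step(1) dyadic_rect_eq[OF w(1)] by auto
    then show ?case using w v by force
  qed
  then obtain w where w: "w \<in> dyadic_rect p q z" "dyadic_avg f p q z \<le> dyadic_avg f p' q w" by blast
  have "\<exists>v\<in>dyadic_rect p q z. dyadic_avg f p q z \<le> dyadic_avg f p' q' v"
    using le(2)
  proof (induction q' rule: dec_induct)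
    case base
    show ?case using w by blast
  next
    case (step n)
    then obtain u where u: "u \<in> dyadic_rect p q z" "dyadic_avg f p q z \<le> dyadic_avg f p' n u" by blast
    then have "u \<in> unit_square" using dyadic_rect_subset_unit[OF z] by blast
    then obtain v where v: "v \<in> dyadic_rect p' n u" "dyadic_avg f p' n u \<le> dyadic_avg f p' (Suc n) v"
      using dyadic_avg_child_snd[OF f] by blast
    then have "v \<in> dyadic_rect p q z"
      using dyadic_rect_mono[OF le(1) step(1), of u] dyadic_rect_eq[OF u(1)] by auto
    then show ?case using u v by force
  qed
  then show ?thesis using that by blast
qed

lemma set_integral_dyadic_rect_nonneg:
  assumes "\<forall>z\<in>unit_square. 0 \<le> f z" "z \<in> unit_square"
  shows "0 \<le> (LINT w:dyadic_rect p q z|lebesgue. f w :: real)"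
  unfolding set_lebesgue_integral_def
  using assms dyadic_rect_subset_unit[OF assms(2), of p q]
  by (intro Bochner_Integration.integral_nonneg) (auto simp: indicator_def)

lemma dyadic_avg_nonneg:
  assumes "\<forall>z\<in>unit_square. 0 \<le> f z" "z \<in> unit_square"
  shows "0 \<le> dyadic_avg f p q z"
  using set_integral_dyadic_rect_nonneg[OF assms] by (simp add: dyadic_avg_def)

text \<open>For a non-negative function the integral can only grow on passing to the larger
  rectangle, while the area grows at most by the factor \<open>4 ^ d\<close>.\<close>

lemma dyadic_avg_ancestor:
  assumes f: "f absolutely_integrable_on unit_square" and nn: "\<forall>z\<in>unit_square. 0 \<le> f z"
    and z: "z \<in> unit_square" and w: "w \<in> dyadic_rect p' q' z"
    and le: "p \<le> p'" "q \<le> q'" "p' \<le> p + d" "q' \<le> q + d"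
  shows "dyadic_avg f p' q' z \<le> 4 ^ d * dyadic_avg f p q w"
proof -
  have w': "w \<in> unit_square" using w dyadic_rect_subset_unit[OF z] by blast
  have sub: "dyadic_rect p' q' z \<subseteq> dyadic_rect p q w"
    using dyadic_rect_mono[OF le(1,2), of w] dyadic_rect_eq[OF w] by simp
  have "(LINT v:dyadic_rect p' q' z|lebesgue. f v) \<le> (LINT v:dyadic_rect p q w|lebesgue. f v)"
    unfolding set_lebesgue_integral_def
  proof (rule integral_mono)
    fix v
    show "indicat_real (dyadic_rect p' q' z) v *\<^sub>R f v \<le> indicat_real (dyadic_rect p q w) v *\<^sub>R f v"
      using sub dyadic_rect_subset_unit[OF w', of p q] nn by (auto simp: indicator_def)
  qed (use set_integrable_dyadic_rect[OF f z] set_integrable_dyadic_rect[OF f w'] in \<open>auto simp: set_integrable_def\<close>)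
  moreover have nn0: "0 \<le> (LINT v:dyadic_rect p q w|lebesgue. f v)"
    using nn w' by (rule set_integral_dyadic_rect_nonneg)
  moreover have "(2::real) ^ p' * 2 ^ q' \<le> 4 ^ d * (2 ^ p * 2 ^ q)"
  proof -
    have "(2::real) ^ p' \<le> 2 ^ (p + d)" "(2::real) ^ q' \<le> 2 ^ (q + d)" using le by (auto intro: power_increasing)
    then have "(2::real) ^ p' * 2 ^ q' \<le> 2 ^ (p + d) * 2 ^ (q + d)" by (intro mult_mono) auto
    also have "\<dots> = (2 * 2) ^ d * (2 ^ p * 2 ^ q)" unfolding power_add power_mult_distrib by simp
    finally show ?thesis by simp
  qed
  ultimately have "dyadic_avg f p' q' z \<le> (4 ^ d * (2 ^ p * 2 ^ q)) * (LINT v:dyadic_rect p q w|lebesgue. f v)"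
    unfolding dyadic_avg_def by - (rule mult_mono', simp_all add: set_integral_dyadic_rect_nonneg[OF nn z])
  then show ?thesis by (simp add: dyadic_avg_def mult.assoc)
qed

section \<open>Indices versus levels, and why bounded distance excludes divergence\<close>

lemma haar_level_cases:
  assumes "n \<in> A" "n \<ge> 2"
  obtains k where "k \<in> haar_levels A" "n \<le> 2 ^ Suc k" "\<And>x. haar_lev n x \<in> {k, Suc k}"
proof -
  from haar_index_cases[OF assms(2)] obtain k i where ki: "i \<in> {1..2 ^ k}" "n = 2 ^ k + i" .
  then show ?thesis using assms by (intro that[of k]) (auto simp: haar_levels_def haar_lev_index)
qed

text \<open>Here \<open>n > k\<close> lets high levels produce large indices; in
  \<open>haar_level_cases\<close> the bound \<open>n \<le> 2 ^ Suc k\<close> lets large indices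
  force high levels.\<close>

lemma haar_levelsE:
  assumes "k \<in> haar_levels A"
  obtains n where "n \<in> A" "n \<ge> 2" "n > k" "\<And>x. haar_lev n x \<in> {k, Suc k}"
proof -
  from assms obtain i where i: "i \<in> {1..2 ^ k}" "2 ^ k + i \<in> A" by (auto simp: haar_levels_def)
  have "k < 2 ^ k" by (rule less_exp)
  then have "k < 2 ^ k + i" by (rule trans_less_add1)
  moreover have "2 \<le> 2 ^ k + i" using i one_le_power[of "2::nat" k] by simp
  ultimately show ?thesis using i by (intro that[of "2 ^ k + i"]) (auto simp: haar_lev_index)
qed

lemma Limsup_infty_frequently:
  assumes "Limsup (both_to_infinity_in M) (\<lambda>(n, m). ereal \<bar>S n m\<bar>) = \<infinity>"
  obtains n m where "n \<in> M" "m \<in> M" "n \<ge> K" "m \<ge> K" "\<bar>S n m\<bar> > B"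
proof (rule ccontr)
  assume "\<not> thesis"
  then have "eventually (\<lambda>w. (case w of (n, m) \<Rightarrow> ereal \<bar>S n m\<bar>) \<le> ereal B) (both_to_infinity_in M)"
    unfolding eventually_both_to_infinity_in using that by (intro exI[of _ K]) force
  then have "Limsup (both_to_infinity_in M) (\<lambda>(n, m). ereal \<bar>S n m\<bar>) \<le> ereal B"
    by (intro Limsup_bounded)
  then show False using assms by simp
qed

lemma measurable_haar_partial_sum:
  "haar_partial_sum n m f \<in> borel_measurable borel"
proof -
  have "haar2 i j \<in> borel_measurable (borel \<Otimes>\<^sub>M borel)" if "i \<ge> 1" "j \<ge> 1" for i j
  proof -
    have [measurable]: "haar i \<in> borel_measurable borel" "haar j \<in> borel_measurable borel"
      using that by simp_all
    show ?thesis unfolding haar2_def by measurable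
  qed
  then show ?thesis unfolding haar_partial_sum_def[abs_def] borel_prod
    by (intro borel_measurable_sum borel_measurable_times) auto
qed

lemma emeasure_unit_square: "emeasure lborel unit_square = 1"
  unfolding unit_square_def lborel_prod[symmetric] by (subst lborel.emeasure_pair_measure_Times) auto

text \<open>The sets \<open>E K\<close>, on which some late partial sum of \<open>N\<close> exceeds
  \<open>K\<close>, decrease to a null set by convergence. Divergence along \<open>M\<close> makes
  the enlargement of every \<open>E K\<close> cover almost all of the square, which bounds their
  measures below by a positive constant.\<close>

lemma no_divergence_if_levels_close:
  assumes f: "f absolutely_integrable_on unit_square" and nn: "\<forall>z\<in>unit_square. 0 \<le> f z"
    and NM: "N \<subseteq> {1..}" "M \<subseteq> {1..}"
    and L: "\<And>s. s \<in> haar_levels M \<Longrightarrow> \<exists>c\<in>haar_levels N. s \<le> c + L \<and> c \<le> s + L"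
    and ae: "AE z\<in>unit_square in lebesgue.
               ((\<lambda>(n, m). haar_partial_sum n m f z) \<longlongrightarrow> f z) (both_to_infinity_in N) \<and>
               Limsup (both_to_infinity_in M) (\<lambda>(n, m). ereal \<bar>haar_partial_sum n m f z\<bar>) = \<infinity>"
  shows False
proof -
  let ?S = "\<lambda>n m z. haar_partial_sum n m f z"
  define Dy where "Dy = dyadic_rats \<times> UNIV \<union> UNIV \<times> dyadic_rats"
  \<comment> \<open>\<open>K\<close> is both the least index and the threshold, which makes
    \<open>E\<close> decreasing. The null set \<open>Dy\<close> is included because partial sums are
    known to be averages only outside it, and \<open>E K\<close> has to contain entire
    rectangles.\<close>
  define E where "E K = Dy \<union> (\<Union>n\<in>N \<inter> {K..}. \<Union>m\<in>N \<inter> {K..}. {z \<in> unit_square. ?S n m z > real K}) \<inter> unit_square" for K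
  have dr: "dyadic_rats \<in> sets borel" using null_dyadic_rats by (auto simp: null_sets_def)
  have "Dy \<in> sets (borel \<Otimes>\<^sub>M borel)" unfolding Dy_def using dr by auto
  then have Dy_sets: "Dy \<in> sets borel" unfolding borel_prod .
  have sq: "unit_square \<in> sets borel" unfolding unit_square_def borel_prod[symmetric] by auto
  have lev: "{z \<in> unit_square. ?S n m z > real K} \<in> sets borel" for n m K
  proof -
    have "{z \<in> unit_square. ?S n m z > real K} = unit_square \<inter> {z \<in> space borel. ?S n m z > real K}" by auto
    then show ?thesis using sq measurable_haar_partial_sum[of n m f] by auto
  qed
  have E_sets: "E K \<in> sets borel" for K
    unfolding E_def using Dy_sets sq lev by (intro sets.Un sets.Int sets.countable_UN') auto
  have E_dec: "decseq E"
    unfolding decseq_Suc_iff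
  proof
    fix K
    have "real K < a" if "real (Suc K) < a" for a using that by simp
    then show "E (Suc K) \<subseteq> E K" unfolding E_def by fastforce
  qed
  have AE_Dy: "AE z in lebesgue. z \<notin> Dy"
    using AE_not_dyadic_rats by eventually_elim (auto simp: Dy_def)
  have "AE z in lebesgue. z \<notin> (\<Inter>K. E K)"
    using ae AE_Dy
  proof eventually_elim
    case (elim z)
    show ?case
    proof (cases "z \<in> unit_square")
      case True
      then have "((\<lambda>(n, m). ?S n m z) \<longlongrightarrow> f z) (both_to_infinity_in N)" using elim by simp
      from order_tendstoD(2)[OF this, of "f z + 1"]
      obtain K where K: "\<And>n m. n \<in> N \<Longrightarrow> m \<in> N \<Longrightarrow> min n m \<ge> K \<Longrightarrow> ?S n m z < f z + 1"
        unfolding eventually_both_to_infinity_in by auto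
      define K' where "K' = max K (nat \<lceil>f z + 1\<rceil>)"
      have "f z + 1 \<le> real K'" by (simp add: K'_def) linarith
      then have "?S n m z \<le> real K'" if "n \<in> N" "m \<in> N" "n \<ge> K'" "m \<ge> K'" for n m
        using K[OF that(1,2)] that(3,4) by (simp add: K'_def)
      then have "z \<notin> E K'" using elim(2) unfolding E_def by force
      then show ?thesis by blast
    qed (use elim in \<open>auto simp: E_def\<close>)
  qed
  moreover have E_int: "(\<Inter>K. E K) \<in> sets borel" using E_sets by auto
  ultimately have "(\<Inter>K. E K) \<in> null_sets lebesgue"
    by (subst AE_iff_null_sets) auto
  then have "emeasure lborel (\<Inter>K. E K) = 0" using E_int by (simp add: null_sets_def)
  moreover have "(\<lambda>K. emeasure lborel (E K)) \<longlonglongrightarrow> emeasure lborel (\<Inter>K. E K)"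
  proof (rule Lim_emeasure_decseq)
    have "emeasure lborel (E K) \<le> emeasure lborel Dy + emeasure lborel unit_square" for K
      using Dy_sets sq E_sets
      by (intro order_trans[OF emeasure_mono emeasure_subadditive]) (auto simp: E_def)
    moreover have "emeasure lborel Dy = 0"
    proof -
      have "AE z in lborel. z \<notin> Dy" using AE_Dy Dy_sets AE_completion_iff by blast
      then show ?thesis using Dy_sets AE_iff_null_sets[of Dy lborel] by (auto simp: null_sets_def)
    qed
    ultimately have "emeasure lborel (E K) \<le> 1" for K by (simp add: emeasure_unit_square)
    then show "emeasure lborel (E K) \<noteq> \<infinity>" for K by (metis ennreal_one_less_top infinity_ennreal_def leD)
  qed (use E_sets E_dec in auto)
  ultimately have E_lim: "(\<lambda>K. emeasure lborel (E K)) \<longlonglongrightarrow> 0" by simp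

  \<comment> \<open>A level of \<open>N\<close> is within \<open>L\<close> of a level of
    \<open>M\<close>, and an index of level \<open>k\<close> may average over level \<open>k\<close>
    or \<open>k + 1\<close>; so the refined levels chosen below exceed the given ones by at most
    \<open>L + 1\<close>.\<close>
  define \<delta> :: real where "\<delta> = 1 / 2 ^ Suc L"
  have \<delta>: "\<delta> > 0" by (simp add: \<delta>_def)
  have one_le: "1 \<le> ennreal (1 / \<delta>\<^sup>2) * emeasure lborel (E K)" for K
  proof -
    obtain H where H: "H \<in> sets borel" "emeasure lborel H \<le> ennreal (1 / \<delta>\<^sup>2) * emeasure lborel (E K)"
      and H_mem: "\<And>z w p q p' q'. z \<in> unit_square \<Longrightarrow> dyadic_rect p' q' w \<subseteq> dyadic_rect p q z \<Longrightarrow> dyadic_rect p' q' w \<subseteq> E K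
        \<Longrightarrow> \<delta> / 2 ^ p \<le> 1 / 2 ^ p' \<Longrightarrow> \<delta> / 2 ^ q \<le> 1 / 2 ^ q' \<Longrightarrow> z \<in> H"
      using dyadic_rectangle_enlargement[OF E_sets \<delta>] by metis
    have "AE z in lebesgue. z \<in> unit_square \<longrightarrow> z \<in> H"
      using ae AE_Dy
    proof eventually_elim
      case (elim z)
      show ?case
      proof
        assume z: "z \<in> unit_square"
        \<comment> \<open>The factor \<open>4 ^ Suc L\<close> is what
          \<open>dyadic_avg_ancestor\<close> will lose. The index bound
          \<open>2 ^ (K + L + 2)\<close> puts \<open>s\<close> and \<open>t\<close> so high that the
          neighbouring levels \<open>c\<close> and \<open>d\<close> of \<open>N\<close> are still at
          least \<open>K\<close>.\<close>
        define B where "B = 4 ^ Suc L * real K"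
        obtain n m where nm: "n \<in> M" "m \<in> M" "n \<ge> 2 ^ (K + L + 2)" "m \<ge> 2 ^ (K + L + 2)" "\<bar>?S n m z\<bar> > B"
          using elim z by (blast intro: Limsup_infty_frequently[of M "\<lambda>n m. ?S n m z" "2 ^ (K + L + 2)" B])
        have "2 ^ 1 \<le> (2::nat) ^ (K + L + 2)" by (rule power_increasing) auto
        then have nm2: "n \<ge> 2" "m \<ge> 2" using order_trans[OF _ nm(3)] order_trans[OF _ nm(4)] by simp_all
        obtain s where s: "s \<in> haar_levels M" "n \<le> 2 ^ Suc s" "\<And>x. haar_lev n x \<in> {s, Suc s}"
          using haar_level_cases[OF nm(1) nm2(1)] by metis
        obtain t where t: "t \<in> haar_levels M" "m \<le> 2 ^ Suc t" "\<And>x. haar_lev m x \<in> {t, Suc t}"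
          using haar_level_cases[OF nm(2) nm2(2)] by metis
        have st: "K + L + 2 \<le> Suc s" "K + L + 2 \<le> Suc t"
          using nm(3,4) s(2) t(2) power_increasing_iff[of "2::nat"] by (meson le_trans one_less_numeral_iff semiring_norm(76))+
        obtain c where c: "c \<in> haar_levels N" "s \<le> c + L" "c \<le> s + L" using L[OF s(1)] by blast
        obtain d where d: "d \<in> haar_levels N" "t \<le> d + L" "d \<le> t + L" using L[OF t(1)] by blast
        obtain n' where n': "n' \<in> N" "n' > c" "n' \<ge> 2" "\<And>x. haar_lev n' x \<in> {c, Suc c}"
          using haar_levelsE[OF c(1)] by metis
        obtain m' where m': "m' \<in> N" "m' > d" "m' \<ge> 2" "\<And>x. haar_lev m' x \<in> {d, Suc d}"
          using haar_levelsE[OF d(1)] by metis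
        define p where "p = haar_lev n (fst z)"
        define q where "q = haar_lev m (snd z)"
        \<comment> \<open>The level at which \<open>n'\<close> averages is \<open>c\<close> or
          \<open>c + 1\<close>, depending on the point. Refining down to \<open>c + 1\<close> at
          least keeps the small rectangle inside the \<open>N\<close>-rectangle of each of its
          points outside \<open>Dy\<close>.\<close>
        define p' where "p' = max p (Suc c)"
        define q' where "q' = max q (Suc d)"
        have p: "p \<in> {s, Suc s}" and q: "q \<in> {t, Suc t}" using s(3) t(3) by (auto simp: p_def q_def)
        have S_avg: "?S n m z = dyadic_avg f p q z"
          unfolding p_def q_def using z elim(2) nm2 by (intro haar_partial_sum_eq_avg f) (auto simp: Dy_def mem_Times_iff)
        then have big: "dyadic_avg f p q z > B" using nm(5) dyadic_avg_nonneg[OF nn z, of p q] by simp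
        obtain w where w: "w \<in> dyadic_rect p q z" "dyadic_avg f p q z \<le> dyadic_avg f p' q' w"
          using dyadic_avg_descendant[OF f z, of p p' q q'] by (auto simp: p'_def q'_def)
        have sub: "dyadic_rect p' q' w \<subseteq> dyadic_rect p q z"
          using dyadic_rect_mono[of p p' q q' w] dyadic_rect_eq[OF w(1)] by (simp add: p'_def q'_def)
        have sub_sq: "dyadic_rect p q z \<subseteq> unit_square" using z by (rule dyadic_rect_subset_unit)
        have "dyadic_rect p' q' w \<subseteq> E K"
        proof
          fix v assume v: "v \<in> dyadic_rect p' q' w"
          then have v_sq: "v \<in> unit_square" using sub sub_sq by blast
          show "v \<in> E K"
          proof (cases "v \<in> Dy")
            case False
            have lv: "haar_lev n' (fst v) \<in> {c, Suc c}" "haar_lev m' (snd v) \<in> {d, Suc d}" using n'(4) m'(4) by auto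
            have "dyadic_avg f p' q' w \<le> 4 ^ Suc L * dyadic_avg f (haar_lev n' (fst v)) (haar_lev m' (snd v)) v"
              by (rule dyadic_avg_ancestor[OF f nn])
                 (use v w(1) sub_sq lv p q c d in \<open>auto simp: p'_def q'_def\<close>)
            also have "dyadic_avg f (haar_lev n' (fst v)) (haar_lev m' (snd v)) v = ?S n' m' v"
              using v_sq False n' m' by (intro haar_partial_sum_eq_avg[symmetric] f) (auto simp: Dy_def mem_Times_iff)
            finally have "4 ^ Suc L * real K < 4 ^ Suc L * ?S n' m' v"
              by (rule order_less_le_trans[OF big[unfolded B_def] order_trans[OF w(2)]])
            then have "real K < ?S n' m' v" by (rule mult_left_less_imp_less) simp
            moreover have "n' \<ge> K" "m' \<ge> K" using n' m' c d st by auto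
            ultimately show ?thesis using v_sq n' m' by (auto simp: E_def)
          qed (simp add: E_def)
        qed
        moreover have "\<delta> / 2 ^ p \<le> 1 / 2 ^ p'"
        proof -
          have "(2::real) ^ p' \<le> 2 ^ (p + Suc L)" using p c by (intro power_increasing) (auto simp: p'_def)
          then show ?thesis by (simp add: \<delta>_def field_simps power_add)
        qed
        moreover have "\<delta> / 2 ^ q \<le> 1 / 2 ^ q'"
        proof -
          have "(2::real) ^ q' \<le> 2 ^ (q + Suc L)" using q d by (intro power_increasing) (auto simp: q'_def)
          then show ?thesis by (simp add: \<delta>_def field_simps power_add)
        qed
        ultimately show "z \<in> H" using H_mem z sub by blast
      qed
    qed
    then have "AE z in lborel. z \<in> unit_square \<longrightarrow> z \<in> H" using H(1) sq by (subst AE_completion_iff[symmetric]) auto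
    then have "emeasure lborel unit_square \<le> emeasure lborel H" using H(1) by (intro emeasure_mono_AE) auto
    then show ?thesis using H(2) by (simp add: emeasure_unit_square)
  qed
  have "(\<lambda>K. ennreal (1 / \<delta>\<^sup>2) * emeasure lborel (E K)) \<longlonglongrightarrow> ennreal (1 / \<delta>\<^sup>2) * 0"
    by (intro ennreal_tendsto_cmult E_lim) simp
  then have "1 \<le> ennreal (1 / \<delta>\<^sup>2) * 0" by (rule LIMSEQ_le_const) (use one_le in auto)
  then show False by simp
qed

section \<open>Spikes over sets of vanishing digits\<close>

definition zero_digits :: "nat set \<Rightarrow> real set" where
  "zero_digits T = {x. \<forall>t\<in>T. even \<lfloor>2 ^ t * x\<rfloor>}"

lemma zero_digits_anti_mono: "T \<subseteq> T' \<Longrightarrow> zero_digits T' \<subseteq> zero_digits T"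
  by (auto simp: zero_digits_def)

lemma zero_digits_cong:
  assumes "T \<subseteq> {..p}" "\<lfloor>2 ^ p * x\<rfloor> = \<lfloor>2 ^ p * y\<rfloor>"
  shows "x \<in> zero_digits T \<longleftrightarrow> y \<in> zero_digits T"
proof -
  have "\<lfloor>2 ^ t * x\<rfloor> = \<lfloor>2 ^ t * y\<rfloor>" if "t \<in> T" for t
  proof -
    have "t \<le> p" using assms(1) that by auto
    from floor_pow2_div[OF this, of x] floor_pow2_div[OF this, of y] show ?thesis using assms(2) by simp
  qed
  then show ?thesis by (simp add: zero_digits_def)
qed

lemma sets_zero_digits [measurable]:
  assumes "finite T"
  shows "zero_digits T \<in> sets borel"
proof -
  have "zero_digits T = {x \<in> space borel. \<forall>t\<in>T. even \<lfloor>2 ^ t * x\<rfloor>}" by (simp add: zero_digits_def)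
  also have "\<dots> \<in> sets borel" using assms by (intro sets.sets_Collect_finite_All) measurable
  finally show ?thesis .
qed

text \<open>The digits up to \<open>p\<close> are constant on a cell of level \<open>p\<close>, and
  every later digit required to vanish halves the measure. The induction starts at a level beyond
  all of \<open>T\<close> and moves to coarser cells.\<close>

lemma measure_cell_zero_digits:
  assumes fin: "finite T"
  shows "measure lborel (dyadic_cell p \<lfloor>2 ^ p * x\<rfloor> \<inter> zero_digits T)
    = indicator (zero_digits (T \<inter> {..p})) x / 2 ^ (p + card (T \<inter> {p<..}))"
proof -
  obtain b where b: "T \<subseteq> {..b}" using fin finite_nat_iff_bounded_le by blast
  define d where "d = b - p"
  have "T \<subseteq> {..p + d}" using b by (auto simp: d_def)
  then show ?thesis
  proof (induction d arbitrary: p x)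
    case 0
    then have T: "T \<inter> {..p} = T" "T \<inter> {p<..} = {}" by auto
    have "dyadic_cell p \<lfloor>2 ^ p * x\<rfloor> \<inter> zero_digits T = (if x \<in> zero_digits T then dyadic_cell p \<lfloor>2 ^ p * x\<rfloor> else {})"
    proof -
      have "x \<in> zero_digits T \<longleftrightarrow> y \<in> zero_digits T" if "y \<in> dyadic_cell p \<lfloor>2 ^ p * x\<rfloor>" for y
        by (rule zero_digits_cong[of T p]) (use 0 that in \<open>auto simp: dyadic_cell_def\<close>)
      then show ?thesis by (cases "x \<in> zero_digits T") auto
    qed
    then show ?case by (simp add: T measure_dyadic_cell)
  next
    case (Suc d)
    define j where "j = \<lfloor>2 ^ p * x\<rfloor>"
    define w where "w i = real_of_int (2 * j + i) / 2 ^ Suc p" for i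
    have fl: "\<lfloor>2 ^ Suc p * w i\<rfloor> = 2 * j + i" for i
    proof -
      have "2 ^ Suc p * w i = real_of_int (2 * j + i)" by (simp add: w_def)
      then show ?thesis by (simp only: floor_of_int)
    qed
    have fl': "\<lfloor>2 ^ p * w i\<rfloor> = \<lfloor>2 ^ p * x\<rfloor>" if "i \<in> {0, 1}" for i
      using floor_pow2_div[of p "Suc p" "w i"] that unfolding fl by (auto simp: j_def)
    have IH: "measure lborel (dyadic_cell (Suc p) (2 * j + i) \<inter> zero_digits T)
        = indicator (zero_digits (T \<inter> {..Suc p})) (w i) / 2 ^ (Suc p + card (T \<inter> {Suc p<..}))" for i
      using Suc.IH[of "Suc p" "w i"] Suc.prems unfolding fl by simp
    have wx: "w i \<in> zero_digits (T \<inter> {..p}) \<longleftrightarrow> x \<in> zero_digits (T \<inter> {..p})" if "i \<in> {0, 1}" for i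
      by (rule zero_digits_cong[OF _ fl'[OF that]]) auto
    have w: "w i \<in> zero_digits (T \<inter> {..Suc p}) \<longleftrightarrow> x \<in> zero_digits (T \<inter> {..p}) \<and> (Suc p \<in> T \<longrightarrow> i = 0)"
      if "i \<in> {0, 1}" for i
    proof -
      have "w i \<in> zero_digits (T \<inter> {..Suc p}) \<longleftrightarrow> w i \<in> zero_digits (T \<inter> {..p}) \<and> (Suc p \<in> T \<longrightarrow> even (2 * j + i))"
        unfolding zero_digits_def atMost_Suc Int_insert_right using fl[of i]
        by (cases "Suc p \<in> T") (simp_all del: power_Suc, blast)
      then show ?thesis using wx[OF that] that by auto
    qed
    have card: "card (T \<inter> {p<..}) = (if Suc p \<in> T then 1 else 0) + card (T \<inter> {Suc p<..})"
    proof -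
      have "{p<..} = insert (Suc p) {Suc p<..}" by auto
      then show ?thesis using fin by auto
    qed
    have "dyadic_cell p j \<inter> zero_digits T
        = (dyadic_cell (Suc p) (2 * j + 0) \<inter> zero_digits T) \<union> (dyadic_cell (Suc p) (2 * j + 1) \<inter> zero_digits T)"
      unfolding dyadic_cell_split[of p j] by auto
    also have "measure lborel \<dots> = measure lborel (dyadic_cell (Suc p) (2 * j + 0) \<inter> zero_digits T)
        + measure lborel (dyadic_cell (Suc p) (2 * j + 1) \<inter> zero_digits T)"
      using dyadic_cell_disjoint[of "2 * j" "2 * j + 1" "Suc p"] fin
      by (intro measure_Un_AE AE_I2 fmeasurable_Int_fmeasurable fmeasurable_dyadic_cell) auto
    also have "\<dots> = indicator (zero_digits (T \<inter> {..p})) x / 2 ^ (p + card (T \<inter> {p<..}))"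
      unfolding IH card using w[of 0] w[of 1] by (auto simp: indicator_def)
    finally show ?case by (simp add: j_def)
  qed
qed

text \<open>Position 0 is the parity of the integer part, which is even on the whole unit interval;
  hence \<open>0 \<notin> T\<close>.\<close>

lemma measure_zero_digits_unit:
  assumes "finite T" "0 \<notin> T"
  shows "measure lborel ({0..<1} \<inter> zero_digits T) = 1 / 2 ^ card T"
proof -
  have "T \<inter> {..0} = {}" "T \<inter> {0<..} = T" using assms by (auto intro: gr0I)
  then show ?thesis
    using measure_cell_zero_digits[OF assms(1), of 0 0] by (simp add: dyadic_cell_0 zero_digits_def)
qed

lemma measure_lborel_Times:
  fixes A B :: "real set"
  assumes "A \<in> sets borel" "B \<in> sets borel"
  shows "measure lborel (A \<times> B) = measure lborel A * measure lborel B"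
  using lborel.emeasure_pair_measure_Times[of A lborel B] assms
  by (simp add: lborel_prod measure_def enn2real_mult)

text \<open>The normalisation makes \<open>\<nu>\<close> the integral over the unit square (if \<open>0 \<notin> T\<close>).\<close>

definition spike :: "real \<Rightarrow> nat set \<Rightarrow> real \<times> real \<Rightarrow> real" where
  "spike \<nu> T z = \<nu> * 4 ^ card T * indicator (zero_digits T \<times> zero_digits T) z"

lemma set_integrable_spike:
  assumes "finite T" "R \<in> fmeasurable lborel"
  shows "set_integrable lebesgue R (spike \<nu> T)"
proof -
  have "zero_digits T \<times> zero_digits T \<in> sets borel"
    using assms(1) unfolding borel_prod[symmetric] by auto
  then have "R \<inter> (zero_digits T \<times> zero_digits T) \<in> fmeasurable lborel"
    using assms(2) by (intro fmeasurable_Int_fmeasurable) auto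
  then have "integrable lborel (indicat_real (R \<inter> (zero_digits T \<times> zero_digits T)))"
    by (simp add: fmeasurable_def)
  then have "integrable lborel (\<lambda>z. (\<nu> * 4 ^ card T) * indicat_real (R \<inter> (zero_digits T \<times> zero_digits T)) z)"
    by simp
  then have "integrable lebesgue (\<lambda>z. (\<nu> * 4 ^ card T) * indicat_real (R \<inter> (zero_digits T \<times> zero_digits T)) z)"
    using integrable_completion[of _ lborel] by blast
  then show ?thesis
    by (simp add: set_integrable_def spike_def indicator_inter_arith mult_ac)
qed

lemma dyadic_rect_fmeasurable: "dyadic_rect p q z \<in> fmeasurable lborel"
proof (rule fmeasurableI)
  show "dyadic_rect p q z \<in> sets lborel"
    unfolding dyadic_rect_def by (simp add: borel_prod[symmetric])
  show "emeasure lborel (dyadic_rect p q z) < \<infinity>"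
    unfolding dyadic_rect_def lborel_prod[symmetric]
    by (subst lborel.emeasure_pair_measure_Times) (auto simp: emeasure_dyadic_cell ennreal_mult_less_top)
qed

text \<open>Each digit of \<open>T\<close> that a level has passed doubles the average where the
  digit vanishes and annihilates it elsewhere; the digits still to come are averaged out by the
  normalisation.\<close>

lemma dyadic_avg_spike:
  assumes fin: "finite T"
  shows "dyadic_avg (spike \<nu> T) p q z = \<nu> * 2 ^ (card (T \<inter> {..p}) + card (T \<inter> {..q}))
    * indicator (zero_digits (T \<inter> {..p}) \<times> zero_digits (T \<inter> {..q})) z"
proof -
  let ?Z = "zero_digits T"
  let ?I = "dyadic_cell p \<lfloor>2 ^ p * fst z\<rfloor>" and ?J = "dyadic_cell q \<lfloor>2 ^ q * snd z\<rfloor>"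
  have c: "card T = card (T \<inter> {..p}) + card (T \<inter> {p<..})" for p
  proof -
    have "card (T \<inter> {..p} \<union> T \<inter> {p<..}) = card (T \<inter> {..p}) + card (T \<inter> {p<..})"
      using fin by (intro card_Un_disjoint) auto
    moreover have "T \<inter> {..p} \<union> T \<inter> {p<..} = T" by auto
    ultimately show ?thesis by simp
  qed
  have ZS: "?Z \<in> sets borel" using fin by simp
  have "(LINT w:dyadic_rect p q z|lebesgue. spike \<nu> T w)
      = (LINT w|lebesgue. (\<nu> * 4 ^ card T) * indicat_real (dyadic_rect p q z \<inter> ?Z \<times> ?Z) w)"
    unfolding set_lebesgue_integral_def spike_def
    by (intro Bochner_Integration.integral_cong) (auto simp: indicator_def)
  also have "\<dots> = \<nu> * 4 ^ card T * measure lebesgue (dyadic_rect p q z \<inter> ?Z \<times> ?Z)"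
    by simp
  also have "measure lebesgue (dyadic_rect p q z \<inter> ?Z \<times> ?Z) = measure lborel ((?I \<inter> ?Z) \<times> (?J \<inter> ?Z))"
  proof -
    have "(?I \<inter> ?Z) \<times> (?J \<inter> ?Z) \<in> sets borel" unfolding borel_prod[symmetric] using ZS by auto
    moreover have "dyadic_rect p q z \<inter> ?Z \<times> ?Z = (?I \<inter> ?Z) \<times> (?J \<inter> ?Z)" by (auto simp: dyadic_rect_def)
    ultimately show ?thesis by (simp add: measure_completion)
  qed
  also have "\<dots> = measure lborel (?I \<inter> ?Z) * measure lborel (?J \<inter> ?Z)"
    using ZS by (intro measure_lborel_Times) auto
  finally have "dyadic_avg (spike \<nu> T) p q z = 2 ^ p * 2 ^ q * (\<nu> * 4 ^ card T *
     (indicator (zero_digits (T \<inter> {..p})) (fst z) / 2 ^ (p + card (T \<inter> {p<..})) *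
      (indicator (zero_digits (T \<inter> {..q})) (snd z) / 2 ^ (q + card (T \<inter> {q<..})))))"
    by (simp add: dyadic_avg_def measure_cell_zero_digits[OF fin])
  moreover have "(4::real) ^ card T = 2 ^ (card (T \<inter> {..p}) + card (T \<inter> {p<..})) * 2 ^ (card (T \<inter> {..q}) + card (T \<inter> {q<..}))"
    unfolding c[symmetric] power_mult_distrib[symmetric] by simp
  ultimately show ?thesis
    by (cases z) (simp add: power_add indicator_times)
qed

section \<open>Exceptional and success sets and their measures\<close>

lemma card_initial_segment:
  fixes T :: "nat set"
  assumes fin: "finite T" and "0 \<notin> T" "m \<le> card T"
  obtains p where "card (T \<inter> {..p}) = m"
proof -
  have "\<exists>p. card (T \<inter> {..p}) = m" if "m \<le> card (T \<inter> {..b})" for b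
    using that
  proof (induction b)
    case 0
    then have "T \<inter> {..0} = {}" using assms by auto
    then show ?case using 0 by (intro exI[of _ 0]) auto
  next
    case (Suc b)
    \<comment> \<open>The count rises by at most one per level, so it takes every intermediate
      value.\<close>
    have "T \<inter> {..Suc b} \<subseteq> insert (Suc b) (T \<inter> {..b})" by (auto simp: le_Suc_eq)
    then have "card (T \<inter> {..Suc b}) \<le> Suc (card (T \<inter> {..b}))"
      using card_mono[of "insert (Suc b) (T \<inter> {..b})" "T \<inter> {..Suc b}"] fin by (simp add: card_insert_if split: if_splits)
    then show ?case using Suc by (cases "m \<le> card (T \<inter> {..b})") (auto intro!: exI[of _ "Suc b"])
  qed
  moreover obtain b where "T \<subseteq> {..b}" using fin finite_nat_iff_bounded_le by blast
  then have "T \<inter> {..b} = T" by auto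
  ultimately show ?thesis using assms(3) that by metis
qed

lemma initial_segment_mono:
  fixes T :: "nat set"
  assumes "finite T" "card (T \<inter> {..p}) \<le> card (T \<inter> {..q})"
  shows "T \<inter> {..p} \<subseteq> T \<inter> {..q}"
proof (cases "p \<le> q")
  case False
  then have "T \<inter> {..q} \<subseteq> T \<inter> {..p}" by auto
  moreover from this have "card (T \<inter> {..q}) \<le> card (T \<inter> {..p})" using assms(1) by (intro card_mono) auto
  ultimately have "T \<inter> {..q} = T \<inter> {..p}" using assms by (intro card_subset_eq) auto
  then show ?thesis by simp
qed auto

text \<open>Intended for \<open>T\<close> made of blocks of \<open>h\<close> digits: \<open>h dvd card (T \<inter> {..p})\<close> says that level \<open>p\<close>
  cuts no block, which is the case for the levels coming from \<open>N\<close>.\<close>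

definition spike_exceptional :: "nat set \<Rightarrow> nat \<Rightarrow> (real \<times> real) set" where
  "spike_exceptional T h = {z \<in> unit_square. \<exists>p q. h dvd card (T \<inter> {..p}) \<and> h dvd card (T \<inter> {..q})
     \<and> card T \<le> card (T \<inter> {..p}) + card (T \<inter> {..q}) \<and> z \<in> zero_digits (T \<inter> {..p}) \<times> zero_digits (T \<inter> {..q})}"

text \<open>If \<open>i\<close> whole blocks are passed in the first coordinate, at least
  \<open>l - i\<close> must be passed in the second. So \<open>l + 1\<close> product sets suffice,
  and each of them fixes \<open>l * h\<close> digits in total.\<close>

lemma spike_exceptional_bound:
  assumes fin: "finite T" and T0: "0 \<notin> T" and card: "card T = l * h" and h: "h > 0"
  shows "spike_exceptional T h \<in> sets borel"
    "emeasure lborel (spike_exceptional T h) \<le> ennreal ((real l + 1) / 2 ^ (l * h))"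
proof -
  \<comment> \<open>Any level that has passed exactly \<open>m\<close> digits will do: by
    \<open>initial_segment_mono\<close> such levels determine the same initial segment of
    \<open>T\<close>.\<close>
  define P where "P m = (SOME p. card (T \<inter> {..p}) = m)" for m
  have P: "card (T \<inter> {..P m}) = m" if m: "m \<le> l * h" for m
  proof -
    have "m \<le> card T" using m card by simp
    from card_initial_segment[OF fin T0 this] obtain p where "card (T \<inter> {..p}) = m" .
    then show ?thesis unfolding P_def by (rule someI)
  qed
  define Q where "Q i = ({0..<1} \<inter> zero_digits (T \<inter> {..P (i * h)})) \<times> ({0..<1} \<inter> zero_digits (T \<inter> {..P ((l - i) * h)}))" for i
  have eq: "spike_exceptional T h = (\<Union>i\<in>{..l}. Q i)"
  proof (intro equalityI subsetI)
    fix z assume "z \<in> spike_exceptional T h"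
    then obtain p q where z: "z \<in> unit_square" "h dvd card (T \<inter> {..p})" "h dvd card (T \<inter> {..q})"
      "card T \<le> card (T \<inter> {..p}) + card (T \<inter> {..q})" "z \<in> zero_digits (T \<inter> {..p}) \<times> zero_digits (T \<inter> {..q})"
      by (auto simp: spike_exceptional_def)
    obtain i where i: "card (T \<inter> {..p}) = i * h" using z(2) by (metis dvd_div_mult_self)
    obtain j where j: "card (T \<inter> {..q}) = j * h" using z(3) by (metis dvd_div_mult_self)
    have "card (T \<inter> {..p}) \<le> card T" using fin by (intro card_mono) auto
    then have il: "i \<le> l" using i card h by simp
    have "l * h \<le> (i + j) * h" using z(4) i j card by (simp add: add_mult_distrib)
    then have lj: "l - i \<le> j" using h by simp
    have "(l - i) * h \<le> l * h" "i * h \<le> l * h" using il by auto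
    note PP = P[OF this(1)] P[OF this(2)]
    have "T \<inter> {..P (i * h)} \<subseteq> T \<inter> {..p}" using fin PP i by (intro initial_segment_mono) auto
    moreover have "T \<inter> {..P ((l - i) * h)} \<subseteq> T \<inter> {..q}" using fin PP j lj by (intro initial_segment_mono) auto
    ultimately have "z \<in> Q i" using z(1,5) zero_digits_anti_mono unfolding Q_def unit_square_def by blast
    then show "z \<in> (\<Union>i\<in>{..l}. Q i)" using il by auto
  next
    fix z assume "z \<in> (\<Union>i\<in>{..l}. Q i)"
    then obtain i where i: "i \<le> l" "z \<in> Q i" by auto
    have "(l - i) * h \<le> l * h" "i * h \<le> l * h" using i by auto
    note PP = P[OF this(1)] P[OF this(2)]
    have "(l - i) * h + i * h = l * h" using i by (simp add: add_mult_distrib[symmetric])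
    then have le: "card T \<le> card (T \<inter> {..P (i * h)}) + card (T \<inter> {..P ((l - i) * h)})" using PP card by simp
    have "z \<in> unit_square" "z \<in> zero_digits (T \<inter> {..P (i * h)}) \<times> zero_digits (T \<inter> {..P ((l - i) * h)})"
      using i(2) by (auto simp: Q_def unit_square_def)
    then have "z \<in> unit_square \<and> (h dvd card (T \<inter> {..P (i * h)}) \<and> h dvd card (T \<inter> {..P ((l - i) * h)})
     \<and> card T \<le> card (T \<inter> {..P (i * h)}) + card (T \<inter> {..P ((l - i) * h)})
     \<and> z \<in> zero_digits (T \<inter> {..P (i * h)}) \<times> zero_digits (T \<inter> {..P ((l - i) * h)}))"
      using PP le by simp
    then show "z \<in> spike_exceptional T h" unfolding spike_exceptional_def by blast
  qed
  have Zs: "{0..<1} \<inter> zero_digits (T \<inter> {..p}) \<in> sets borel" for p using fin by auto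
  have Q_sets: "Q i \<in> sets borel" for i
    unfolding Q_def borel_prod[symmetric] using Zs by auto
  then show "spike_exceptional T h \<in> sets borel" unfolding eq by auto
  have mZ: "emeasure lborel ({0..<1} \<inter> zero_digits (T \<inter> {..P m})) = ennreal (1 / 2 ^ m)" if "m \<le> l * h" for m
  proof -
    have "{0..<1} \<inter> zero_digits (T \<inter> {..P m}) \<in> fmeasurable lborel"
      using fmeasurable_Int_fmeasurable[OF fmeasurable_dyadic_cell[of 0 0]] fin by (simp add: dyadic_cell_0)
    then have "emeasure lborel ({0..<1} \<inter> zero_digits (T \<inter> {..P m})) = ennreal (measure lborel ({0..<1} \<inter> zero_digits (T \<inter> {..P m})))"
      by (rule emeasure_eq_measure2)
    then show ?thesis using measure_zero_digits_unit[of "T \<inter> {..P m}"] fin T0 P[OF that] by simp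
  qed
  have mQ: "emeasure lborel (Q i) = ennreal (1 / 2 ^ (l * h))" if "i \<le> l" for i
  proof -
    have *: "(l - i) * h \<le> l * h" "i * h \<le> l * h" "i * h + (l - i) * h = l * h"
      using that by (auto simp: add_mult_distrib[symmetric])
    have "emeasure lborel (Q i) = ennreal (1 / 2 ^ (i * h)) * ennreal (1 / 2 ^ ((l - i) * h))"
      unfolding Q_def lborel_prod[symmetric] using Zs
      by (subst lborel.emeasure_pair_measure_Times) (auto simp: mZ[OF *(1)] mZ[OF *(2)])
    then show ?thesis by (simp add: ennreal_mult[symmetric] power_add[symmetric] *(3))
  qed
  have "emeasure lborel (spike_exceptional T h) \<le> (\<Sum>i\<in>{..l}. emeasure lborel (Q i))"
    unfolding eq by (rule emeasure_subadditive_finite) (use Q_sets in auto)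
  also have "\<dots> = (\<Sum>i\<in>{..l}. ennreal (1 / 2 ^ (l * h)))" by (intro sum.cong refl mQ) simp
  also have "\<dots> = ennreal ((real l + 1) / 2 ^ (l * h))"
    by (simp add: ennreal_of_nat_eq_real_of_nat ennreal_mult[symmetric] add_ac del: of_nat_Suc)
  finally show "emeasure lborel (spike_exceptional T h) \<le> ennreal ((real l + 1) / 2 ^ (l * h))" .
qed

text \<open>Off the exceptional set a nonzero average has passed fewer than \<open>l\<close> whole
  blocks in total, hence at most \<open>l - 1\<close>. If each level passes none or all of
  \<open>T\<close>, only passing none in both coordinates remains and the average is \<nu>. This
  sharper bound is what permits adding many spikes.\<close>

lemma spike_avg_bound:
  assumes fin: "finite T" and T0: "0 \<notin> T" and card: "card T = l * h" and h: "h > 0" and \<nu>: "\<nu> \<ge> 0"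
    and z: "z \<in> unit_square" "z \<notin> spike_exceptional T h"
    and pq: "h dvd card (T \<inter> {..p})" "h dvd card (T \<inter> {..q})"
  shows "dyadic_avg (spike \<nu> T) p q z \<le> \<nu> +
    (if card (T \<inter> {..p}) \<in> {0, card T} \<and> card (T \<inter> {..q}) \<in> {0, card T} then 0 else \<nu> * 2 ^ ((l - 1) * h))"
proof (cases "z \<in> zero_digits (T \<inter> {..p}) \<times> zero_digits (T \<inter> {..q})")
  case True
  then have lt: "card (T \<inter> {..p}) + card (T \<inter> {..q}) < card T"
    using z pq unfolding spike_exceptional_def by (auto simp: not_le[symmetric])
  show ?thesis
  proof (cases "card (T \<inter> {..p}) \<in> {0, card T} \<and> card (T \<inter> {..q}) \<in> {0, card T}")
    case True
    then have "card (T \<inter> {..p}) = 0" "card (T \<inter> {..q}) = 0" using lt by auto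
    then have "dyadic_avg (spike \<nu> T) p q z \<le> \<nu> * 1"
      unfolding dyadic_avg_spike[OF fin] using \<nu> by (simp add: indicator_def)
    then show ?thesis using True by simp
  next
    case False
    obtain i where i: "card (T \<inter> {..p}) = i * h" using pq(1) by (metis dvd_div_mult_self)
    obtain j where j: "card (T \<inter> {..q}) = j * h" using pq(2) by (metis dvd_div_mult_self)
    have "(i + j) * h < l * h" using lt i j card by (simp add: add_mult_distrib)
    then have "(i + j) * h \<le> (l - 1) * h" by (intro mult_right_mono) auto
    then have "card (T \<inter> {..p}) + card (T \<inter> {..q}) \<le> (l - 1) * h" using i j by (simp add: add_mult_distrib)
    then have "(2::real) ^ (card (T \<inter> {..p}) + card (T \<inter> {..q})) \<le> 2 ^ ((l - 1) * h)"
      by (intro power_increasing) auto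
    then have "dyadic_avg (spike \<nu> T) p q z \<le> \<nu> * 2 ^ ((l - 1) * h)"
      unfolding dyadic_avg_spike[OF fin] using \<nu> by (simp add: indicator_def mult_left_mono)
    then show ?thesis using False \<nu> by auto
  qed
next
  case False
  then show ?thesis using \<nu> by (simp add: dyadic_avg_spike[OF fin])
qed

text \<open>This expresses independence: \<open>A\<close> is decided by the digits up to level
  \<open>a\<close>, and \<open>S\<close> occupies at least the proportion \<open>s\<close> of every
  square of that level, so removing \<open>S\<close> leaves at most the proportion
  \<open>1 - s\<close> of \<open>A\<close>.\<close>

lemma measure_diff_level_set:
  assumes A: "\<And>z w. \<lfloor>2 ^ a * fst z\<rfloor> = \<lfloor>2 ^ a * fst w\<rfloor> \<Longrightarrow> \<lfloor>2 ^ a * snd z\<rfloor> = \<lfloor>2 ^ a * snd w\<rfloor> \<Longrightarrow> z \<in> A \<longleftrightarrow> w \<in> A"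
    and S: "S \<in> sets borel" and s: "\<And>z. s / 4 ^ a \<le> measure lborel (dyadic_rect a a z \<inter> S)"
  shows "measure lborel (A \<inter> unit_square - S) \<le> (1 - s) * measure lborel (A \<inter> unit_square)"
proof -
  define Q where "Q = (\<lambda>(i, j). dyadic_cell a i \<times> dyadic_cell a j)"
  \<comment> \<open>Membership in \<open>A\<close> is constant on a square of level
    \<open>a\<close>, so it is tested at the lower left corner.\<close>
  define J where "J = {(i, j) \<in> {0..<2 ^ a} \<times> {0..<2 ^ a}. (real_of_int i / 2 ^ a, real_of_int j / 2 ^ a) \<in> A}"
  have finJ: "finite J" unfolding J_def by (rule finite_subset[of _ "{0..<2 ^ a} \<times> {0..<2 ^ a}"]) auto
  have Q_rect: "Q ij = dyadic_rect a a (real_of_int (fst ij) / 2 ^ a, real_of_int (snd ij) / 2 ^ a)" for ij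
    by (auto simp: Q_def dyadic_rect_def case_prod_beta)
  have Q_fm: "Q ij \<in> fmeasurable lborel" for ij
    unfolding Q_rect by (rule dyadic_rect_fmeasurable)
  have QS_fm: "Q ij - S \<in> fmeasurable lborel" for ij
    by (rule fmeasurableI2[OF Q_fm]) (use Q_fm[of ij] S in \<open>auto simp: fmeasurable_def\<close>)
  have mQ: "measure lborel (Q ij) = 1 / 4 ^ a" for ij
  proof -
    have "measure lborel (Q ij) = 1 / 2 ^ a * (1 / 2 ^ a)"
      unfolding Q_def case_prod_beta by (subst measure_lborel_Times) (auto simp: measure_dyadic_cell)
    also have "\<dots> = 1 / 4 ^ a" by (simp add: power_mult_distrib[symmetric])
    finally show ?thesis .
  qed
  have un: "A \<inter> unit_square = (\<Union>ij\<in>J. Q ij)"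
  proof (intro equalityI subsetI)
    fix z assume z: "z \<in> A \<inter> unit_square"
    define i j where "i = \<lfloor>2 ^ a * fst z\<rfloor>" and "j = \<lfloor>2 ^ a * snd z\<rfloor>"
    have "i \<in> {0..<2 ^ a}" "j \<in> {0..<2 ^ a}"
      using z floor_pow2_unit[of "fst z" a] floor_pow2_unit[of "snd z" a] by (auto simp: i_def j_def unit_square_def)
    moreover have "(real_of_int i / 2 ^ a, real_of_int j / 2 ^ a) \<in> A \<longleftrightarrow> z \<in> A"
      by (rule A) (simp_all add: i_def j_def)
    ultimately have "(i, j) \<in> J" using z by (auto simp: J_def)
    moreover have "z \<in> Q (i, j)" by (cases z) (simp add: Q_def i_def j_def dyadic_cell_def)
    ultimately show "z \<in> (\<Union>ij\<in>J. Q ij)" by blast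
  next
    fix z assume "z \<in> (\<Union>ij\<in>J. Q ij)"
    then obtain i j where ij: "(i, j) \<in> J" "z \<in> Q (i, j)" by auto
    then have "fst z \<in> dyadic_cell a i" "snd z \<in> dyadic_cell a j" by (auto simp: Q_def)
    moreover have "i \<in> {0..<2 ^ a}" "j \<in> {0..<2 ^ a}" using ij by (auto simp: J_def)
    ultimately have "fst z \<in> {0..<1}" "snd z \<in> {0..<1}" using dyadic_cell_subset_unit by blast+
    moreover have "(real_of_int i / 2 ^ a, real_of_int j / 2 ^ a) \<in> A \<longleftrightarrow> z \<in> A"
      by (rule A) (use ij(2) in \<open>auto simp: Q_def dyadic_cell_def\<close>)
    ultimately show "z \<in> A \<inter> unit_square" using ij by (cases z) (auto simp: J_def unit_square_def)
  qed
  have disj: "disjoint_family_on Q J" "disjoint_family_on (\<lambda>ij. Q ij - S) J"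
    by (auto simp: disjoint_family_on_def Q_def dyadic_cell_def)
  have "measure lborel (A \<inter> unit_square - S) = measure lborel (\<Union>ij\<in>J. Q ij - S)"
    unfolding un by (rule arg_cong[where f = "measure lborel"]) auto
  also have "\<dots> = (\<Sum>ij\<in>J. measure lborel (Q ij - S))"
    using finJ disj(2) QS_fm by (intro measure_finite_Union) (auto simp: fmeasurable_def less_top)
  also have "\<dots> \<le> (\<Sum>ij\<in>J. (1 - s) * measure lborel (Q ij))"
  proof (rule sum_mono)
    fix ij
    have "Q ij - S = Q ij - Q ij \<inter> S" by auto
    moreover have "measure lborel (Q ij - Q ij \<inter> S) = measure lborel (Q ij) - measure lborel (Q ij \<inter> S)"
      using Q_fm[of ij] fmeasurable_Int_fmeasurable[OF Q_fm[of ij], of S] S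
      by (intro measure_Diff) (auto simp: fmeasurable_def less_top)
    ultimately have "measure lborel (Q ij - S) = measure lborel (Q ij) - measure lborel (Q ij \<inter> S)" by simp
    also have "\<dots> \<le> 1 / 4 ^ a - s / 4 ^ a" using s by (simp add: mQ) (simp add: Q_rect)
    also have "\<dots> = (1 - s) * measure lborel (Q ij)" by (simp add: mQ diff_divide_distrib)
    finally show "measure lborel (Q ij - S) \<le> (1 - s) * measure lborel (Q ij)" .
  qed
  also have "\<dots> = (1 - s) * measure lborel (A \<inter> unit_square)"
    unfolding un sum_distrib_left[symmetric]
    using finJ disj(1) Q_fm by (subst measure_finite_Union) (auto simp: fmeasurable_def less_top)
  finally show ?thesis .
qed

text \<open>The level \<open>d i\<close> will cut the \<open>i\<close>-th block of \<open>T\<close>. All members of the union have the same measure,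
  and they form a staircase that is disjoint up to a fixed proportion.\<close>

definition spike_success :: "nat set \<Rightarrow> (nat \<Rightarrow> nat) \<Rightarrow> nat \<Rightarrow> (real \<times> real) set" where
  "spike_success T d l = (\<Union>i<l. zero_digits (T \<inter> {..d i}) \<times> zero_digits (T \<inter> {..d (l - 1 - i)}))"

lemma sets_spike_success:
  assumes "finite T"
  shows "spike_success T d l \<in> sets borel"
  unfolding spike_success_def borel_prod[symmetric] using assms by (intro sets.finite_UN) auto

lemma spike_success_cong:
  assumes "T \<subseteq> {..a}" "\<lfloor>2 ^ a * fst z\<rfloor> = \<lfloor>2 ^ a * fst w\<rfloor>" "\<lfloor>2 ^ a * snd z\<rfloor> = \<lfloor>2 ^ a * snd w\<rfloor>"
  shows "z \<in> spike_success T d l \<longleftrightarrow> w \<in> spike_success T d l"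
proof -
  have "T \<inter> {..b} \<subseteq> {..a}" for b using assms(1) by auto
  then have "fst z \<in> zero_digits (T \<inter> {..b}) \<longleftrightarrow> fst w \<in> zero_digits (T \<inter> {..b})"
    "snd z \<in> zero_digits (T \<inter> {..b}) \<longleftrightarrow> snd w \<in> zero_digits (T \<inter> {..b})" for b
    using zero_digits_cong assms(2,3) by blast+
  then show ?thesis unfolding spike_success_def by (auto simp: mem_Times_iff)
qed

text \<open>The strips \<open>E i\<close> are made disjoint by removing from the first factor the
  part that belongs to the next step. The next step requires at least one further digit to vanish,
  since \<open>v > 0\<close>, so at least half of each rectangle remains; this is the
  \<open>+ 1\<close> in the exponent.\<close>

lemma spike_success_measure:
  assumes fin: "finite T" and T: "T \<subseteq> {a<..}" and card: "card T = l * h" and h: "h = u + v" "v > 0"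
    and d: "\<And>i. i < l \<Longrightarrow> card (T \<inter> {..d i}) = i * h + u"
  shows "real l / 2 ^ ((l - 1) * h + 2 * u + 1) / 4 ^ a \<le> measure lborel (dyadic_rect a a z \<inter> spike_success T d l)"
proof -
  define I J where "I = dyadic_cell a \<lfloor>2 ^ a * fst z\<rfloor>" and "J = dyadic_cell a \<lfloor>2 ^ a * snd z\<rfloor>"
  define W where "W i = zero_digits (T \<inter> {..d i})" for i
  \<comment> \<open>After the last step all of \<open>T\<close> takes the place of the next initial
    segment.\<close>
  define W' where "W' i = (if Suc i < l then W (Suc i) else zero_digits T)" for i
  define E where "E i = (I \<inter> (W i - W' i)) \<times> (J \<inter> W (l - 1 - i))" for i
  have m: "measure lborel (dyadic_cell a \<lfloor>2 ^ a * x\<rfloor> \<inter> zero_digits S) = 1 / 2 ^ (a + card S)" if "S \<subseteq> T" for S and x :: real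
  proof -
    have S: "finite S" "S \<inter> {..a} = {}" "S \<inter> {a<..} = S" using that fin T by (auto intro: finite_subset)
    show ?thesis unfolding measure_cell_zero_digits[OF S(1)] S by (simp add: zero_digits_def)
  qed
  have WS: "W i \<in> sets borel" "W' i \<in> sets borel" "I \<in> sets borel" "J \<in> sets borel" for i
    using fin by (auto simp: W_def W'_def I_def J_def)
  have ES: "E i \<in> sets borel" for i
    unfolding E_def borel_prod[symmetric] using WS by auto
  have IJ: "I \<times> J = dyadic_rect a a z" by (simp add: dyadic_rect_def I_def J_def)
  have E_fm: "E i \<in> fmeasurable lborel" for i
    by (rule fmeasurableI2[OF dyadic_rect_fmeasurable[of a a z]]) (use ES in \<open>auto simp: IJ[symmetric] E_def\<close>)
  have W_anti: "W k \<subseteq> W i" if "i \<le> k" "k < l" for i k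
  proof -
    have "i * h + u \<le> k * h + u" using that by simp
    then have "T \<inter> {..d i} \<subseteq> T \<inter> {..d k}" using fin d that by (intro initial_segment_mono) auto
    then show ?thesis unfolding W_def by (rule zero_digits_anti_mono)
  qed
  have W'_sub: "W' i \<subseteq> W i" if "i < l" for i
    using W_anti[of i "Suc i"] that unfolding W'_def by (auto simp: W_def zero_digits_def)
  have mE: "1 / 2 ^ ((l - 1) * h + 2 * u + 1) / 4 ^ a \<le> measure lborel (E i)" if i: "i < l" for i
  proof -
    have mW: "measure lborel (I \<inter> W i) = 1 / 2 ^ (a + (i * h + u))"
      unfolding I_def W_def using m[of "T \<inter> {..d i}"] d[OF i] by simp
    have mJ: "measure lborel (J \<inter> W (l - 1 - i)) = 1 / 2 ^ (a + ((l - 1 - i) * h + u))"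
      unfolding J_def W_def using m[of "T \<inter> {..d (l - 1 - i)}"] d[of "l - 1 - i"] i by simp
    have mW': "measure lborel (I \<inter> W' i) \<le> 1 / 2 ^ (a + (i * h + u + 1))"
    proof (cases "Suc i < l")
      case True
      have "measure lborel (I \<inter> W' i) = 1 / 2 ^ (a + (Suc i * h + u))"
        using True m[of "T \<inter> {..d (Suc i)}"] d[OF True] by (simp add: W'_def W_def I_def)
      also have "\<dots> \<le> 1 / 2 ^ (a + (i * h + u + 1))"
        using h by (intro divide_left_mono power_increasing) auto
      finally show ?thesis .
    next
      case False
      then have "l = Suc i" using i by simp
      then have "measure lborel (I \<inter> W' i) = 1 / 2 ^ (a + Suc i * h)"
        using m[of T] card by (simp add: W'_def I_def)
      also have "\<dots> \<le> 1 / 2 ^ (a + (i * h + u + 1))"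
        using h by (intro divide_left_mono power_increasing) auto
      finally show ?thesis .
    qed
    have I_fm: "I \<in> fmeasurable lborel" by (simp add: I_def fmeasurable_dyadic_cell)
    have "I \<inter> (W i - W' i) = (I \<inter> W i) - (I \<inter> W' i)" by auto
    moreover have "measure lborel ((I \<inter> W i) - (I \<inter> W' i)) = measure lborel (I \<inter> W i) - measure lborel (I \<inter> W' i)"
      using W'_sub[OF i] fmeasurable_Int_fmeasurable[OF I_fm, of "W i"] WS
      by (intro measure_Diff) (auto simp: fmeasurable_def)
    ultimately have "measure lborel (I \<inter> (W i - W' i)) \<ge> 1 / 2 ^ (a + (i * h + u)) - 1 / 2 ^ (a + (i * h + u + 1))"
      using mW mW' by simp
    then have ge: "measure lborel (I \<inter> (W i - W' i)) \<ge> 1 / 2 ^ (a + (i * h + u + 1))" by simp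
    \<comment> \<open>The digits passed in the two coordinates add up to the same number for every
      \<open>i\<close>, so all strips obey one bound.\<close>
    have ex: "(l - 1) * h + 2 * u + 1 + (a + a) = (a + (i * h + u + 1)) + (a + ((l - 1 - i) * h + u))"
    proof -
      have "(l - 1) * h = i * h + (l - 1 - i) * h" using i by (simp add: add_mult_distrib[symmetric])
      then show ?thesis by simp
    qed
    have four: "(4::real) ^ a = 2 ^ (a + a)" by (simp only: power_add power_mult_distrib[symmetric]) simp
    have "1 / 2 ^ ((l - 1) * h + 2 * u + 1) / 4 ^ a = 1 / (2::real) ^ ((l - 1) * h + 2 * u + 1 + (a + a))"
      unfolding four power_add[of 2 _ "a + a"] by (simp only: divide_divide_eq_left)
    also have "\<dots> = 1 / 2 ^ (a + (i * h + u + 1)) * (1 / 2 ^ (a + ((l - 1 - i) * h + u)))"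
      unfolding ex by (simp add: power_add)
    also have "\<dots> \<le> measure lborel (I \<inter> (W i - W' i)) * (1 / 2 ^ (a + ((l - 1 - i) * h + u)))"
      using ge by (intro mult_right_mono) auto
    also have "\<dots> = measure lborel (E i)"
      unfolding E_def mJ[symmetric] using WS by (intro measure_lborel_Times[symmetric]) auto
    finally show ?thesis .
  qed
  have E_disj: "E i \<inter> E k = {}" if "i < k" "k < l" for i k
    using W_anti[of "Suc i" k] that by (auto simp: E_def W'_def)
  have disj: "disjoint_family_on E {..<l}"
    unfolding disjoint_family_on_def
  proof (intro ballI impI)
    fix i k assume "i \<in> {..<l}" "k \<in> {..<l}" "i \<noteq> k"
    then show "E i \<inter> E k = {}" using E_disj[of i k] E_disj[of k i] by (cases "i < k") auto
  qed
  have "real l / 2 ^ ((l - 1) * h + 2 * u + 1) / 4 ^ a = (\<Sum>i<l. 1 / 2 ^ ((l - 1) * h + 2 * u + 1) / 4 ^ a)" by simp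
  also have "\<dots> \<le> (\<Sum>i<l. measure lborel (E i))" using mE by (intro sum_mono) auto
  also have "\<dots> = measure lborel (\<Union>i<l. E i)"
    using disj E_fm by (intro measure_finite_Union[symmetric]) (auto simp: fmeasurable_def less_top)
  also have "\<dots> \<le> measure lborel (dyadic_rect a a z \<inter> spike_success T d l)"
  proof (rule measure_mono_fmeasurable)
    show "(\<Union>i<l. E i) \<subseteq> dyadic_rect a a z \<inter> spike_success T d l"
      unfolding spike_success_def IJ[symmetric] E_def W_def by blast
    show "dyadic_rect a a z \<inter> spike_success T d l \<in> fmeasurable lborel"
      using sets_spike_success[OF fin] by (intro fmeasurable_Int_fmeasurable dyadic_rect_fmeasurable) auto
  qed (use ES in auto)
  finally show ?thesis .
qed

text \<open>Leaving out the digit \<open>n + 1\<close> makes the levels \<open>n\<close> and \<open>n + 1\<close> equivalent, as a Haar partial sum of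
  index \<open>2 ^ n + i\<close> averages over cells of either level.\<close>

definition digit_block :: "nat \<Rightarrow> nat \<Rightarrow> nat \<Rightarrow> nat set" where
  "digit_block u v n = {n - u<..n} \<union> {Suc n<..Suc n + v}"

lemma digit_block_Int:
  assumes "u \<le> n"
  shows "p + u \<le> n \<Longrightarrow> card (digit_block u v n \<inter> {..p}) = 0"
    "Suc n + v \<le> p \<Longrightarrow> card (digit_block u v n \<inter> {..p}) = u + v"
    "p \<in> {n, Suc n} \<Longrightarrow> card (digit_block u v n \<inter> {..p}) = u"
proof -
  have c: "card (digit_block u v n) = u + v"
    unfolding digit_block_def using assms by (subst card_Un_disjoint) auto
  show "card (digit_block u v n \<inter> {..p}) = 0" if "p + u \<le> n"
    using that by (auto simp: digit_block_def)
  show "card (digit_block u v n \<inter> {..p}) = u + v" if "Suc n + v \<le> p"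
  proof -
    have "digit_block u v n \<inter> {..p} = digit_block u v n" using that by (auto simp: digit_block_def)
    then show ?thesis using c by simp
  qed
  show "card (digit_block u v n \<inter> {..p}) = u" if "p \<in> {n, Suc n}"
  proof -
    have "digit_block u v n \<inter> {..p} = {n - u<..n}" using that by (auto simp: digit_block_def)
    then show ?thesis using assms by simp
  qed
qed

section \<open>A family of independent spikes\<close>

lemma sparse_sequence:
  fixes D :: "nat set"
  assumes "\<And>K. \<exists>n\<in>D. n \<ge> K \<and> P n"
  obtains \<sigma> :: "nat \<Rightarrow> nat" where "\<And>i. \<sigma> i \<in> D" "\<And>i. P (\<sigma> i)" "\<And>i. K \<le> \<sigma> i" "\<And>i k. i < k \<Longrightarrow> \<sigma> i + g \<le> \<sigma> k"
proof -
  obtain pick where pick: "\<And>K. pick K \<in> D \<and> K \<le> pick K \<and> P (pick K)" using assms by metis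
  define \<sigma> where "\<sigma> = rec_nat (pick K) (\<lambda>_ n. pick (n + g))"
  have \<sigma>0: "\<sigma> 0 = pick K" and \<sigma>S: "\<sigma> (Suc i) = pick (\<sigma> i + g)" for i by (simp_all add: \<sigma>_def)
  have D: "\<sigma> i \<in> D" "P (\<sigma> i)" for i by (cases i; use pick \<sigma>0 \<sigma>S in simp)+
  have step: "\<sigma> i + g \<le> \<sigma> (Suc i)" for i using pick by (simp add: \<sigma>S)
  have sep: "\<sigma> i + g \<le> \<sigma> k" if "i < k" for i k
    using that
  proof (induction k)
    case (Suc k)
    show ?case
    proof (cases "i = k")
      case False
      then have "\<sigma> i + g \<le> \<sigma> k" using Suc by simp
      also have "\<dots> \<le> \<sigma> (Suc k)" using step[of k] by simp
      finally show ?thesis .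
    qed (use step in simp)
  qed simp
  have "K \<le> \<sigma> i" for i
    using pick[of K] sep[of 0 i] \<sigma>0 by (cases "i = 0") (auto intro: order_trans)
  then show ?thesis using D sep by (intro that[of \<sigma>]) auto
qed

text \<open>Intended for the spikes of which a given level has passed some digits but not all; there
  is at most one such spike.\<close>

lemma sum_at_most_one:
  fixes c :: real
  assumes "finite A" "c \<ge> 0" "\<And>r r'. r \<in> A \<Longrightarrow> r' \<in> A \<Longrightarrow> \<not> Q r \<Longrightarrow> \<not> Q r' \<Longrightarrow> r = r'"
  shows "(\<Sum>r\<in>A. if Q r then 0 else c) \<le> c"
proof -
  have "(\<Sum>r\<in>A. if Q r then 0 else c) = (\<Sum>r\<in>{r\<in>A. \<not> Q r}. c)"
    using assms(1) by (intro sum.mono_neutral_cong_right) auto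
  also have "\<dots> = real (card {r\<in>A. \<not> Q r}) * c" by simp
  also have "\<dots> \<le> 1 * c"
  proof (intro mult_right_mono)
    have "card {r\<in>A. \<not> Q r} \<le> Suc 0" using assms(1,3) by (subst card_le_Suc0_iff_eq) auto
    then show "real (card {r\<in>A. \<not> Q r}) \<le> 1" by simp
  qed (use assms in auto)
  finally show ?thesis by simp
qed

text \<open>The parameters are chosen in the order \<open>w\<close>, \<open>e\<close>, \<open>u\<close>, \<open>v\<close>. One spike succeeds with probability at
  least \<open>s = l / 2 ^ (L + 1)\<close>, and \<open>R\<close> independent ones have \<open>R * s = w\<close>, so that all of them fail with
  probability at most \<open>exp (- w)\<close>.\<close>

lemma spike_family_parameters:
  fixes \<epsilon> \<Lambda> :: real
  assumes \<epsilon>: "\<epsilon> > 0" and \<Lambda>: "\<Lambda> > 0"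
  obtains u v l R :: nat and \<nu> :: real where "v > 0" "l > 0" "\<nu> \<ge> 0"
    "\<nu> * 2 ^ ((l - 1) * (u + v) + 2 * u) = \<Lambda>"
    "real R * \<nu> \<le> \<epsilon> / 2" "2 * (\<nu> * 2 ^ ((l - 1) * (u + v))) \<le> \<epsilon> / 2"
    "real R * ((real l + 1) / 2 ^ (l * (u + v))) \<le> \<epsilon>"
    "(1 - real l / 2 ^ ((l - 1) * (u + v) + 2 * u + 1)) ^ R \<le> \<epsilon>"
    "real l / 2 ^ ((l - 1) * (u + v) + 2 * u + 1) \<le> 1"
proof -
  \<comment> \<open>Each choice secures one bound: \<open>w\<close> makes \<open>exp (- w)\<close>
    small; \<open>l = 2 ^ e\<close> makes the total integral
    \<open>R * \<nu> = 2 * w * \<Lambda> / l\<close> small; \<open>u\<close> makes the average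
    \<Lambda> / \<open>4 ^ u\<close> seen by \<open>N\<close> small; \<open>v\<close> makes the
    total exceptional measure, at most \<open>4 * w * 2 ^ u / 2 ^ v\<close>, small.\<close>
  obtain w :: nat where w: "- ln \<epsilon> < real w" using reals_Archimedean2 by blast
  obtain e where e: "4 * real w * \<Lambda> / \<epsilon> < 2 ^ e" using real_arch_pow[of 2] by auto
  obtain u where u: "4 * \<Lambda> / \<epsilon> < 4 ^ u" using real_arch_pow[of 4] by auto
  obtain v0 where v0: "4 * real w * 2 ^ u / \<epsilon> < 2 ^ v0" using real_arch_pow[of 2] by auto
  define v where "v = Suc v0"
  define l where "l = (2::nat) ^ e"
  define L where "L = (l - 1) * (u + v) + 2 * u"
  \<comment> \<open>Chosen so that \<open>R * l = w * 2 ^ (L + 1)\<close>. The fact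
    \<open>eL\<close> ensures that the subtraction in the exponent is not truncated, and that the
    success proportion is at most 1.\<close>
  define R where "R = w * 2 ^ (L + 1 - e)"
  define \<nu> where "\<nu> = \<Lambda> / 2 ^ L"
  have eL: "e \<le> L"
  proof -
    have "e < l" unfolding l_def by (rule less_exp)
    then have "e \<le> (l - 1) * 1" by simp
    also have "\<dots> \<le> (l - 1) * (u + v)" by (intro mult_left_mono) (auto simp: v_def)
    finally show ?thesis by (simp add: L_def)
  qed
  have l0: "l > 0" by (simp add: l_def)
  have Rl: "real R * real l = real w * 2 ^ (L + 1)"
  proof -
    have "(2::nat) ^ (L + 1 - e) * 2 ^ e = 2 ^ (L + 1)" using eL by (simp add: power_add[symmetric])
    then have "R * l = w * 2 ^ (L + 1)" unfolding R_def l_def by (simp only: mult.assoc)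
    then have "real (R * l) = real (w * 2 ^ (L + 1))" by (simp only:)
    then show ?thesis by simp
  qed
  show ?thesis
  proof (rule that[of v l \<nu> u R])
    show "v > 0" by (simp add: v_def)
    show "\<nu> \<ge> 0" using \<Lambda> by (simp add: \<nu>_def)
    show "\<nu> * 2 ^ ((l - 1) * (u + v) + 2 * u) = \<Lambda>" unfolding \<nu>_def L_def[symmetric] by simp
    have "real R * \<nu> * 2 ^ e = real R * real l * \<Lambda> / 2 ^ L" by (simp add: \<nu>_def l_def)
    also have "\<dots> = 2 * real w * \<Lambda>" unfolding Rl by simp
    finally have 1: "real R * \<nu> * 2 ^ e = 2 * real w * \<Lambda>" .
    have "4 * real w * \<Lambda> \<le> \<epsilon> * 2 ^ e" using e \<epsilon> by (simp add: field_simps)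
    then have "real R * \<nu> * 2 ^ e \<le> \<epsilon> / 2 * 2 ^ e" unfolding 1 by simp
    then show "real R * \<nu> \<le> \<epsilon> / 2" by (rule mult_right_le_imp_le) simp
    have "\<nu> * 2 ^ ((l - 1) * (u + v)) = \<Lambda> / 2 ^ (2 * u)" by (simp add: \<nu>_def L_def power_add)
    also have "\<dots> = \<Lambda> / 4 ^ u" by (simp add: power_mult)
    finally have 2: "\<nu> * 2 ^ ((l - 1) * (u + v)) = \<Lambda> / 4 ^ u" .
    show "2 * (\<nu> * 2 ^ ((l - 1) * (u + v))) \<le> \<epsilon> / 2" unfolding 2 using u \<epsilon> by (simp add: field_simps)
    have ex: "L + 2 + v = l * (u + v) + u + 2"
      using l0 by (cases l) (auto simp: L_def)
    have "real R * (real l + 1) \<le> real R * (2 * real l)" using l0 by (intro mult_left_mono) auto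
    also have "\<dots> = real w * 2 ^ (L + 2)" using Rl by simp
    finally have "real R * ((real l + 1) / 2 ^ (l * (u + v))) \<le> real w * 2 ^ (L + 2) / 2 ^ (l * (u + v))"
      by (simp add: divide_right_mono)
    also have "\<dots> = real w * 2 ^ (L + 2 + v) / 2 ^ (l * (u + v)) / 2 ^ v" by (simp add: power_add)
    also have "\<dots> = 4 * real w * 2 ^ u / 2 ^ v" unfolding ex by (simp add: power_add)
    also have "\<dots> \<le> \<epsilon>"
    proof -
      have "4 * real w * 2 ^ u / \<epsilon> < 2 ^ v" using v0 by (simp add: v_def) (smt (verit) zero_less_power)
      then show ?thesis using \<epsilon> by (simp add: field_simps)
    qed
    finally show "real R * ((real l + 1) / 2 ^ (l * (u + v))) \<le> \<epsilon>" .
    define s where "s = real l / 2 ^ (L + 1)"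
    have s1: "s \<le> 1"
    proof -
      have "(2::real) ^ e \<le> 2 ^ (L + 1)" using eL by (intro power_increasing) auto
      then show ?thesis by (simp add: s_def l_def)
    qed
    then show "real l / 2 ^ ((l - 1) * (u + v) + 2 * u + 1) \<le> 1" unfolding s_def L_def .
    have "(1 - s) ^ R \<le> exp (- s) ^ R" using s1 exp_ge_add_one_self[of "- s"] by (intro power_mono) auto
    also have "\<dots> = exp (- (real R * s))" by (simp add: exp_of_nat_mult[symmetric])
    also have "real R * s = real w" using Rl by (simp add: s_def)
    also have "exp (- real w) \<le> exp (ln \<epsilon>)" using w by simp
    also have "\<dots> = \<epsilon>" using \<epsilon> by simp
    finally show "(1 - real l / 2 ^ ((l - 1) * (u + v) + 2 * u + 1)) ^ R \<le> \<epsilon>" unfolding s_def L_def .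
  qed (rule l0)
qed

text \<open>One stage of the construction: the sum of \<open>R\<close> spikes has integral at most
  \<epsilon>, its averages along \<open>N\<close> are at most \<epsilon> off \<open>X\<close>, and
  some average along \<open>M\<close> reaches \<Lambda> on \<open>G\<close>. Both \<open>c\<close>
  and \<open>c + 1\<close> occur because an index of level \<open>c\<close> may average over
  either.\<close>

lemma spike_family:
  fixes C D :: "nat set" and \<epsilon> \<Lambda> :: real
  assumes gap: "\<And>g K. \<exists>n\<in>D. K \<le> n \<and> (\<forall>c\<in>C. c + g \<le> n \<or> n + g \<le> c)" and \<epsilon>: "\<epsilon> > 0" and \<Lambda>: "\<Lambda> > 0"
  obtains R :: nat and T :: "nat \<Rightarrow> nat set" and \<nu> :: real and X G :: "(real \<times> real) set"
  where "\<And>r. finite (T r)" "\<And>r. 0 \<notin> T r" "\<nu> \<ge> 0" "real R * \<nu> \<le> \<epsilon>"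
    "X \<in> sets borel" "emeasure lborel X \<le> ennreal \<epsilon>"
    "\<And>z p q. z \<in> unit_square \<Longrightarrow> z \<notin> X \<Longrightarrow> p \<in> C \<union> Suc ` C \<Longrightarrow> q \<in> C \<union> Suc ` C
       \<Longrightarrow> (\<Sum>r<R. dyadic_avg (spike \<nu> (T r)) p q z) \<le> \<epsilon>"
    "G \<in> sets borel" "emeasure lborel (unit_square - G) \<le> ennreal \<epsilon>"
    "\<And>z. z \<in> G \<Longrightarrow> \<exists>s\<in>D. \<exists>t\<in>D. K \<le> s \<and> K \<le> t \<and>
       (\<forall>p\<in>{s, Suc s}. \<forall>q\<in>{t, Suc t}. \<Lambda> \<le> (\<Sum>r<R. dyadic_avg (spike \<nu> (T r)) p q z))"
proof -
  obtain u v l R :: nat and \<nu> :: real where v: "v > 0" and l: "l > 0" and \<nu>: "\<nu> \<ge> 0"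
    and \<nu>_eq: "\<nu> * 2 ^ ((l - 1) * (u + v) + 2 * u) = \<Lambda>"
    and R1: "real R * \<nu> \<le> \<epsilon> / 2" and R2: "2 * (\<nu> * 2 ^ ((l - 1) * (u + v))) \<le> \<epsilon> / 2"
    and R3: "real R * ((real l + 1) / 2 ^ (l * (u + v))) \<le> \<epsilon>"
    and R4: "(1 - real l / 2 ^ ((l - 1) * (u + v) + 2 * u + 1)) ^ R \<le> \<epsilon>"
    and R5: "real l / 2 ^ ((l - 1) * (u + v) + 2 * u + 1) \<le> 1"
    by (rule spike_family_parameters[OF \<epsilon> \<Lambda>]) blast
  define h where "h = u + v"
  \<comment> \<open>The gap separates consecutive blocks and keeps the levels \<open>c\<close> and
    \<open>c + 1\<close>, for \<open>c\<close> in \<open>C\<close>, from cutting any block.\<close>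
  define g where "g = u + v + 3"
  obtain \<sigma> :: "nat \<Rightarrow> nat" where \<sigma>: "\<And>i. \<sigma> i \<in> D" "\<And>i. \<forall>c\<in>C. c + g \<le> \<sigma> i \<or> \<sigma> i + g \<le> c"
    "\<And>i. K + g \<le> \<sigma> i" and sep: "\<And>i k. i < k \<Longrightarrow> \<sigma> i + g \<le> \<sigma> k"
    using sparse_sequence[OF gap, of g "K + g" g] by blast
  define B where "B i = digit_block u v (\<sigma> i)" for i
  \<comment> \<open>The \<open>r\<close>-th spike uses the \<open>l\<close> consecutive blocks from
    number \<open>r * l\<close> on; \<open>a r\<close> is a level after all earlier spikes and
    before the first digit of this one.\<close>
  define T where "T r = (\<Union>i<l. B (r * l + i))" for r
  define d where "d r i = \<sigma> (r * l + i)" for r i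
  define a where "a r = \<sigma> (r * l) - u" for r
  have u\<sigma>: "u \<le> \<sigma> i" for i using \<sigma>(3)[of i] by (simp add: g_def)
  have finB: "finite (B i)" for i by (simp add: B_def digit_block_def)
  have B_sub: "B i \<subseteq> {\<sigma> i - u<..Suc (\<sigma> i) + v}" for i using u\<sigma>[of i] by (auto simp: B_def digit_block_def)
  have B_disj: "B i \<inter> B k = {}" if "i \<noteq> k" for i k
  proof -
    have "B i \<inter> B k = {}" if "i < k" for i k
    proof -
      have "x \<le> Suc (\<sigma> i) + v" if "x \<in> B i" for x using B_sub[of i] that by auto
      moreover have "\<sigma> k - u < x" if "x \<in> B k" for x using B_sub[of k] that by auto
      moreover have "Suc (\<sigma> i) + v \<le> \<sigma> k - u" using sep[OF that] by (simp add: g_def)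
      ultimately show ?thesis by (meson disjoint_iff leD le_trans)
    qed
    then show ?thesis using that by (metis inf_commute nat_neq_iff)
  qed
  have finT: "finite (T r)" for r using finB by (simp add: T_def)
  have card_T_Int: "card (T r \<inter> {..p}) = (\<Sum>i<l. card (B (r * l + i) \<inter> {..p}))" for r p
  proof -
    have "T r \<inter> {..p} = (\<Union>i<l. B (r * l + i) \<inter> {..p})" by (auto simp: T_def)
    also have "card \<dots> = (\<Sum>i<l. card (B (r * l + i) \<inter> {..p}))"
    proof (intro card_UN_disjoint ballI impI)
      fix i k :: nat assume "i \<noteq> k"
      then show "(B (r * l + i) \<inter> {..p}) \<inter> (B (r * l + k) \<inter> {..p}) = {}"
        using B_disj[of "r * l + i" "r * l + k"] by auto
    qed (use finB in auto)
    finally show ?thesis .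
  qed
  have T_low: "T r \<subseteq> {a r<..}" for r
  proof
    fix x assume "x \<in> T r"
    then obtain i where "i < l" "x \<in> B (r * l + i)" by (auto simp: T_def)
    then have "\<sigma> (r * l + i) - u < x" using B_sub[of "r * l + i"] by auto
    moreover have "\<sigma> (r * l) \<le> \<sigma> (r * l + i)" using sep[of "r * l" "r * l + i"] by (cases "i = 0") auto
    ultimately show "x \<in> {a r<..}" by (simp add: a_def)
  qed
  have T_up: "T r \<subseteq> {..a r'}" if "r < r'" for r r'
  proof
    fix x assume "x \<in> T r"
    then obtain i where i: "i < l" "x \<in> B (r * l + i)" by (auto simp: T_def)
    then have x: "x \<le> Suc (\<sigma> (r * l + i)) + v" using B_sub[of "r * l + i"] by auto
    have "r * l + l \<le> r' * l" using mult_le_mono1[of "Suc r" r' l] that by simp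
    then have "r * l + i < r' * l" using i by simp
    from sep[OF this] show "x \<in> {..a r'}" using x by (simp add: a_def g_def)
  qed
  have T0: "0 \<notin> T r" for r using T_low[of r] by auto
  have card_T: "card (T r) = l * h" for r
  proof -
    have "T r \<inter> {..a (Suc r)} = T r" using T_up[of r "Suc r"] by auto
    moreover have "card (B (r * l + i) \<inter> {..a (Suc r)}) = h" if "i < l" for i
    proof -
      have "r * l + i < Suc r * l" using that by simp
      from sep[OF this] show ?thesis
        unfolding B_def h_def by (intro digit_block_Int(2) u\<sigma>) (simp add: a_def g_def)
    qed
    ultimately show ?thesis using card_T_Int[of r "a (Suc r)"] by simp
  qed
  have card_good: "h dvd card (T r \<inter> {..p})" if "p \<in> C \<union> Suc ` C" for p r
  proof -
    have "\<exists>c\<in>C. c \<le> p \<and> p \<le> Suc c" using that by (auto intro: bexI[of _ p]) (use le_Suc_eq in blast)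
    then obtain c where c: "c \<in> C" "c \<le> p" "p \<le> Suc c" by blast
    have "card (B i \<inter> {..p}) \<in> {0, h}" for i
    proof (cases "c + g \<le> \<sigma> i")
      case True
      then have "p + u \<le> \<sigma> i" using c by (simp add: g_def)
      then show ?thesis using digit_block_Int(1)[OF u\<sigma>] by (simp add: B_def)
    next
      case False
      then have "Suc (\<sigma> i) + v \<le> p" using \<sigma>(2)[of i] c by (auto simp: g_def)
      then show ?thesis using digit_block_Int(2)[OF u\<sigma>] by (simp add: B_def h_def)
    qed
    then have "h dvd card (B i \<inter> {..p})" for i by (metis dvd_0_right dvd_refl insertE singletonD)
    then show ?thesis unfolding card_T_Int by (intro dvd_sum) auto
  qed
  have card_d: "card (T r \<inter> {..p}) = i * h + u" if "i < l" "p \<in> {d r i, Suc (d r i)}" for r i p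
  proof -
    have 1: "card (B (r * l + k) \<inter> {..p}) = h" if "k < i" for k
    proof -
      have "\<sigma> (r * l + k) + g \<le> \<sigma> (r * l + i)" using that by (intro sep) simp
      then show ?thesis unfolding B_def h_def
        using \<open>p \<in> _\<close> by (intro digit_block_Int(2) u\<sigma>) (auto simp: d_def g_def)
    qed
    have 2: "card (B (r * l + k) \<inter> {..p}) = 0" if "i < k" for k
    proof -
      have "\<sigma> (r * l + i) + g \<le> \<sigma> (r * l + k)" using that by (intro sep) simp
      then show ?thesis unfolding B_def
        using \<open>p \<in> _\<close> by (intro digit_block_Int(1) u\<sigma>) (auto simp: d_def g_def)
    qed
    have 3: "card (B (r * l + i) \<inter> {..p}) = u"
      unfolding B_def using that(2) by (intro digit_block_Int(3) u\<sigma>) (simp add: d_def)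
    have "card (T r \<inter> {..p}) = (\<Sum>k<l. if k < i then h else if k = i then u else 0)"
      unfolding card_T_Int using 1 2 3 by (intro sum.cong) (auto simp: not_less le_less)
    also have "{..<l} = {..<i} \<union> {i} \<union> {i<..<l}" using \<open>i < l\<close> by auto
    also have "(\<Sum>k\<in>{..<i} \<union> {i} \<union> {i<..<l}. if k < i then h else if k = i then u else 0) = i * h + u"
    proof -
      have "{..<i} \<inter> {i<..<l} = {}" by auto
      then show ?thesis by (simp add: sum.union_disjoint)
    qed
    finally show ?thesis .
  qed
  \<comment> \<open>Digit sets of different spikes occupy successive ranges: a level that has
    reached digits of a later spike has passed every digit of the earlier ones.\<close>
  have partial: "r = r'" if "card (T r \<inter> {..p}) \<notin> {0, card (T r)}" "card (T r' \<inter> {..p}) \<notin> {0, card (T r')}" for r r' p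
  proof -
    have *: False if "r < r'" "card (T r \<inter> {..p}) \<notin> {0, card (T r)}" "card (T r' \<inter> {..p}) \<notin> {0, card (T r')}" for r r'
    proof -
      have "T r' \<inter> {..p} \<noteq> {}" using that(3) by auto
      then obtain x where "x \<in> T r'" "x \<le> p" by auto
      then have "a r' < p" using T_low[of r'] by auto
      then have "T r \<inter> {..p} = T r" using T_up[OF that(1)] by auto
      then show False using that(2) by simp
    qed
    show ?thesis using *[of r r'] *[of r' r] that by (metis nat_neq_iff)
  qed

  define X where "X = (\<Union>r<R. spike_exceptional (T r) h)"
  have h0: "h > 0" using v by (simp add: h_def)
  note Ex = spike_exceptional_bound[OF finT T0 card_T h0]
  have X_sets: "X \<in> sets borel" unfolding X_def using Ex(1) by auto
  have "emeasure lborel X \<le> (\<Sum>r<R. emeasure lborel (spike_exceptional (T r) h))"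
    unfolding X_def by (rule emeasure_subadditive_finite) (use Ex(1) in auto)
  also have "\<dots> \<le> (\<Sum>r<R. ennreal ((real l + 1) / 2 ^ (l * h)))" by (intro sum_mono Ex(2))
  also have "\<dots> = ennreal (real R * ((real l + 1) / 2 ^ (l * h)))"
    by (subst sum_ennreal) auto
  also have "\<dots> \<le> ennreal \<epsilon>" using R3 by (intro ennreal_leI) (simp add: h_def)
  finally have X_bound: "emeasure lborel X \<le> ennreal \<epsilon>" .
  have X_avg: "(\<Sum>r<R. dyadic_avg (spike \<nu> (T r)) p q z) \<le> \<epsilon>"
    if z: "z \<in> unit_square" "z \<notin> X" and pq: "p \<in> C \<union> Suc ` C" "q \<in> C \<union> Suc ` C" for z p q
  proof -
    \<comment> \<open>Every spike contributes at most \<nu>, and an additional \<eta> only if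
      \<open>p\<close> or \<open>q\<close> has passed it partially. By \<open>partial\<close> each
      of \<open>p\<close> and \<open>q\<close> does so for at most one \<open>r\<close>, so the
      total is at most \<open>R * \<nu> + 2 * \<eta>\<close>.\<close>
    define \<eta> where "\<eta> = \<nu> * 2 ^ ((l - 1) * h)"
    have \<eta>: "\<eta> \<ge> 0" using \<nu> by (simp add: \<eta>_def)
    let ?Q = "\<lambda>p r. card (T r \<inter> {..p}) \<in> {0, card (T r)}"
    have "(\<Sum>r<R. dyadic_avg (spike \<nu> (T r)) p q z)
        \<le> (\<Sum>r<R. \<nu> + ((if ?Q p r then 0 else \<eta>) + (if ?Q q r then 0 else \<eta>)))"
    proof (rule sum_mono)
      fix r assume "r \<in> {..<R}"
      then have "z \<notin> spike_exceptional (T r) h" using z by (auto simp: X_def)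
      from spike_avg_bound[OF finT T0 card_T h0 \<nu> z(1) this card_good[OF pq(1)] card_good[OF pq(2)]]
      have "dyadic_avg (spike \<nu> (T r)) p q z \<le> \<nu> + (if ?Q p r \<and> ?Q q r then 0 else \<eta>)" by (simp only: \<eta>_def)
      also have "\<dots> \<le> \<nu> + ((if ?Q p r then 0 else \<eta>) + (if ?Q q r then 0 else \<eta>))" using \<eta> by auto
      finally show "dyadic_avg (spike \<nu> (T r)) p q z \<le> \<nu> + ((if ?Q p r then 0 else \<eta>) + (if ?Q q r then 0 else \<eta>))" .
    qed
    also have "\<dots> = real R * \<nu> + ((\<Sum>r<R. if ?Q p r then 0 else \<eta>) + (\<Sum>r<R. if ?Q q r then 0 else \<eta>))"
      by (simp only: sum.distrib) simp
    also have "\<dots> \<le> real R * \<nu> + (\<eta> + \<eta>)"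
    proof (intro add_mono order_refl)
      show "(\<Sum>r<R. if ?Q p r then 0 else \<eta>) \<le> \<eta>" for p
        by (rule sum_at_most_one[OF finite_lessThan \<eta>]) (rule partial)
      then show "(\<Sum>r<R. if ?Q q r then 0 else \<eta>) \<le> \<eta>" .
    qed
    also have "\<dots> \<le> \<epsilon>" using R1 R2 by (simp add: \<eta>_def h_def)
    finally show ?thesis .
  qed

  define S where "S r = spike_success (T r) (d r) l" for r
  define s where "s = real l / 2 ^ ((l - 1) * h + 2 * u + 1)"
  define G where "G = (\<Union>r<R. S r)"
  have S_sets: "S r \<in> sets borel" for r unfolding S_def by (rule sets_spike_success[OF finT])
  have sq: "unit_square \<in> sets borel" unfolding unit_square_def borel_prod[symmetric] by auto
  have S_meas: "s / 4 ^ a r \<le> measure lborel (dyadic_rect (a r) (a r) z \<inter> S r)" for r z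
    unfolding s_def S_def
    by (rule spike_success_measure[OF finT T_low card_T h_def v]) (auto intro!: card_d)
  \<comment> \<open>The first \<open>n\<close> success sets are decided by digits up to level
    \<open>a n\<close>, and \<open>S n\<close> fills at least the proportion \<open>s\<close> of
    each square of that level; so every spike multiplies the measure of failure by at most
    \<open>1 - s\<close>.\<close>
  have "measure lborel (unit_square - (\<Union>r<n. S r)) \<le> (1 - s) ^ n" for n
  proof (induction n)
    case 0
    then show ?case by (simp add: measure_def emeasure_unit_square)
  next
    case (Suc n)
    define A where "A = - (\<Union>r<n. S r)"
    have "unit_square - (\<Union>r<Suc n. S r) = A \<inter> unit_square - S n" by (auto simp: A_def less_Suc_eq)
    also have "measure lborel (A \<inter> unit_square - S n) \<le> (1 - s) * measure lborel (A \<inter> unit_square)"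
    proof (rule measure_diff_level_set[OF _ S_sets S_meas])
      fix z w :: "real \<times> real"
      assume "\<lfloor>2 ^ a n * fst z\<rfloor> = \<lfloor>2 ^ a n * fst w\<rfloor>" "\<lfloor>2 ^ a n * snd z\<rfloor> = \<lfloor>2 ^ a n * snd w\<rfloor>"
      then have "z \<in> S r \<longleftrightarrow> w \<in> S r" if "r < n" for r
        unfolding S_def by (intro spike_success_cong[OF T_up[OF that]])
      then show "z \<in> A \<longleftrightarrow> w \<in> A" by (auto simp: A_def)
    qed
    also have "A \<inter> unit_square = unit_square - (\<Union>r<n. S r)" by (auto simp: A_def)
    also have "(1 - s) * measure lborel (unit_square - (\<Union>r<n. S r)) \<le> (1 - s) * (1 - s) ^ n"
      using Suc R5 by (intro mult_left_mono) (auto simp: s_def h_def)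
    finally show ?case by simp
  qed
  from this[of R] have "measure lborel (unit_square - G) \<le> \<epsilon>"
    using R4 by (simp add: G_def s_def h_def)
  moreover have "unit_square - G \<in> fmeasurable lborel"
    by (rule fmeasurableI2[of unit_square])
       (use sq S_sets in \<open>auto simp: G_def fmeasurable_def emeasure_unit_square\<close>)
  ultimately have G_bound: "emeasure lborel (unit_square - G) \<le> ennreal \<epsilon>"
    by (simp add: emeasure_eq_measure2 ennreal_leI)
  have G_avg: "\<exists>s\<in>D. \<exists>t\<in>D. K \<le> s \<and> K \<le> t \<and>
       (\<forall>p\<in>{s, Suc s}. \<forall>q\<in>{t, Suc t}. \<Lambda> \<le> (\<Sum>r<R. dyadic_avg (spike \<nu> (T r)) p q z))" if "z \<in> G" for z
  proof -
    obtain r i where ri: "r < R" "i < l" "z \<in> zero_digits (T r \<inter> {..d r i}) \<times> zero_digits (T r \<inter> {..d r (l - 1 - i)})"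
      using \<open>z \<in> G\<close> unfolding G_def S_def spike_success_def by blast
    define k where "k = l - 1 - i"
    have k: "k < l" "i + k = l - 1" using ri by (auto simp: k_def)
    have "\<Lambda> \<le> (\<Sum>r<R. dyadic_avg (spike \<nu> (T r)) p q z)"
      if p: "p \<in> {d r i, Suc (d r i)}" and q: "q \<in> {d r k, Suc (d r k)}" for p q
    proof -
      \<comment> \<open>Levels that have passed equally many digits have passed the same digits. By
        \<open>card_d\<close> this applies to each cutting level and its successor, so either level
        of a Haar index gives the same average.\<close>
      have "T r \<inter> {..p} = T r \<inter> {..q}" if "card (T r \<inter> {..p}) = card (T r \<inter> {..q})" for p q
        by (intro subset_antisym initial_segment_mono finT) (simp_all only: that order_refl)
      then have seg: "T r \<inter> {..p} = T r \<inter> {..d r i}" "T r \<inter> {..q} = T r \<inter> {..d r k}"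
        using card_d[OF ri(2) p] card_d[OF ri(2), of "d r i" r] card_d[OF k(1) q] card_d[OF k(1), of "d r k" r]
        by (simp_all only: insertI1)
      have "card (T r \<inter> {..p}) + card (T r \<inter> {..q}) = (i + k) * h + 2 * u"
        unfolding card_d[OF ri(2) p] card_d[OF k(1) q] by (simp add: add_mult_distrib)
      then have "dyadic_avg (spike \<nu> (T r)) p q z = \<Lambda>"
        unfolding dyadic_avg_spike[OF finT] using ri(3) k(2) \<nu>_eq by (simp add: seg k_def h_def)
      moreover have "dyadic_avg (spike \<nu> (T r)) p q z \<le> (\<Sum>r<R. dyadic_avg (spike \<nu> (T r)) p q z)"
        using ri(1) \<nu> by (intro member_le_sum) (auto simp: dyadic_avg_spike[OF finT])
      ultimately show ?thesis by simp
    qed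
    moreover have "d r i \<in> D" "d r k \<in> D" "K \<le> d r i" "K \<le> d r k"
      using \<sigma>(1) \<sigma>(3)[of "r * l + i"] \<sigma>(3)[of "r * l + k"] by (auto simp: d_def)
    ultimately show ?thesis by blast
  qed
  have "real R * \<nu> \<le> \<epsilon>" using R1 \<epsilon> by simp
  moreover have "G \<in> sets borel" unfolding G_def using S_sets by auto
  ultimately show ?thesis
    using that[of T \<nu> R X G] finT T0 \<nu> X_sets X_bound X_avg G_bound G_avg by blast
qed

section \<open>Superposition of spikes\<close>

text \<open>The geometric bound on the integrals allows integration term by term. The absolute value
  leaves the sum unchanged where the series converges, and makes \<open>f\<close> non-negative even
  where \<open>suminf\<close> is an unspecified value.\<close>

lemma sums_set_integral_superposition:
  fixes F :: "nat \<Rightarrow> real \<times> real \<Rightarrow> real"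
  assumes nn: "\<And>m z. 0 \<le> F m z" and int: "\<And>m. set_integrable lebesgue unit_square (F m)"
    and bound: "\<And>m. (LINT z:unit_square|lebesgue. F m z) \<le> (1 / 2) ^ m"
    and ae: "AE z in lebesgue. z \<in> unit_square \<longrightarrow> summable (\<lambda>m. F m z)"
    and S: "S \<in> sets lebesgue" "S \<subseteq> unit_square"
  defines "f \<equiv> \<lambda>z. \<bar>\<Sum>m. F m z\<bar>"
  shows "set_integrable lebesgue S f"
    "(\<lambda>m. LINT z:S|lebesgue. F m z) sums (LINT z:S|lebesgue. f z)"
proof -
  let ?G = "\<lambda>m z. indicat_real S z *\<^sub>R F m z"
  have G_int: "integrable lebesgue (?G m)" for m
    using set_integrable_subset[OF int S] by (simp add: set_integrable_def)
  have G_sum: "AE z in lebesgue. summable (\<lambda>m. norm (?G m z))"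
    using ae by eventually_elim (use S nn in \<open>auto simp: indicator_def\<close>)
  have G_le: "(LINT z|lebesgue. norm (?G m z)) \<le> (1 / 2) ^ m" for m
  proof -
    have "(LINT z|lebesgue. norm (?G m z)) \<le> (LINT z:unit_square|lebesgue. F m z)"
      unfolding set_lebesgue_integral_def
      using G_int int S nn
      by (intro integral_mono integrable_norm) (auto simp: indicator_def set_integrable_def)
    then show ?thesis using bound[of m] by simp
  qed
  have summ: "summable (\<lambda>m. LINT z|lebesgue. norm (?G m z))"
    by (rule summable_comparison_test'[of "\<lambda>m. (1 / 2 :: real) ^ m" 0])
       (use G_le in \<open>auto simp: summable_geometric\<close>)
  have eq: "(\<Sum>m. ?G m z) = indicat_real S z *\<^sub>R (\<Sum>m. F m z)" for z
    by (auto simp: indicator_def)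
  have I: "integrable lebesgue (\<lambda>z. indicat_real S z *\<^sub>R (\<Sum>m. F m z))"
    using integrable_suminf[OF G_int G_sum summ] unfolding eq .
  have "(\<lambda>z. norm (indicat_real S z *\<^sub>R (\<Sum>m. F m z))) = (\<lambda>z. indicat_real S z *\<^sub>R f z)"
    by (auto simp: f_def indicator_def)
  then have If: "integrable lebesgue (\<lambda>z. indicat_real S z *\<^sub>R f z)"
    using integrable_norm[OF I] by simp
  then show "set_integrable lebesgue S f" by (simp add: set_integrable_def)
  have "(\<lambda>m. integral\<^sup>L lebesgue (?G m)) sums (LINT z|lebesgue. (\<Sum>m. ?G m z))"
    by (rule sums_integral[OF G_int G_sum summ])
  also have "(LINT z|lebesgue. (\<Sum>m. ?G m z)) = (LINT z|lebesgue. indicat_real S z *\<^sub>R f z)"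
  proof (rule integral_cong_AE)
    show "AE z in lebesgue. (\<Sum>m. ?G m z) = indicat_real S z *\<^sub>R f z"
      using ae
    proof eventually_elim
      case (elim z)
      show ?case
      proof (cases "z \<in> S")
        case True
        then have "0 \<le> (\<Sum>m. F m z)" using elim S nn by (intro suminf_nonneg) auto
        then show ?thesis by (simp only: eq f_def abs_of_nonneg)
      qed simp
    qed
  qed (simp_all only: eq borel_measurable_integrable[OF I] borel_measurable_integrable[OF If])
  finally show "(\<lambda>m. LINT z:S|lebesgue. F m z) sums (LINT z:S|lebesgue. f z)"
    by (simp add: set_lebesgue_integral_def)
qed

lemma dyadic_avg_sum:
  assumes "finite A" "\<And>r. r \<in> A \<Longrightarrow> set_integrable lebesgue (dyadic_rect p q z) (F r)"
  shows "dyadic_avg (\<lambda>w. \<Sum>r\<in>A. F r w) p q z = (\<Sum>r\<in>A. dyadic_avg (F r) p q z)"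
  unfolding dyadic_avg_def set_lebesgue_integral_def scaleR_sum_right
  using assms(2) by (subst Bochner_Integration.integral_sum) (auto simp: set_integrable_def sum_distrib_left)

lemma unit_square_eq_rect: "unit_square = dyadic_rect 0 0 (0, 0)"
  by (simp add: unit_square_def dyadic_rect_def dyadic_cell_0)

lemma both_to_infinity_in_neq_bot:
  assumes "infinite A"
  shows "both_to_infinity_in A \<noteq> bot"
proof
  assume "both_to_infinity_in A = bot"
  then have "eventually (\<lambda>_. False) (both_to_infinity_in A)" by simp
  then obtain K where K: "\<And>n m. n \<in> A \<Longrightarrow> m \<in> A \<Longrightarrow> min n m \<ge> K \<Longrightarrow> False"
    unfolding eventually_both_to_infinity_in by blast
  obtain n where "n \<in> A" "n \<ge> K" using assms infinite_nat_iff_unbounded_le by blast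
  then show False using K[of n n] by simp
qed

text \<open>Stage \<open>k\<close> uses \<epsilon> = \<open>(1 / 2) ^ k\<close> and \<Lambda> =
  \<open>k + 1\<close>. By Borel-Cantelli almost every \<open>z\<close> lies outside
  \<open>X k\<close> and inside \<open>G k\<close> for all large \<open>k\<close>: the first makes
  the averages along \<open>N\<close> summable uniformly, the second makes one average along
  \<open>M\<close> of stage \<open>k\<close> at least \<open>k + 1\<close>.\<close>

lemma divergence_if_gaps:
  assumes NM: "N \<subseteq> {1..}" "M \<subseteq> {1..}" and inf: "infinite N"
    and gap: "\<And>g K. \<exists>n\<in>haar_levels M. K \<le> n \<and> (\<forall>c\<in>haar_levels N. c + g \<le> n \<or> n + g \<le> c)"
  shows "\<exists>f :: real \<times> real \<Rightarrow> real.
            f absolutely_integrable_on unit_square \<and> (\<forall>z\<in>unit_square. 0 \<le> f z) \<and>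
            (AE z\<in>unit_square in lebesgue.
               ((\<lambda>(n, m). haar_partial_sum n m f z) \<longlongrightarrow> f z) (both_to_infinity_in N) \<and>
               Limsup (both_to_infinity_in M) (\<lambda>(n, m). ereal \<bar>haar_partial_sum n m f z\<bar>) = \<infinity>)"
proof -
  let ?C = "haar_levels N" and ?D = "haar_levels M"
  \<comment> \<open>The conclusion of \<open>spike_family\<close> as a single predicate, so that all
    stages can be chosen at once.\<close>
  define Q where "Q k R T \<nu> X G \<longleftrightarrow> (\<forall>r. finite (T r)) \<and> (\<forall>r. 0 \<notin> T r) \<and> \<nu> \<ge> 0 \<and> real R * \<nu> \<le> (1 / 2) ^ k \<and>
     X \<in> sets borel \<and> emeasure lborel X \<le> ennreal ((1 / 2) ^ k) \<and>
     (\<forall>z p q. z \<in> unit_square \<longrightarrow> z \<notin> X \<longrightarrow> p \<in> ?C \<union> Suc ` ?C \<longrightarrow> q \<in> ?C \<union> Suc ` ?C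
       \<longrightarrow> (\<Sum>r<R. dyadic_avg (spike \<nu> (T r)) p q z) \<le> (1 / 2) ^ k) \<and>
     G \<in> sets borel \<and> emeasure lborel (unit_square - G) \<le> ennreal ((1 / 2) ^ k) \<and>
     (\<forall>z. z \<in> G \<longrightarrow> (\<exists>s\<in>?D. \<exists>t\<in>?D. k \<le> s \<and> k \<le> t \<and>
       (\<forall>p\<in>{s, Suc s}. \<forall>q\<in>{t, Suc t}. real k + 1 \<le> (\<Sum>r<R. dyadic_avg (spike \<nu> (T r)) p q z))))"
    for k R :: nat and T :: "nat \<Rightarrow> nat set" and \<nu> X G
  have "\<exists>R T \<nu> X G. Q k R T \<nu> X G" for k
  proof -
    have "(0::real) < (1 / 2) ^ k" "0 < real k + 1" by auto
    then show ?thesis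
    proof (rule spike_family[OF gap, where K = k])
      fix R :: nat and T :: "nat \<Rightarrow> nat set" and \<nu> X G
      assume "\<And>r. finite (T r)" "\<And>r. 0 \<notin> T r" "\<nu> \<ge> 0" "real R * \<nu> \<le> (1 / 2) ^ k"
    "X \<in> sets borel" "emeasure lborel X \<le> ennreal ((1 / 2) ^ k)"
    "\<And>z p q. z \<in> unit_square \<Longrightarrow> z \<notin> X \<Longrightarrow> p \<in> ?C \<union> Suc ` ?C \<Longrightarrow> q \<in> ?C \<union> Suc ` ?C
       \<Longrightarrow> (\<Sum>r<R. dyadic_avg (spike \<nu> (T r)) p q z) \<le> (1 / 2) ^ k"
    "G \<in> sets borel" "emeasure lborel (unit_square - G) \<le> ennreal ((1 / 2) ^ k)"
    "\<And>z. z \<in> G \<Longrightarrow> \<exists>s\<in>?D. \<exists>t\<in>?D. k \<le> s \<and> k \<le> t \<and>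
       (\<forall>p\<in>{s, Suc s}. \<forall>q\<in>{t, Suc t}. real k + 1 \<le> (\<Sum>r<R. dyadic_avg (spike \<nu> (T r)) p q z))"
      then have "Q k R T \<nu> X G" unfolding Q_def by blast
      then show "\<exists>R T \<nu> X G. Q k R T \<nu> X G" by blast
    qed
  qed
  then obtain R :: "nat \<Rightarrow> nat" and T :: "nat \<Rightarrow> nat \<Rightarrow> nat set" and \<nu> X G
    where Q: "\<And>k. Q k (R k) (T k) (\<nu> k) (X k) (G k)" by metis
  have finT: "finite (T k r)" and T0: "0 \<notin> T k r" and \<nu>: "\<nu> k \<ge> 0" and R: "real (R k) * \<nu> k \<le> (1 / 2) ^ k"
    and X: "X k \<in> sets borel" "emeasure lborel (X k) \<le> ennreal ((1 / 2) ^ k)"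
    and G: "G k \<in> sets borel" "emeasure lborel (unit_square - G k) \<le> ennreal ((1 / 2) ^ k)" for k r
    using Q[of k] unfolding Q_def by blast+
  have X_avg: "(\<Sum>r<R k. dyadic_avg (spike (\<nu> k) (T k r)) p q z) \<le> (1 / 2) ^ k"
    if "z \<in> unit_square" "z \<notin> X k" "p \<in> ?C \<union> Suc ` ?C" "q \<in> ?C \<union> Suc ` ?C" for k z p q
    using Q[of k] that unfolding Q_def by blast
  have G_avg: "\<exists>s\<in>?D. \<exists>t\<in>?D. k \<le> s \<and> k \<le> t \<and>
       (\<forall>p\<in>{s, Suc s}. \<forall>q\<in>{t, Suc t}. real k + 1 \<le> (\<Sum>r<R k. dyadic_avg (spike (\<nu> k) (T k r)) p q z))"
    if "z \<in> G k" for k z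
    using Q[of k] that unfolding Q_def by blast
  define F where "F k z = (\<Sum>r<R k. spike (\<nu> k) (T k r) z)" for k z
  define f where "f z = \<bar>\<Sum>k. F k z\<bar>" for z
  have F_nn: "0 \<le> F k z" for k z unfolding F_def spike_def using \<nu> by (intro sum_nonneg) auto
  have sp_int: "set_integrable lebesgue (dyadic_rect p q z) (spike (\<nu> k) (T k r))" for p q z k r
    by (rule set_integrable_spike[OF finT dyadic_rect_fmeasurable])
  have F_avg: "dyadic_avg (F k) p q z = (\<Sum>r<R k. dyadic_avg (spike (\<nu> k) (T k r)) p q z)" for k p q z
    unfolding F_def[abs_def] by (rule dyadic_avg_sum) (auto intro: sp_int)
  have F_int: "set_integrable lebesgue unit_square (F k)" for k
    using sp_int[of 0 0 "(0, 0)"] unfolding unit_square_eq_rect set_integrable_def F_def scaleR_sum_right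
    by (intro Bochner_Integration.integrable_sum) auto
  have F_bound: "(LINT z:unit_square|lebesgue. F k z) \<le> (1 / 2) ^ k" for k
  proof -
    have "(LINT z:unit_square|lebesgue. F k z) = dyadic_avg (F k) 0 0 (0, 0)"
      by (simp add: dyadic_avg_def unit_square_eq_rect)
    also have "\<dots> = (\<Sum>r<R k. \<nu> k)"
      unfolding F_avg
    proof (rule sum.cong[OF refl])
      fix r
      have "T k r \<inter> {..0} = {}" using T0[of k r] by auto
      then show "dyadic_avg (spike (\<nu> k) (T k r)) 0 0 (0, 0) = \<nu> k"
        by (simp add: dyadic_avg_spike[OF finT] zero_digits_def)
    qed
    finally show ?thesis using R by simp
  qed
  have "\<exists>b. \<forall>r<R k. T k r \<subseteq> {..b}" for k
  proof -
    have "finite (\<Union>r<R k. T k r)" using finT by auto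
    then show ?thesis by (metis UN_subset_iff finite_nat_iff_bounded_le lessThan_iff)
  qed
  then obtain b where b: "\<And>k r. r < R k \<Longrightarrow> T k r \<subseteq> {..b k}" by metis
  \<comment> \<open>Beyond the last digit used by stage \<open>k\<close>, its averages coincide with
    its values.\<close>
  have F_fix: "dyadic_avg (F k) p q z = F k z" if "b k \<le> p" "b k \<le> q" for k p q z
    unfolding F_avg F_def
  proof (rule sum.cong[OF refl])
    fix r assume "r \<in> {..<R k}"
    then have "T k r \<inter> {..p} = T k r" "T k r \<inter> {..q} = T k r" using b[of r k] that by auto
    then show "dyadic_avg (spike (\<nu> k) (T k r)) p q z = spike (\<nu> k) (T k r) z"
      by (simp add: dyadic_avg_spike[OF finT] spike_def power_add power_mult_distrib[symmetric])
  qed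
  have C_large: "\<exists>c\<in>?C. K \<le> c" for K
  proof -
    obtain n where n: "n \<in> N" "n \<ge> 2 ^ (K + 1)" using inf infinite_nat_iff_unbounded_le by blast
    have "(2::nat) ^ 1 \<le> 2 ^ (K + 1)" by (rule power_increasing) auto
    then have "n \<ge> 2" using order_trans[OF _ n(2)] by simp
    from haar_level_cases[OF n(1) this] obtain c where c: "c \<in> ?C" "n \<le> 2 ^ Suc c" by metis
    have "(2::nat) ^ (K + 1) \<le> 2 ^ Suc c" using n(2) c(2) by (rule order_trans)
    then have "K \<le> c" by (subst (asm) power_increasing_iff) auto
    then show ?thesis using c by blast
  qed
  \<comment> \<open>\<open>N\<close> has levels beyond \<open>b k\<close>, where averages are
    values; the bound on the averages along \<open>N\<close> is thus also a pointwise bound.\<close>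
  have F_small: "F k z \<le> (1 / 2) ^ k" if "z \<in> unit_square" "z \<notin> X k" for k z
  proof -
    obtain c where c: "c \<in> ?C" "b k \<le> c" using C_large by blast
    have "dyadic_avg (F k) c c z \<le> (1 / 2) ^ k" unfolding F_avg using X_avg[OF that] c by blast
    then show ?thesis using F_fix c by simp
  qed

  have sq: "unit_square \<in> sets borel" unfolding unit_square_def borel_prod[symmetric] by auto
  define A where "A k = X k \<union> (unit_square - G k)" for k
  have A_sets: "A k \<in> sets lborel" for k unfolding A_def using X G sq by auto
  have A_le: "emeasure lborel (A k) \<le> ennreal (2 * (1 / 2) ^ k)" for k
  proof -
    have "emeasure lborel (A k) \<le> emeasure lborel (X k) + emeasure lborel (unit_square - G k)"
      unfolding A_def using X G sq by (intro emeasure_subadditive) auto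
    also have "\<dots> \<le> ennreal ((1 / 2) ^ k) + ennreal ((1 / 2) ^ k)" using X G by (intro add_mono) auto
    also have "\<dots> = ennreal ((1 / 2) ^ k + (1 / 2) ^ k)" by (rule ennreal_plus[symmetric]) simp_all
    also have "(1 / 2) ^ k + (1 / 2) ^ k = 2 * (1 / 2 :: real) ^ k" by simp
    finally show ?thesis .
  qed
  have A_fin: "emeasure lborel (A k) < \<infinity>" for k
    using A_le[of k] by (rule order_le_less_trans) simp
  have "measure lborel (A k) \<le> 2 * (1 / 2) ^ k" for k
    unfolding measure_def by (rule enn2real_leI[OF _ A_le]) simp
  then have A_meas: "norm (measure lborel (A k)) \<le> 2 * (1 / 2) ^ k" for k by (simp only: real_norm_def abs_of_nonneg measure_nonneg)
  have "summable (\<lambda>k. 2 * (1 / 2 :: real) ^ k)" by (rule summable_mult[OF summable_geometric]) simp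
  then have "summable (\<lambda>k. measure lborel (A k))"
    by (rule summable_comparison_test') (rule A_meas)
  from borel_cantelli_AE1[OF A_sets A_fin this]
  have "AE z in lborel. eventually (\<lambda>k. z \<notin> A k) sequentially" by simp
  then have AE_A: "AE z in lebesgue. eventually (\<lambda>k. z \<notin> A k) sequentially" by (rule AE_completion)
  have F_summable: "summable (\<lambda>k. F k z)" if z: "z \<in> unit_square" and ev: "eventually (\<lambda>k. z \<notin> A k) sequentially" for z
  proof -
    obtain k0 where k0: "\<And>k. k \<ge> k0 \<Longrightarrow> z \<notin> A k" using ev unfolding eventually_sequentially by blast
    show ?thesis
    proof (rule summable_comparison_test'[of "\<lambda>k. (1 / 2 :: real) ^ k" k0])
      fix k assume "k \<ge> k0"
      then have "z \<notin> X k" using k0 unfolding A_def by blast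
      then show "norm (F k z) \<le> (1 / 2) ^ k" using F_small[OF z] F_nn by simp
    qed (simp add: summable_geometric)
  qed
  have AE_summable: "AE z in lebesgue. z \<in> unit_square \<longrightarrow> summable (\<lambda>k. F k z)"
    using AE_A by eventually_elim (rule impI, rule F_summable)
  note superpos = sums_set_integral_superposition[of F, OF F_nn F_int F_bound AE_summable]
  have f_int: "f absolutely_integrable_on unit_square"
    unfolding f_def[abs_def] using sq by (intro superpos(1)) auto
  have f_avg: "(\<lambda>k. dyadic_avg (F k) p q z) sums dyadic_avg f p q z" if "z \<in> unit_square" for p q z
    unfolding dyadic_avg_def f_def[abs_def]
    by (intro sums_mult superpos(2) sets_dyadic_rect dyadic_rect_subset_unit that)
  have F_avg_nn: "0 \<le> dyadic_avg (F k) p q z" if "z \<in> unit_square" for k p q z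
    using F_nn that by (intro dyadic_avg_nonneg) auto

  have "AE z\<in>unit_square in lebesgue.
               ((\<lambda>(n, m). haar_partial_sum n m f z) \<longlongrightarrow> f z) (both_to_infinity_in N) \<and>
               Limsup (both_to_infinity_in M) (\<lambda>(n, m). ereal \<bar>haar_partial_sum n m f z\<bar>) = \<infinity>"
    using AE_A AE_not_dyadic_rats
  proof (eventually_elim, intro impI conjI)
    fix z
    assume ev: "eventually (\<lambda>k. z \<notin> A k) sequentially" and nd: "fst z \<notin> dyadic_rats \<and> snd z \<notin> dyadic_rats"
      and z: "z \<in> unit_square"
    obtain k0 where k0: "\<And>k. k \<ge> k0 \<Longrightarrow> z \<notin> X k" "\<And>k. k \<ge> k0 \<Longrightarrow> z \<in> G k"
      using ev z unfolding A_def eventually_sequentially by blast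
    define P where "P k = (\<lambda>(n, m). dyadic_avg (F k) (haar_lev n (fst z)) (haar_lev m (snd z)) z)" for k
    have S_eq: "haar_partial_sum n m f z = (\<Sum>k. P k (n, m))" and P_sums: "summable (\<lambda>k. P k (n, m))"
      if "n \<ge> 1" "m \<ge> 1" for n m
      using haar_partial_sum_eq_avg[OF f_int z _ _ that] nd f_avg[OF z] by (auto simp: P_def sums_iff)
    have f_eq: "f z = (\<Sum>k. F k z)"
      using suminf_nonneg[OF F_summable[OF z ev] F_nn] by (simp add: f_def)
    have "((\<lambda>w. \<Sum>k. P k w) \<longlongrightarrow> (\<Sum>k. F k z)) (both_to_infinity_in N)"
    \<comment> \<open>Dominated convergence for series: each term is eventually constant by
      \<open>F_fix\<close>, and for \<open>k \<ge> k0\<close> the terms are bounded by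
      \<open>(1 / 2) ^ k\<close> uniformly in the indices.\<close>
    proof (rule tannerys_theorem[THEN conjunct2, THEN conjunct2])
      fix k
      show "(P k \<longlongrightarrow> F k z) (both_to_infinity_in N)"
      proof (rule tendsto_eventually)
        show "eventually (\<lambda>w. P k w = F k z) (both_to_infinity_in N)"
          unfolding eventually_both_to_infinity_in
        proof (intro exI[of _ "2 ^ (b k + 1)"] ballI impI)
          fix n m assume nm: "n \<in> N" "m \<in> N" "2 ^ (b k + 1) \<le> min n m"
          have big: "b k \<le> haar_lev n x" if "n \<in> N" "2 ^ (b k + 1) \<le> n" for n x
          proof -
            have "(2::nat) ^ 1 \<le> 2 ^ (b k + 1)" by (rule power_increasing) auto
            then have "n \<ge> 2" using order_trans[OF _ that(2)] by simp
            from haar_level_cases[OF that(1) this] obtain c where c: "n \<le> 2 ^ Suc c" "\<And>x. haar_lev n x \<in> {c, Suc c}" by metis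
            have "(2::nat) ^ (b k + 1) \<le> 2 ^ Suc c" using that(2) c(1) by (rule order_trans)
            then have "b k \<le> c" by (subst (asm) power_increasing_iff) auto
            then show ?thesis using c(2)[of x] by auto
          qed
          show "P k (n, m) = F k z"
            unfolding P_def using big[OF nm(1)] big[OF nm(2)] nm(3) by (simp add: F_fix)
        qed
      qed
    next
      \<comment> \<open>Index 1 belongs to no level, so the bound for levels coming from
        \<open>N\<close> starts at index 2.\<close>
      have "eventually (\<lambda>w. fst w \<in> N \<and> snd w \<in> N \<and> fst w \<ge> 2 \<and> snd w \<ge> 2) (both_to_infinity_in N)"
        unfolding eventually_both_to_infinity_in by (intro exI[of _ 2]) auto
      from eventually_prodI[OF eventually_ge_at_top[of k0] this]
      show "eventually (\<lambda>(k, w). norm (P k w) \<le> (1 / 2) ^ k) (at_top \<times>\<^sub>F both_to_infinity_in N)"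
      proof eventually_elim
        case (elim kw)
        obtain k n m where kw: "kw = (k, (n, m))" by (metis surj_pair)
        have lev: "haar_lev n x \<in> ?C \<union> Suc ` ?C" if "n \<in> N" "n \<ge> 2" for n x
          using haar_level_cases[OF that] by (metis UnI1 UnI2 image_eqI insertE singletonD)
        have "dyadic_avg (F k) (haar_lev n (fst z)) (haar_lev m (snd z)) z \<le> (1 / 2) ^ k"
          unfolding F_avg using elim kw k0 by (intro X_avg z lev) auto
        then show ?case using F_avg_nn[OF z] by (simp add: kw P_def)
      qed
    next
      show "summable (\<lambda>k. (1 / 2 :: real) ^ k)" by (rule summable_geometric) simp
      show "both_to_infinity_in N \<noteq> bot" by (rule both_to_infinity_in_neq_bot[OF inf])
    qed
    moreover have "eventually (\<lambda>w. (\<Sum>k. P k w) = (case w of (n, m) \<Rightarrow> haar_partial_sum n m f z)) (both_to_infinity_in N)"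
      unfolding eventually_both_to_infinity_in by (intro exI[of _ 1]) (auto simp: S_eq)
    ultimately show "((\<lambda>(n, m). haar_partial_sum n m f z) \<longlongrightarrow> f z) (both_to_infinity_in N)"
      unfolding f_eq by (rule Lim_transform_eventually)
    show "Limsup (both_to_infinity_in M) (\<lambda>(n, m). ereal \<bar>haar_partial_sum n m f z\<bar>) = \<infinity>"
    proof (rule ccontr)
      assume "Limsup (both_to_infinity_in M) (\<lambda>(n, m). ereal \<bar>haar_partial_sum n m f z\<bar>) \<noteq> \<infinity>"
      then obtain B where "Limsup (both_to_infinity_in M) (\<lambda>(n, m). ereal \<bar>haar_partial_sum n m f z\<bar>) < ereal B"
        by (metis less_PInf_Ex_of_nat)
      from Limsup_lessD[OF this] obtain K where K: "\<And>n m. n \<in> M \<Longrightarrow> m \<in> M \<Longrightarrow> min n m \<ge> K \<Longrightarrow> \<bar>haar_partial_sum n m f z\<bar> < B"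
        unfolding eventually_both_to_infinity_in by auto
      \<comment> \<open>Beyond \<open>k0\<close> the point lies in \<open>G k\<close>. The levels
        found there are at least \<open>k\<close>, so the indices exceed \<open>K\<close>, and the
        average reached exceeds \<open>B\<close>.\<close>
      define k where "k = max k0 (max K (nat \<lceil>B\<rceil>))"
      have k: "k0 \<le> k" "K \<le> k" "B \<le> real k" by (auto simp: k_def) linarith
      obtain s t where st: "s \<in> ?D" "t \<in> ?D" "k \<le> s" "k \<le> t"
        and avg: "\<And>p q. p \<in> {s, Suc s} \<Longrightarrow> q \<in> {t, Suc t} \<Longrightarrow> real k + 1 \<le> dyadic_avg (F k) p q z"
        using G_avg[OF k0(2)[OF k(1)]] unfolding F_avg by blast
      obtain n where n: "n \<in> M" "n \<ge> 2" "n > s" "\<And>x. haar_lev n x \<in> {s, Suc s}"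
        using haar_levelsE[OF st(1)] by metis
      obtain m where m: "m \<in> M" "m \<ge> 2" "m > t" "\<And>x. haar_lev m x \<in> {t, Suc t}"
        using haar_levelsE[OF st(2)] by metis
      have "real k + 1 \<le> P k (n, m)" unfolding P_def using avg n(4) m(4) by simp
      also have "\<dots> \<le> (\<Sum>k. P k (n, m))"
      proof -
        \<comment> \<open>All stages have non-negative averages, so a large one cannot be cancelled
          by the others.\<close>
        have "(\<Sum>j\<in>{k}. P j (n, m)) \<le> (\<Sum>j. P j (n, m))"
          using n m F_avg_nn[OF z] by (intro sum_le_suminf P_sums) (auto simp: P_def)
        then show ?thesis by simp
      qed
      also have "\<dots> = haar_partial_sum n m f z" using n m by (intro S_eq[symmetric]) auto
      finally have "B < \<bar>haar_partial_sum n m f z\<bar>" using k by linarith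
      then show False using K[of n m] n m st k by simp
    qed
  qed
  then show ?thesis using f_int by (intro exI[of _ f]) (auto simp: f_def)
qed

section \<open>The equivalence in terms of the distance to \<open>C\<close>\<close>

theorem theorem1p1:
  fixes N M C D :: "nat set"
  assumes "N \<subseteq> {1..}" and "infinite N"
    and "M \<subseteq> {1..}" and "infinite M"
    and "C = haar_levels N" and "D = haar_levels M"
  shows "(\<exists>f :: real \<times> real \<Rightarrow> real.
            f absolutely_integrable_on unit_square \<and> (\<forall>z\<in>unit_square. 0 \<le> f z) \<and>
            (AE z\<in>unit_square in lebesgue.
               ((\<lambda>(n, m). haar_partial_sum n m f z) \<longlongrightarrow> f z) (both_to_infinity_in N) \<and>
               Limsup (both_to_infinity_in M) (\<lambda>(n, m). ereal \<bar>haar_partial_sum n m f z\<bar>) = \<infinity>))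
         \<longleftrightarrow> (SUP n\<in>D. ereal (infdist (real n) (real ` C))) = \<infinity>"
    (is "?L \<longleftrightarrow> ?S = \<infinity>")
proof
  \<comment> \<open>\<open>infdist\<close> to the empty set is 0 by convention, so it is the
    distance to a nearest level only for nonempty \<open>C\<close>.\<close>
  have "C \<noteq> {}"
  proof -
    obtain n where n: "n \<in> N" "n \<ge> 2" using assms(2) infinite_nat_iff_unbounded_le by blast
    from haar_level_cases[OF this] show ?thesis unfolding assms(5) by blast
  qed
  then obtain c0 where c0: "c0 \<in> C" by blast
  show "?S = \<infinity>" if ?L
  proof (rule ccontr)
    assume "?S \<noteq> \<infinity>"
    then obtain L where L: "?S < ereal (real L)"
      by (metis less_PInf_Ex_of_nat)
    have close: "\<exists>c\<in>C. s \<le> c + L \<and> c \<le> s + L" if "s \<in> D" for s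
    proof -
      have "ereal (infdist (real s) (real ` C)) \<le> ?S" using that by (rule SUP_upper)
      also note L
      finally have "infdist (real s) (real ` C) < real L" by simp
      moreover obtain c where "c \<in> C" "infdist (real s) (real ` C) = \<bar>real s - real c\<bar>"
        using infdist_nat_attained[OF \<open>C \<noteq> {}\<close>] by blast
      ultimately show ?thesis by (intro bexI[of _ c]) auto
    qed
    from that obtain f where "f absolutely_integrable_on unit_square" "\<forall>z\<in>unit_square. 0 \<le> f z"
      "AE z\<in>unit_square in lebesgue.
               ((\<lambda>(n, m). haar_partial_sum n m f z) \<longlongrightarrow> f z) (both_to_infinity_in N) \<and>
               Limsup (both_to_infinity_in M) (\<lambda>(n, m). ereal \<bar>haar_partial_sum n m f z\<bar>) = \<infinity>"
      by blast
    from no_divergence_if_levels_close[OF this(1,2) assms(1,3) close[unfolded assms(5,6)] this(3)]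
    show False .
  qed
  show ?L if S: "?S = \<infinity>"
  proof (rule divergence_if_gaps[OF assms(1,3,2)])
    fix g K :: nat
    \<comment> \<open>The term \<open>g\<close> supplies the gap and \<open>K + c0\<close> makes
      \<open>n\<close> large: a number below \<open>c0\<close> is at distance at most
      \<open>c0\<close> from it, so \<open>n\<close> must lie above \<open>c0\<close>, by more than
      \<open>K\<close>.\<close>
    have "ereal (real (g + K + c0)) < ?S" unfolding S by simp
    then obtain n where n: "n \<in> D" "real (g + K + c0) < infdist (real n) (real ` C)"
      unfolding less_SUP_iff by auto
    have far: "real (g + K + c0) < \<bar>real n - real c\<bar>" if "c \<in> C" for c
      using n(2) infdist_le[of "real c" "real ` C" "real n"] that by (simp add: dist_real_def)
    have "K \<le> n" using far[OF c0] by linarith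
    moreover have "c + g \<le> n \<or> n + g \<le> c" if "c \<in> C" for c using far[OF that] by linarith
    ultimately show "\<exists>n\<in>haar_levels M. K \<le> n \<and> (\<forall>c\<in>haar_levels N. c + g \<le> n \<or> n + g \<le> c)"
      using n(1) unfolding assms(5,6) by blast
  qed
qed

end
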